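(* Let $p\ge 1$ and $\alpha\in(0,1]$. Assume that both $\Omega$ and $S$ are uniformly $C^{1,\alpha}$ domains. Let $\mathbf{u}\in W^{1,p}_0(S,\Omega)$ be such that $\operatorname{div}\mathbf{u}=0$. Then there exist positive constants $H_*$, $C_w$, $c_0$ depending only on $S$, $\Omega$, $p$, such that, whenever $h<H_*$ and $\sigma_h:=c_0h^{\frac1{1+\alpha}}$, $$|u_{P3}|\le C_w\,h^{\frac{1+2\alpha}{p(1+\alpha)}\left(p-\frac{3+\alpha}{1+2\alpha}\right)}\|\nabla\mathbf{u}\|_{L^p(\mathcal{C}_{\sigma_h}\cap F)},$$ $$|\mathbf{u}_{P\tau}|\le C_w\,h^{\frac1p\left(p-\frac{3+\alpha}{1+\alpha}\right)}\|\nabla\mathbf{u}\|_{L^p(\mathcal{C}_{\sigma_h}\cap F)},$$ $$|\boldsymbol{\omega}_\tau|\le C_w\,h^{\frac{2\alpha}{p(1+\alpha)}\left(p-\frac{3+\alpha}{2\alpha}\right)}\|\nabla\mathbf{u}\|_{L^p(\mathcal{C}_{\sigma_h}\cap F)},$$ $$|\omega_3|\le C_w\,h^{\frac{\alpha}{p(1+\alpha)}\left(p-\frac{3+\alpha}{\alpha}\right)}\|\nabla\mathbf{u}\|_{L^p(\mathcal{C}_{\sigma_h}\cap F)}.$$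
   Context: $\Omega\subset\mathbb{R}^3$ is a domain, $S\subset\Omega$ is a bounded connected domain, and $F=\Omega\setminus\overline{S}$. A domain $D\subset\mathbb{R}^3$ is uniformly $C^{1,\alpha}$, $\alpha\in(0,1]$, if there are constants $k>0$, $\sigma_0>0$ such that for each $x_0\in\partial D$ there is an isometry $\mathcal{R}:\mathbb{R}^3\to\mathbb{R}^3$ with $\mathcal{R}(0)=x_0$ and $\mathcal{R}(\{x\in\mathbb{R}^3:\ k|\mathbf{x}'|^{1+\alpha}<|x_3|<k\sigma_0^{1+\alpha},\ |\mathbf{x}'|<\sigma_0\})\cap\partial D=\emptyset$, where $\mathbf{x}'=(x_1,x_2)$. For $p\ge1$, $W^{1,p}_0(S,\Omega)$ is the set of vector fields $\mathbf{u}:\Omega\to\mathbb{R}^3$, $\mathbf{u}\in W^{1,p}_0(\Omega)$, for which there are constant vectors $\mathbf{u}_*,\boldsymbol{\omega}\in\mathbb{R}^3$ with $\mathbf{u}(\mathbf{x})=\mathbf{u}_*+\boldsymbol{\omega}\times(\mathbf{x}-\mathbf{x}_* )$ for $\mathbf{x}\in S$, where $\mathbf{x}_*\in\overline{S}$ is a fixed point. $h=\operatorname{dist}(S,\partial\Omega)=|PQ|$, where $P\in\partial S$ and $Q\in\partial\Omega$ are two points that realize the distance; it is assumed throughout that $h<H:=\operatorname{diam}S$. Orthogonal coordinates $(x_1,x_2,x_3)$ are chosen with origin at $Q$ and $P=(0,0,h)$; the plane of $\mathbf{x}'=(x_1,x_2)$ is tangent to $\partial\Omega$ at $Q$ and parallel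 to the tangent plane of $\partial S$ at $P$. In these coordinates, $\mathbf{u}_P=(\mathbf{u}_{P\tau},u_{P3})=(u_{P1},u_{P2},u_{P3})$ is the velocity of the rigid body $S$ at the point $P$, that is $\mathbf{u}_P=\mathbf{u}_*+\boldsymbol{\omega}\times(P-\mathbf{x}_* )$, and $\boldsymbol{\omega}=(\boldsymbol{\omega}_\tau,\omega_3)=(\omega_1,\omega_2,\omega_3)$ is its angular velocity. For $\sigma>0$, $\mathcal{C}_\sigma\cap F=\{|\mathbf{x}'|<\sigma\}\cap F$.
   Formalization: The domain Ω is additionally assumed to lie on one side of its boundary (Ω equals the interior of its closure); without this the literal definition admits ℝ³ minus a point, for which the first estimate fails with p = 2, α = 1. *)

theory Defs
  imports "HOL-Analysis.Analysis"
begin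

definition isometry :: "(real^3 \<Rightarrow> real^3) \<Rightarrow> bool" where
  "isometry R \<longleftrightarrow> (\<forall>x y. dist (R x) (R y) = dist x y)"

definition domain3 :: "(real^3) set \<Rightarrow> bool" where
  "domain3 D \<longleftrightarrow> open D \<and> connected D \<and> D \<noteq> {}"

definition tangential :: "real^3 \<Rightarrow> real^2" where
  "tangential x = vector [x $ 1, x $ 2]"

text \<open>Pitfall: the condition only squeezes \<open>\<partial>D\<close> between two graphs. It does not force \<open>D\<close> to lie on
  one side of \<open>\<partial>D\<close>: the space minus a point, or minus a compact subset of a plane, satisfies it.
  One-sidedness amounts to \<open>interior (closure D) = D\<close>.\<close>

definition uniformly_C1alpha :: "real \<Rightarrow> (real^3) set \<Rightarrow> bool" where
  "uniformly_C1alpha \<alpha> D \<longleftrightarrow>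
     (\<exists>k>0. \<exists>\<sigma>0>0. \<forall>x0\<in>frontier D. \<exists>R. isometry R \<and> R 0 = x0 \<and>
        R ` {x. k * norm (tangential x) powr (1 + \<alpha>) < \<bar>x $ 3\<bar> \<and>
                \<bar>x $ 3\<bar> < k * \<sigma>0 powr (1 + \<alpha>) \<and> norm (tangential x) < \<sigma>0}
          \<inter> frontier D = {})"

primrec Ck :: "nat \<Rightarrow> (real^3 \<Rightarrow> 'b::real_normed_vector) \<Rightarrow> bool" where
  "Ck 0 f \<longleftrightarrow> continuous_on UNIV f"
| "Ck (Suc k) f \<longleftrightarrow> (\<forall>x. f differentiable (at x)) \<and>
     (\<forall>j. Ck k (\<lambda>x. frechet_derivative f (at x) (axis j 1)))"

text \<open>The functions of class \<open>C\<^sub>c\<^sup>\<infinity>(\<Omega>)\<close>, extended by zero to the whole space.\<close>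

definition test_function :: "(real^3) set \<Rightarrow> (real^3 \<Rightarrow> 'b::real_normed_vector) \<Rightarrow> bool" where
  "test_function \<Omega> \<phi> \<longleftrightarrow> (\<forall>k. Ck k \<phi>) \<and>
     compact (closure {x. \<phi> x \<noteq> 0}) \<and> closure {x. \<phi> x \<noteq> 0} \<subseteq> \<Omega>"

definition Lp :: "real \<Rightarrow> (real^3) set \<Rightarrow> (real^3 \<Rightarrow> 'b::euclidean_space) \<Rightarrow> bool" where
  "Lp p A f \<longleftrightarrow> f \<in> borel_measurable (lebesgue_on A) \<and>
     integrable (lebesgue_on A) (\<lambda>x. norm (f x) powr p)"

text \<open>Meaningful only for functions satisfying \<^const>\<open>Lp\<close>: the Bochner integral of a
  non-integrable function is 0.\<close>

definition Lp_norm :: "real \<Rightarrow> (real^3) set \<Rightarrow> (real^3 \<Rightarrow> 'b::euclidean_space) \<Rightarrow> real" where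
  "Lp_norm p A f = (integral\<^sup>L (lebesgue_on A) (\<lambda>x. norm (f x) powr p)) powr (1 / p)"

text \<open>\<open>G x $ i $ j\<close> is the weak derivative of the \<open>i\<close>-th component of \<open>u\<close> in direction \<open>j\<close>;
  the norm on \<^typ>\<open>real^3^3\<close> is the Frobenius norm.\<close>

definition weak_gradient :: "(real^3) set \<Rightarrow> (real^3 \<Rightarrow> real^3) \<Rightarrow> (real^3 \<Rightarrow> real^3^3) \<Rightarrow> bool" where
  "weak_gradient \<Omega> u G \<longleftrightarrow>
     (\<forall>K. compact K \<and> K \<subseteq> \<Omega> \<longrightarrow> u absolutely_integrable_on K \<and> G absolutely_integrable_on K) \<and>
     (\<forall>\<phi>::real^3 \<Rightarrow> real. test_function \<Omega> \<phi> \<longrightarrow> (\<forall>i j.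
        integral\<^sup>L (lebesgue_on \<Omega>) (\<lambda>x. u x $ i * frechet_derivative \<phi> (at x) (axis j 1))
          = - integral\<^sup>L (lebesgue_on \<Omega>) (\<lambda>x. G x $ i $ j * \<phi> x)))"

text \<open>\<open>W\<^sub>0\<^sup>1\<^sup>,\<^sup>p(\<Omega>)\<close> is the closure of \<open>C\<^sub>c\<^sup>\<infinity>(\<Omega>)\<close> in \<open>W\<^sup>1\<^sup>,\<^sup>p(\<Omega>)\<close>.\<close>

definition W1p0 :: "real \<Rightarrow> (real^3) set \<Rightarrow> (real^3 \<Rightarrow> real^3) set" where
  "W1p0 p \<Omega> = {u. \<exists>G. weak_gradient \<Omega> u G \<and> Lp p \<Omega> u \<and> Lp p \<Omega> G \<and>
     (\<exists>\<phi>. (\<forall>n. test_function \<Omega> (\<phi> n)) \<and>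
        (\<lambda>n. Lp_norm p \<Omega> (\<lambda>x. \<phi> n x - u x)) \<longlonglongrightarrow> 0 \<and>
        (\<lambda>n. Lp_norm p \<Omega> (\<lambda>x. jacobian (\<phi> n) (at x) - G x)) \<longlonglongrightarrow> 0)}"

text \<open>Sobolev functions are represented by functions defined up to null sets, so the rigidity
  condition is an almost-everywhere statement.\<close>

definition rigid_on :: "(real^3) set \<Rightarrow> real^3 \<Rightarrow> real^3 \<Rightarrow> real^3 \<Rightarrow> (real^3 \<Rightarrow> real^3) \<Rightarrow> bool" where
  "rigid_on S xs us \<omega> u \<longleftrightarrow>
     (AE x in lebesgue. x \<in> S \<longrightarrow> u x = us + cross3 \<omega> (x - xs))"

definition W1p0_body :: "real \<Rightarrow> real^3 \<Rightarrow> (real^3) set \<Rightarrow> (real^3) set \<Rightarrow> (real^3 \<Rightarrow> real^3) set" where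
  "W1p0_body p xs S \<Omega> = {u \<in> W1p0 p \<Omega>. \<exists>us \<omega>. rigid_on S xs us \<omega> u}"

definition cylinder :: "real \<Rightarrow> (real^3) set" where
  "cylinder \<sigma> = {x. norm (tangential x) < \<sigma>}"

end

theory Submission
  imports Defs
begin

text \<open>Let \<open>\<sigma> = c\<^sub>0 h\<^bsup>1/(1+\<alpha>)\<^esup>\<close> with \<open>k c\<^sub>0\<^bsup>1+\<alpha>\<^esup> = 1\<close>, where \<open>k\<close> is the constant of the boundary condition, and
\<open>s = \<sigma>/2\<close>. Let \<open>V\<close>, of order \<open>s\<^sup>2 h\<close> and hence of order \<open>h\<^bsup>(3+\<alpha>)/(1+\<alpha>)\<^esup>\<close>, be the volume of a box around the gap of width
\<open>2s\<close> and of height of order \<open>h\<close>, and put \<open>A = V\<^bsup>-1/p\<^esup> N\<close>, where \<open>N\<close> is the norm on the right-hand sides. Then the four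
estimates say that, up to constants, \<open>\<bar>u\<^sub>P\<^sub>3\<bar> \<le> (h\<^sup>2/s) A\<close>, \<open>\<bar>u\<^sub>P\<^sub>\<tau>\<bar> \<le> h A\<close>, \<open>\<bar>\<omega>\<^sub>\<tau>\<bar> \<le> (h/s)\<^sup>2 A\<close> and
\<open>\<bar>\<omega>\<^sub>3\<bar> \<le> (h/s) A\<close>.

Geometry. Inside \<open>\<bar>x'\<bar> < \<sigma>\<close> the slab \<open>2h < x\<^sub>3 < 3h\<close> lies in the body and the slab \<open>-2h < x\<^sub>3 < -h\<close> lies
outside the cavity. The condition on the boundary provides, at each boundary point, two opposite cusps that avoid the
boundary. At points that are nearest to a point of an open set, one of the two cusps lies in the set, and a limit of such
cusps lies in the set as well (lemma \<open>interior_cusp_exists\<close>). This applies to the body at \<open>P\<close> and to the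
complement of the closed cavity at \<open>Q\<close>. These cusps are disjoint from the balls of radius \<open>h\<close> around \<open>Q\<close> and \<open>P\<close>,
so their axes must be vertical (lemma \<open>cusp_axis_unique\<close>).

Analysis. A field in the closure of the test functions, extended by zero, satisfies the weak identity
\<open>\<integral> u\<^sub>i \<partial>\<^sub>j\<psi> = - \<integral> G\<^sub>i\<^sub>j \<psi>\<close> for all \<open>C\<^sup>1\<close> functions \<open>\<psi>\<close> of bounded support on the whole space, and \<open>G\<close> is determined
almost everywhere by \<open>u\<close>; on the body it is the constant antisymmetric matrix of \<open>\<omega>\<close>. Everything is read off from this
identity with \<open>\<psi> = a(x\<^sub>1/s) b(x\<^sub>2/s) \<Theta>(x\<^sub>3/h)\<close>, where \<open>\<Theta>(t) = t\<close> in the gap and \<open>\<Theta> = 0\<close> beyond the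
two slabs. The second derivative \<open>\<Theta>''\<close> then lives on the slabs only: on the upper one \<open>u\<close> is the rigid motion,
on the lower one \<open>u = 0\<close>. Testing with \<open>\<partial>\<^sub>3\<psi>\<close> bounds the moments of \<open>u\<^sub>i\<close> on the upper slab by \<open>h \<integral> \<bar>G\<^sub>i\<^sub>3\<bar>\<close>.
For \<open>u\<^sub>3\<close>, the equation \<open>div u = 0\<close> tested with \<open>\<partial>\<^sub>3\<psi>\<close> replaces \<open>\<partial>\<^sub>3\<partial>\<^sub>3\<psi>\<close> by \<open>\<partial>\<^sub>1\<partial>\<^sub>3\<psi>\<close> and \<open>\<partial>\<^sub>2\<partial>\<^sub>3\<psi>\<close>
acting on \<open>u\<^sub>1\<close> and \<open>u\<^sub>2\<close>, which gains the factor \<open>h/s\<close>. Choosing \<open>a\<close> and \<open>b\<close> even or odd isolates each of the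
components of \<open>u\<^sub>P\<close> and \<open>\<omega>\<close> (lemma \<open>gap_estimates\<close>).

The box contains a piece of the body, where \<open>G\<^sub>i\<^sub>3\<close> does not vanish but is bounded by \<open>\<bar>\<omega>\<^sub>\<tau>\<bar>\<close>. This
contributes a term \<open>(h/s)\<^sup>2 \<bar>\<omega>\<^sub>\<tau>\<bar>\<close> to the bound of \<open>\<bar>\<omega>\<^sub>\<tau>\<bar>\<close> itself, which is absorbed for small \<open>h\<close> because \<open>h/s \<longlonglongrightarrow> 0\<close>
(lemma \<open>absorption\<close>). The boundary of the body is a null set, since near each of its points it lies in slabs
that are thin relative to balls (lemma \<open>negligible_squeezed\<close>).\<close>

section \<open>Cusps at the boundary of a uniformly regular domain\<close>

lemma isometry_decompose:
  assumes "isometry R"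
  obtains A where "orthogonal_transformation A" "\<And>x. R x = R 0 + A x"
proof
  show "orthogonal_transformation (\<lambda>x. R x - R 0)"
    using assms by (simp add: orthogonal_transformation_isometry isometry_def dist_norm)
qed simp

lemma norm_tangential: "norm (tangential x) = norm (x - (x \<bullet> axis 3 1) *\<^sub>R axis 3 1)"
proof -
  have "(norm (tangential x))\<^sup>2 = (x $ 1)\<^sup>2 + (x $ 2)\<^sup>2"
    unfolding power2_norm_eq_inner inner_vec_def tangential_def
    by (simp add: sum_2 power2_eq_square)
  moreover have "(norm (x - (x \<bullet> axis 3 1) *\<^sub>R axis 3 1))\<^sup>2 = (x $ 1)\<^sup>2 + (x $ 2)\<^sup>2"
    unfolding power2_norm_eq_inner inner_vec_def
    by (simp add: sum_3 power2_eq_square axis_def inner_axis)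
  ultimately show ?thesis
    by (metis norm_ge_zero power2_eq_iff_nonneg)
qed

text \<open>One half of a region as in \<^const>\<open>uniformly_C1alpha\<close>, with \<open>\<delta>\<close> limiting both its height and its radius. It is described
by its apex and its unit axis instead of an isometry: the region is rotationally symmetric, and the possible axes form a
compact set.\<close>

definition cusp :: "real \<Rightarrow> real \<Rightarrow> real \<Rightarrow> real^3 \<Rightarrow> real^3 \<Rightarrow> (real^3) set" where
  "cusp k \<delta> \<beta> x m = {y. k * norm ((y - x) - ((y - x) \<bullet> m) *\<^sub>R m) powr \<beta> < (y - x) \<bullet> m \<and>
     (y - x) \<bullet> m < \<delta> \<and> norm ((y - x) - ((y - x) \<bullet> m) *\<^sub>R m) < \<delta>}"

definition squeezed :: "real \<Rightarrow> real \<Rightarrow> real \<Rightarrow> (real^3) set \<Rightarrow> bool" where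
  "squeezed k \<delta> \<beta> \<Gamma> \<longleftrightarrow> (\<forall>x\<in>\<Gamma>. \<exists>m. norm m = 1 \<and>
     cusp k \<delta> \<beta> x m \<inter> \<Gamma> = {} \<and> cusp k \<delta> \<beta> x (- m) \<inter> \<Gamma> = {})"

lemma cusp_orthogonal_image:
  assumes A: "orthogonal_transformation A"
  shows "x + A v \<in> cusp k \<delta> \<beta> x (A m) \<longleftrightarrow> v \<in> cusp k \<delta> \<beta> 0 m"
proof -
  have lin: "linear A" and inn: "\<And>v w. A v \<bullet> A w = v \<bullet> w"
    using A by (auto simp: orthogonal_transformation_def)
  have "A v - (v \<bullet> m) *\<^sub>R A m = A (v - (v \<bullet> m) *\<^sub>R m)"
    by (simp add: lin linear_diff linear_scale)
  then have "norm (A v - (v \<bullet> m) *\<^sub>R A m) = norm (v - (v \<bullet> m) *\<^sub>R m)"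
    using A orthogonal_transformation by metis
  then show ?thesis
    by (simp add: cusp_def inn)
qed

lemma cusp_translate: "x + v \<in> cusp k \<delta> \<beta> x m \<longleftrightarrow> v \<in> cusp k \<delta> \<beta> 0 m"
  by (simp add: cusp_def)

lemma uniformly_C1alpha_imp_squeezed:
  assumes "uniformly_C1alpha \<alpha> D"
  obtains k \<delta> where "k > 0" "\<delta> > 0" "squeezed k \<delta> (1 + \<alpha>) (frontier D)"
proof -
  obtain k \<sigma> where k: "k > 0" "\<sigma> > 0" and R: "\<And>x0. x0 \<in> frontier D \<Longrightarrow> \<exists>R. isometry R \<and> R 0 = x0 \<and>
        R ` {x. k * norm (tangential x) powr (1 + \<alpha>) < \<bar>x $ 3\<bar> \<and>
                \<bar>x $ 3\<bar> < k * \<sigma> powr (1 + \<alpha>) \<and> norm (tangential x) < \<sigma>}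
          \<inter> frontier D = {}"
    using assms unfolding uniformly_C1alpha_def by auto
  define \<delta> where "\<delta> = min \<sigma> (k * \<sigma> powr (1 + \<alpha>))"
  have "squeezed k \<delta> (1 + \<alpha>) (frontier D)"
    unfolding squeezed_def
  proof
    fix x0 assume "x0 \<in> frontier D"
    then obtain R where R: "isometry R" "R 0 = x0"
      "R ` {x. k * norm (tangential x) powr (1 + \<alpha>) < \<bar>x $ 3\<bar> \<and>
                \<bar>x $ 3\<bar> < k * \<sigma> powr (1 + \<alpha>) \<and> norm (tangential x) < \<sigma>}
          \<inter> frontier D = {}"
      using R by blast
    obtain A where A: "orthogonal_transformation A" "\<And>x. R x = x0 + A x"
      using isometry_decompose[OF R(1)] R(2) by metis
    have lin: "linear A" and surj: "surj A"
      using A(1) by (auto simp: orthogonal_transformation_linear orthogonal_transformation_surj)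
    have nm: "norm (A (axis 3 1)) = 1"
      using A(1) by (simp add: orthogonal_transformation_norm)
    have sub: "cusp k \<delta> (1+\<alpha>) x0 (A e) \<inter> frontier D = {}" if "e = axis 3 1 \<or> e = - axis 3 1" for e
    proof -
      have "y \<in> R ` {x. k * norm (tangential x) powr (1 + \<alpha>) < \<bar>x $ 3\<bar> \<and>
                \<bar>x $ 3\<bar> < k * \<sigma> powr (1 + \<alpha>) \<and> norm (tangential x) < \<sigma>}"
        if y: "y \<in> cusp k \<delta> (1+\<alpha>) x0 (A e)" for y
      proof -
        obtain v where v: "y = x0 + A v"
          by (metis surj surjD add.commute diff_add_cancel)
        have "v \<in> cusp k \<delta> (1+\<alpha>) 0 e"
          using y v cusp_orthogonal_image[OF A(1)] by blast
        then have "k * norm (tangential v) powr (1 + \<alpha>) < \<bar>v $ 3\<bar> \<and>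
                \<bar>v $ 3\<bar> < k * \<sigma> powr (1 + \<alpha>) \<and> norm (tangential v) < \<sigma>"
          using \<open>e = axis 3 1 \<or> e = - axis 3 1\<close> k mult_nonneg_nonneg[of k "norm (tangential v) powr (1 + \<alpha>)"] 
          by (auto simp: cusp_def norm_tangential[of v] \<delta>_def inner_axis abs_if simp del: mult_nonneg_nonneg)
        moreover have "y = R v" using v A(2) by simp
        ultimately show ?thesis by blast
      qed
      then show ?thesis using R(3) by blast
    qed
    have "- A (axis 3 1) = A (- axis 3 1)"
      by (simp add: lin linear_neg)
    then show "\<exists>m. norm m = 1 \<and> cusp k \<delta> (1 + \<alpha>) x0 m \<inter> frontier D = {} \<and>
             cusp k \<delta> (1 + \<alpha>) x0 (- m) \<inter> frontier D = {}"
      using nm sub by (intro exI[of _ "A (axis 3 1)"]) auto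
  qed
  moreover have "\<delta> > 0" using k by (simp add: \<delta>_def)
  ultimately show ?thesis using that k by blast
qed

lemma squeezed_isometry:
  assumes f: "isometry f" and sq: "squeezed k \<delta> \<beta> \<Gamma>"
  shows "squeezed k \<delta> \<beta> (f ` \<Gamma>)"
  unfolding squeezed_def
proof clarify
  fix x assume "x \<in> \<Gamma>"
  then obtain m where m: "norm m = 1" "cusp k \<delta> \<beta> x m \<inter> \<Gamma> = {}" "cusp k \<delta> \<beta> x (- m) \<inter> \<Gamma> = {}"
    using sq by (auto simp: squeezed_def)
  obtain A where A: "orthogonal_transformation A" "\<And>x. f x = f 0 + A x"
    using isometry_decompose[OF f] by metis
  have lin: "linear A" using A(1) by (auto simp: orthogonal_transformation_linear)
  have key: "cusp k \<delta> \<beta> (f x) (A e) \<inter> f ` \<Gamma> = {}" if "cusp k \<delta> \<beta> x e \<inter> \<Gamma> = {}" for e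
  proof -
    have "f y \<notin> cusp k \<delta> \<beta> (f x) (A e)" if "y \<in> \<Gamma>" for y
    proof
      assume *: "f y \<in> cusp k \<delta> \<beta> (f x) (A e)"
      have "f y = f x + A (y - x)"
        using A(2)[of x] A(2)[of y] by (simp add: lin linear_diff)
      then have "y - x \<in> cusp k \<delta> \<beta> 0 e"
        using * cusp_orthogonal_image[OF A(1)] by metis
      then have "y \<in> cusp k \<delta> \<beta> x e"
        using cusp_translate[of x "y - x"] by simp
      then show False using \<open>cusp k \<delta> \<beta> x e \<inter> \<Gamma> = {}\<close> that by blast
    qed
    then show ?thesis by blast
  qed
  have "A (- m) = - A m" by (simp add: lin linear_neg)
  then show "\<exists>m. norm m = 1 \<and> cusp k \<delta> \<beta> (f x) m \<inter> f ` \<Gamma> = {} \<and>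
        cusp k \<delta> \<beta> (f x) (- m) \<inter> f ` \<Gamma> = {}"
    using key[OF m(2)] key[OF m(3)] m(1) A(1)
    by (intro exI[of _ "A m"]) (auto simp: orthogonal_transformation_norm)
qed

lemma isometry_topology:
  assumes f: "isometry f"
  shows isometry_frontier_image: "frontier (f ` D) = f ` frontier D"
    and isometry_closure_image: "closure (f ` D) = f ` closure D"
    and isometry_interior_image: "interior (f ` D) = f ` interior D"
proof -
  obtain A where A: "orthogonal_transformation A" "\<And>x. f x = f 0 + A x"
    using isometry_decompose[OF f] by metis
  have lin: "linear A" and inj: "inj A"
    using A(1) by (auto simp: orthogonal_transformation_linear orthogonal_transformation_inj)
  define c where "c = f 0"
  have A2: "f x = c + A x" for x using A(2)[of x] by (simp only: c_def)
  have eq: "f ` X = (+) c ` A ` X" for X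
    by (auto simp: A2 image_image)
  have injf: "inj f" using inj by (auto simp: inj_def A2)
  show cl: "closure (f ` D) = f ` closure D"
    unfolding eq closure_translation using closure_injective_linear_image[OF lin inj] by simp
  have "surj A" using lin inj by (simp add: linear_inj_imp_surj)
  then show int: "interior (f ` D) = f ` interior D"
    unfolding eq interior_translation using interior_surjective_linear_image[OF lin] inj
    by (simp add: interior_bijective_linear_image[OF lin] bij_def)
  show "frontier (f ` D) = f ` frontier D"
    unfolding frontier_def cl int using injf by (simp add: image_set_diff)
qed

text \<open>A cusp is star-shaped about every point of its axis, because \<open>(t \<rho>)\<^sup>\<beta> \<le> t \<rho>\<^sup>\<beta>\<close> for \<open>0 \<le> t \<le> 1\<close>
and \<open>\<beta> \<ge> 1\<close>.\<close>

lemma connected_cusp: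
  assumes "k > 0" "\<delta> > 0" "\<beta> \<ge> 1" "norm m = 1"
  shows "connected (cusp k \<delta> \<beta> x m)"
proof (rule starlike_imp_connected)
  let ?c = "x + (\<delta>/2) *\<^sub>R m"
  have mm: "m \<bullet> m = 1" using assms(4) by (simp add: dot_square_norm)
  have c: "?c \<in> cusp k \<delta> \<beta> x m" using assms mm by (auto simp: cusp_def)
  have "closed_segment ?c y \<subseteq> cusp k \<delta> \<beta> x m" if y: "y \<in> cusp k \<delta> \<beta> x m" for y
  proof
    fix z assume "z \<in> closed_segment ?c y"
    then obtain t where t: "0 \<le> t" "t \<le> 1" and z: "z = (1 - t) *\<^sub>R ?c + t *\<^sub>R y"
      by (auto simp: in_segment)
    define s where "s = (y - x) \<bullet> m"
    define w where "w = (y - x) - s *\<^sub>R m"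
    have yb: "k * norm w powr \<beta> < s" "s < \<delta>" "norm w < \<delta>"
      using y by (auto simp: cusp_def s_def w_def)
    have zx: "z - x = t *\<^sub>R (y - x) + ((1 - t) * (\<delta>/2)) *\<^sub>R m"
      by (simp add: z algebra_simps scaleR_left_diff_distrib)
    have s': "(z - x) \<bullet> m = t * s + (1 - t) * (\<delta>/2)"
      by (simp add: zx s_def inner_add_left mm)
    have w': "(z - x) - ((z - x) \<bullet> m) *\<^sub>R m = t *\<^sub>R w"
      unfolding s' unfolding zx w_def by (simp add: algebra_simps)
    have nw: "norm (t *\<^sub>R w) = t * norm w" using t by simp
    have "t powr \<beta> \<le> t"
    proof (cases "t = 0")
      case False
      then have "t powr \<beta> \<le> t powr 1" using t assms by (intro powr_mono') auto
      then show ?thesis using t by simp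
    qed simp
    then have "k * (t * norm w) powr \<beta> \<le> k * (t * norm w powr \<beta>)"
      using t assms by (simp add: powr_mult mult_left_mono mult_right_mono)
    also have "\<dots> = t * (k * norm w powr \<beta>)" by simp
    also have "\<dots> < t * s + (1 - t) * (\<delta>/2)"
    proof (cases "t = 0")
      case True then show ?thesis using assms by simp
    next
      case False
      then have "t * (k * norm w powr \<beta>) < t * s" using yb(1) t by simp
      moreover have "0 \<le> (1 - t) * (\<delta>/2)" using t assms by simp
      ultimately show ?thesis by linarith
    qed
    finally have 1: "k * (t * norm w) powr \<beta> < t * s + (1 - t) * (\<delta>/2)" .
    have "t * s + (1 - t) * (\<delta>/2) < \<delta>"
      using convex_bound_lt[of s \<delta> "\<delta>/2" t "1 - t"] yb t assms by simp
    moreover have "t * norm w < \<delta>"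
      using mult_left_le_one_le[of "norm w" t] t yb by (simp add: mult.commute)
    ultimately show "z \<in> cusp k \<delta> \<beta> x m"
      unfolding cusp_def using 1 s' w' nw by auto
  qed
  then show "starlike (cusp k \<delta> \<beta> x m)" using c unfolding starlike_def by blast
qed

text \<open>Since \<open>\<beta> > 1\<close>, the cusp is tangent to its base plane and fills a half-space to first order.\<close>

lemma cusp_near_apex:
  assumes "\<delta> > 0" "\<beta> > 1" "v \<bullet> m > 0"
  shows "\<forall>\<^sub>F t in at_right 0. x + t *\<^sub>R v \<in> cusp k \<delta> \<beta> x m"
proof -
  define s where "s = v \<bullet> m"
  define w where "w = v - s *\<^sub>R m"
  have t0: "((\<lambda>t::real. t) \<longlongrightarrow> 0) (at_right 0)" by (rule tendsto_ident_at)
  have "((\<lambda>t. k * norm w powr \<beta> * t powr (\<beta> - 1)) \<longlongrightarrow> k * norm w powr \<beta> * 0 powr (\<beta> - 1)) (at_right 0)"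
    using assms by (intro tendsto_intros t0 tendsto_powr2) (auto simp: eventually_at_right_less intro: eventually_mono[OF eventually_at_right_less])
  then have 1: "\<forall>\<^sub>F t in at_right 0. k * norm w powr \<beta> * t powr (\<beta> - 1) < s"
    using assms by (intro order_tendstoD) (auto simp: s_def)
  have "((\<lambda>t. t * s) \<longlongrightarrow> 0 * s) (at_right 0)" by (intro tendsto_intros t0)
  then have 2: "\<forall>\<^sub>F t in at_right 0. t * s < \<delta>" using assms by (intro order_tendstoD) auto
  have "((\<lambda>t. t * norm w) \<longlongrightarrow> 0 * norm w) (at_right 0)" by (intro tendsto_intros t0)
  then have 3: "\<forall>\<^sub>F t in at_right 0. t * norm w < \<delta>" using assms by (intro order_tendstoD) auto
  have 4: "\<forall>\<^sub>F t::real in at_right 0. 0 < t" by (rule eventually_at_right_less)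
  from 1 2 3 4 show ?thesis
  proof eventually_elim
    case (elim t)
    have "t *\<^sub>R v - (t *\<^sub>R v \<bullet> m) *\<^sub>R m = t *\<^sub>R w" by (simp add: w_def s_def algebra_simps)
    then have n: "norm (t *\<^sub>R v - (t *\<^sub>R v \<bullet> m) *\<^sub>R m) = t * norm w" using elim by simp
    have "k * (t * norm w) powr \<beta> = t * (k * norm w powr \<beta> * t powr (\<beta> - 1))"
      using elim by (simp add: powr_mult powr_diff)
    also have "\<dots> < t * s" using elim by simp
    finally show ?case using elim n by (simp add: cusp_def s_def)
  qed
qed

text \<open>If \<open>m\<close> were different from \<open>- e\<close>, the direction \<open>m + e\<close> would have positive inner products with both \<open>m\<close> and
\<open>e\<close>, and would enter both the cusp and the ball.\<close>

lemma cusp_axis_unique: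
  assumes "\<delta> > 0" "\<beta> > 1" "norm m = 1" "norm e = 1" "r > 0"
    and disj: "cusp k \<delta> \<beta> x m \<inter> ball (x + r *\<^sub>R e) r = {}"
  shows "m = - e"
proof (rule ccontr)
  assume "m \<noteq> - e"
  define q where "q = 1 + m \<bullet> e"
  have ee: "m \<bullet> m = 1" "e \<bullet> e = 1" using assms by (auto simp: dot_square_norm)
  have "(m + e) \<bullet> (m + e) > 0"
    using \<open>m \<noteq> - e\<close> by (simp add: eq_neg_iff_add_eq_0)
  moreover have vv: "(m + e) \<bullet> (m + e) = 2 * q"
    by (simp add: q_def ee inner_add_left inner_add_right inner_commute)
  ultimately have q: "q > 0" by simp
  have vm: "(m + e) \<bullet> m = q" "(m + e) \<bullet> e = q"
    by (simp_all add: q_def ee inner_add_left inner_add_right inner_commute)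
  have "\<forall>\<^sub>F t in at_right 0. x + t *\<^sub>R (m + e) \<in> cusp k \<delta> \<beta> x m"
    using q vm assms by (intro cusp_near_apex) auto
  moreover have "\<forall>\<^sub>F t in at_right 0. t < r" "\<forall>\<^sub>F t::real in at_right 0. 0 < t"
    using assms by (auto simp: eventually_at_right_less eventually_at_right_field)
  ultimately have "\<forall>\<^sub>F t::real in at_right 0. False"
  proof eventually_elim
    case (elim t)
    have "(norm (r *\<^sub>R e - t *\<^sub>R (m + e)))\<^sup>2 = r\<^sup>2 - 2 * t * r * q + t\<^sup>2 * (2 * q)"
      unfolding power2_norm_eq_inner
      using vv vm(2) ee by (simp add: inner_diff_left inner_diff_right power2_eq_square inner_commute)
    also have "\<dots> = r\<^sup>2 - 2 * t * q * (r - t)" by (simp add: algebra_simps power2_eq_square)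
    also have "\<dots> < r\<^sup>2" using elim q by simp
    finally have "norm (r *\<^sub>R e - t *\<^sub>R (m + e)) < r"
      by (rule power_less_imp_less_base) (use assms in auto)
    then have "x + t *\<^sub>R (m + e) \<in> ball (x + r *\<^sub>R e) r"
      by (simp add: dist_norm)
    then show False using elim disj by blast
  qed
  then show False by simp
qed

lemma norm_orthogonal_part_le:
  assumes "norm m = 1"
  shows "norm (v - (v \<bullet> m) *\<^sub>R m) \<le> norm v"
proof -
  have "(norm (v - (v \<bullet> m) *\<^sub>R m))\<^sup>2 = (norm v)\<^sup>2 - (v \<bullet> m)\<^sup>2"
    unfolding power2_norm_eq_inner using assms dot_square_norm[of m]
    by (simp add: inner_diff_left inner_diff_right inner_commute power2_eq_square)
  also have "\<dots> \<le> (norm v)\<^sup>2" by simp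
  finally show ?thesis by (rule power2_le_imp_le) simp
qed

text \<open>The apex lies on the sphere, and the axis does not point away from the centre, which may lie in the base
plane of the cusp. Going the fraction \<open>a\<^sup>2\<close> of the way to the centre, one can still climb by \<open>a r / 2\<close> along the axis
without leaving the ball. The height is linear in \<open>a\<close> and the horizontal distance quadratic, so the point reached
is in the cusp for small \<open>a\<close>.\<close>

lemma cusp_meets_ball:
  assumes "\<delta> > 0" "\<beta> > 1" "k > 0" "norm m = 1" "norm v = r" "r > 0" "v \<bullet> m \<ge> 0"
  shows "cusp k \<delta> \<beta> x m \<inter> ball (x + v) r \<noteq> {}"
proof -
  have mm: "m \<bullet> m = 1" using assms by (simp add: dot_square_norm)
  have "((\<lambda>a::real. a * r / 2 + a\<^sup>2 * r) \<longlongrightarrow> 0 * r / 2 + 0\<^sup>2 * r) (at_right 0)"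
    by (intro tendsto_intros tendsto_ident_at) simp
  then have 1: "\<forall>\<^sub>F a in at_right 0. a * r / 2 + a\<^sup>2 * r < \<delta>"
    using assms by (intro order_tendstoD) auto
  have "((\<lambda>a::real. k * r powr \<beta> * a) \<longlongrightarrow> k * r powr \<beta> * 0) (at_right 0)"
    by (intro tendsto_intros tendsto_ident_at)
  then have 2: "\<forall>\<^sub>F a in at_right 0. k * r powr \<beta> * a < r / 2"
    using assms by (intro order_tendstoD) auto
  have 3: "\<forall>\<^sub>F a::real in at_right 0. 0 < a" "\<forall>\<^sub>F a::real in at_right 0. a < 1"
    by (auto simp: eventually_at_right_less eventually_at_right_field intro: exI[of _ 1])
  obtain a where a: "a * r / 2 + a\<^sup>2 * r < \<delta>" "k * r powr \<beta> * a < r / 2" "0 < a" "a < 1"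
    using eventually_happens[OF eventually_conj[OF eventually_conj[OF 1 2] eventually_conj[OF 3]]]
    by (auto simp: trivial_limit_at_right_real)
  define t where "t = a\<^sup>2"
  define \<tau> where "\<tau> = a * r / 2"
  have t: "0 < t" "t < 1" using a by (auto simp: t_def power_less_one_iff)
  define p where "p = t *\<^sub>R v + \<tau> *\<^sub>R m"
  define s where "s = v \<bullet> m"
  define w where "w = v - s *\<^sub>R m"
  have nw: "norm w \<le> r" using norm_orthogonal_part_le[OF assms(4), of v] assms(5) by (simp add: w_def s_def)
  have sle: "s \<le> r" using Cauchy_Schwarz_ineq2[of v m] assms by (simp add: s_def)
  have s': "p \<bullet> m = t * s + \<tau>" by (simp add: p_def s_def inner_add_left mm)
  have w': "p - (p \<bullet> m) *\<^sub>R m = t *\<^sub>R w" unfolding s' by (simp add: p_def w_def algebra_simps)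
  have n': "norm (p - (p \<bullet> m) *\<^sub>R m) = t * norm w" using w' t by simp
  have tw: "t * norm w \<le> t * r" using nw t by simp
  have ts: "0 \<le> t * s" using assms(7) t by (simp add: s_def)
  have "k * (t * norm w) powr \<beta> \<le> k * (t * r) powr \<beta>"
    using tw t assms by (intro mult_left_mono powr_mono2) auto
  also have "\<dots> \<le> k * (t * r powr \<beta>)"
  proof -
    have "t powr \<beta> \<le> t powr 1" using t assms by (intro powr_mono') auto
    then show ?thesis using t assms by (simp add: powr_mult)
  qed
  also have "\<dots> = a * (k * r powr \<beta> * a)" by (simp add: t_def power2_eq_square)
  also have "\<dots> < \<tau>" using a by (simp add: \<tau>_def)
  also have "\<tau> \<le> p \<bullet> m" using ts s' by simp
  finally have c1: "k * (t * norm w) powr \<beta> < p \<bullet> m" .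
  have c2: "p \<bullet> m < \<delta>"
  proof -
    have "t * s \<le> t * r" using sle t by simp
    then show ?thesis using a(1) s' by (simp add: \<tau>_def t_def)
  qed
  have c3: "t * norm w < \<delta>"
    using tw a(1) mult_pos_pos[OF a(3) assms(6)] by (simp add: t_def)
  have "x + p \<in> cusp k \<delta> \<beta> x m" using c1 c2 c3 n' by (simp add: cusp_def)
  moreover have "x + p \<in> ball (x + v) r"
  proof -
    have "v - p = (1 - t) *\<^sub>R v - \<tau> *\<^sub>R m" by (simp add: p_def algebra_simps)
    then have "(norm (v - p))\<^sup>2 = (1 - t)\<^sup>2 * (v \<bullet> v) - 2 * ((1 - t) * \<tau> * s) + \<tau>\<^sup>2"
      unfolding power2_norm_eq_inner s_def
      by (simp add: inner_diff_left inner_diff_right mm power2_eq_square inner_commute)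
    also have "\<dots> \<le> (1 - t)\<^sup>2 * r\<^sup>2 + \<tau>\<^sup>2"
    proof -
      have "v \<bullet> v = r\<^sup>2" using assms by (simp add: dot_square_norm)
      moreover have "0 \<le> 2 * ((1 - t) * \<tau> * s)"
        using assms t a by (simp add: \<tau>_def s_def)
      ultimately show ?thesis by simp
    qed
    also have "\<dots> = r\<^sup>2 - (7/4 - t) * t * r\<^sup>2"
      by (simp add: \<tau>_def t_def power2_eq_square field_simps)
    also have "\<dots> < r\<^sup>2" using t assms by simp
    finally have "norm (v - p) < r" by (rule power_less_imp_less_base) (use assms in auto)
    then show ?thesis by (simp add: dist_norm)
  qed
  ultimately show ?thesis by blast
qed

text \<open>At a boundary point \<open>y\<close> nearest to a point of \<open>D\<close> there is a ball in \<open>D\<close> that touches \<open>y\<close>; it meets one of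
the two cusps at \<open>y\<close>, which therefore lies in \<open>D\<close>. Such points \<open>y\<close> accumulate at every boundary point, and membership
in a cusp is an open condition on apex and axis, so a limit of the axes works. The point \<open>x0\<close> itself may have no nearby
touching ball.\<close>

lemma interior_cusp_exists:
  assumes D: "open D" and x0: "x0 \<in> frontier D" and sq: "squeezed k \<delta> \<beta> (frontier D)"
    and "k > 0" "\<delta> > 0" "\<beta> > 1"
  obtains m where "norm m = 1" "cusp k \<delta> \<beta> x0 m \<subseteq> D"
proof -
  have "x0 \<in> closure D" using x0 by (simp add: frontier_def)
  then obtain X where X: "\<And>n. X n \<in> D" "X \<longlonglongrightarrow> x0" by (auto simp: closure_sequential)
  have "\<exists>y m. norm m = 1 \<and> dist y (X n) \<le> dist x0 (X n) \<and> cusp k \<delta> \<beta> y m \<subseteq> D" for n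
  proof -
    obtain y where y: "y \<in> frontier D" "\<And>z. z \<in> frontier D \<Longrightarrow> dist (X n) y \<le> dist (X n) z"
      using distance_attains_inf[of "frontier D" "X n"] x0 by (metis empty_iff frontier_closed)
    define v where "v = X n - y"
    define r where "r = norm v"
    have "X n \<notin> frontier D" using X(1)[of n] D by (simp add: frontier_def interior_open)
    then have r: "r > 0" using y by (auto simp: r_def v_def)
    have ball: "ball (X n) r \<subseteq> D"
    proof (rule ccontr)
      assume "\<not> ball (X n) r \<subseteq> D"
      then have "ball (X n) r \<inter> frontier D \<noteq> {}"
        using X(1)[of n] r
        by (intro connected_Int_frontier connected_ball) (auto intro!: exI[of _ "X n"] simp: disjoint_iff)
      then obtain z where "z \<in> frontier D" "dist (X n) z < r" by auto
      then show False using y(2)[of z] by (simp add: r_def v_def dist_norm)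
    qed
    obtain m0 where m0: "norm m0 = 1" "cusp k \<delta> \<beta> y m0 \<inter> frontier D = {}"
      "cusp k \<delta> \<beta> y (- m0) \<inter> frontier D = {}"
      using sq y(1) unfolding squeezed_def by blast
    \<comment> \<open>the axis on whose side the touching ball lies\<close>
    define m where "m = (if v \<bullet> m0 \<ge> 0 then m0 else - m0)"
    have m: "norm m = 1" "cusp k \<delta> \<beta> y m \<inter> frontier D = {}" "v \<bullet> m \<ge> 0"
      using m0 by (auto simp: m_def)
    have "cusp k \<delta> \<beta> y m \<inter> ball (y + v) r \<noteq> {}"
      using m r assms by (intro cusp_meets_ball) (auto simp: r_def)
    then have meets: "cusp k \<delta> \<beta> y m \<inter> D \<noteq> {}" using ball by (auto simp: v_def)
    have "connected (cusp k \<delta> \<beta> y m)"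
      using m assms by (intro connected_cusp) auto
    then have "cusp k \<delta> \<beta> y m \<subseteq> D"
      using connected_Int_frontier[of "cusp k \<delta> \<beta> y m" D] meets m(2) by blast
    then show ?thesis using m(1) y(2)[OF x0] by (metis dist_commute)
  qed
  then obtain Y M where YM: "\<And>n. norm (M n) = 1" "\<And>n. dist (Y n) (X n) \<le> dist x0 (X n)"
     "\<And>n. cusp k \<delta> \<beta> (Y n) (M n) \<subseteq> D" by metis
  have "(\<lambda>n. dist x0 (X n)) \<longlonglongrightarrow> dist x0 x0" by (intro tendsto_intros X)
  then have "(\<lambda>n. dist x0 (X n)) \<longlonglongrightarrow> 0" by simp
  then have "(\<lambda>n. Y n - X n) \<longlonglongrightarrow> 0"
    by (rule Lim_null_comparison[rotated]) (use YM(2) in \<open>simp add: dist_norm\<close>)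
  then have Y: "Y \<longlonglongrightarrow> x0" using tendsto_add[OF _ X(2)] by fastforce
  obtain m \<phi> where m: "m \<in> sphere 0 1" "strict_mono (\<phi>::nat\<Rightarrow>nat)" "(M \<circ> \<phi>) \<longlonglongrightarrow> m"
    using compact_sphere[of "0::real^3" 1] YM(1) unfolding compact_def
    by (metis mem_sphere_0)
  have Y': "(\<lambda>n. Y (\<phi> n)) \<longlonglongrightarrow> x0" using LIMSEQ_subseq_LIMSEQ[OF Y m(2)] by (simp add: o_def)
  have M': "(\<lambda>n. M (\<phi> n)) \<longlonglongrightarrow> m" using m(3) by (simp add: o_def)
  have "cusp k \<delta> \<beta> x0 m \<subseteq> D"
  proof
    fix z assume z: "z \<in> cusp k \<delta> \<beta> x0 m"
    let ?s = "\<lambda>n. (z - Y (\<phi> n)) \<bullet> M (\<phi> n)"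
    let ?w = "\<lambda>n. norm ((z - Y (\<phi> n)) - ?s n *\<^sub>R M (\<phi> n))"
    have s: "?s \<longlonglongrightarrow> (z - x0) \<bullet> m" by (intro tendsto_intros Y' M')
    have w: "?w \<longlonglongrightarrow> norm ((z - x0) - ((z - x0) \<bullet> m) *\<^sub>R m)" by (intro tendsto_intros Y' M')
    have p: "(\<lambda>n. ?s n - k * ?w n powr \<beta>) \<longlonglongrightarrow> (z - x0) \<bullet> m - k * norm ((z - x0) - ((z - x0) \<bullet> m) *\<^sub>R m) powr \<beta>"
      using assms by (intro tendsto_intros s w tendsto_powr2) auto
    have "\<forall>\<^sub>F n in sequentially. 0 < ?s n - k * ?w n powr \<beta>"
      using z by (intro order_tendstoD[OF p]) (auto simp: cusp_def)
    moreover have "\<forall>\<^sub>F n in sequentially. ?s n < \<delta>" "\<forall>\<^sub>F n in sequentially. ?w n < \<delta>"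
      using z by (intro order_tendstoD[OF s] order_tendstoD[OF w]; auto simp: cusp_def)+
    ultimately have "\<forall>\<^sub>F n in sequentially. z \<in> D"
    proof eventually_elim
      case (elim n)
      then have "z \<in> cusp k \<delta> \<beta> (Y (\<phi> n)) (M (\<phi> n))" by (simp add: cusp_def)
      then show "z \<in> D" using YM(3) by blast
    qed
    then show "z \<in> D" by simp
  qed
  then show ?thesis using that m(1) by simp
qed

lemma measure_slab:
  fixes m x :: "real^3"
  assumes m: "norm m = 1" and "d \<ge> 0" "\<epsilon> \<ge> 0"
  obtains U where "{y. norm (y - x) \<le> d \<and> \<bar>(y - x) \<bullet> m\<bar> \<le> \<epsilon>} \<subseteq> U" "U \<in> lmeasurable"
    "measure lebesgue U = 8 * d\<^sup>2 * \<epsilon>"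
proof -
  obtain A :: "real^3 \<Rightarrow> real^3" where A: "orthogonal_transformation A" "A (axis 3 1) = m"
    using orthogonal_transformation_exists_1[of "axis 3 (1::real) :: real^3" m] m by auto
  define c :: "real^3" where "c = vector [d, d, \<epsilon>]"
  have surj: "surj A" using A(1) by (rule orthogonal_transformation_surj)
  define U where "U = (+) x ` A ` cbox (- c) c"
  have U: "U \<in> lmeasurable"
    unfolding U_def using A(1) by (intro measurable_translation lmeasurable_cbox measurable_orthogonal_image)
  have "measure lebesgue U = measure lebesgue (cbox (- c) c)"
    unfolding U_def measure_translation by (intro measure_orthogonal_image[OF A(1)]) simp
  also have "\<dots> = 8 * d\<^sup>2 * \<epsilon>"
  proof -
    have "cbox (- c) c \<noteq> {}"
      using assms(2,3) by (auto simp: c_def interval_eq_empty_cart forall_3 not_less)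
    then have "measure lborel (cbox (- c) c) = 8 * d\<^sup>2 * \<epsilon>"
      unfolding content_cbox_cart[OF \<open>cbox (- c) c \<noteq> {}\<close>] UNIV_3 by (simp add: c_def power2_eq_square)
    then show ?thesis by simp
  qed
  finally have meas: "measure lebesgue U = 8 * d\<^sup>2 * \<epsilon>" .
  have "y \<in> U" if "norm (y - x) \<le> d" "\<bar>(y - x) \<bullet> m\<bar> \<le> \<epsilon>" for y
  proof -
    obtain v where v: "y - x = A v" using surj by (metis surjD)
    have "norm v \<le> d" using that v A(1) by (simp add: orthogonal_transformation_norm)
    then have "\<And>i. \<bar>v $ i\<bar> \<le> d" using component_le_norm_cart order_trans by blast
    moreover have "\<bar>v $ 3\<bar> \<le> \<epsilon>"
      using that(2) v A by (metis orthogonal_transformation_def inner_axis inner_real_def mult.right_neutral)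
    ultimately have "v \<in> cbox (- c) c"
      by (auto simp: mem_box_cart forall_3 c_def abs_le_iff minus_le_iff)
    then show ?thesis unfolding U_def using v
      by (metis add.commute diff_add_cancel image_eqI)
  qed
  then show ?thesis using that U meas by blast
qed

text \<open>Within a small ball of radius \<open>d\<close> about one of its points the set lies in a slab of thickness of order
\<open>d\<^sup>\<beta>\<close>, whose relative volume tends to zero with \<open>d\<close>; so the set has no density points.\<close>

lemma negligible_squeezed:
  assumes sq: "squeezed k \<delta> \<beta> \<Gamma>" and "k > 0" "\<delta> > 0" "\<beta> > 1"
  shows "negligible \<Gamma>"
  unfolding negligible_eq_zero_density
proof (intro ballI allI impI)
  fix x r e assume x: "x \<in> \<Gamma>" and r: "(r::real) > 0" and e: "(e::real) > 0"
  define b where "b = measure lebesgue (ball (0::real^3) 1)"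
  have b: "b > 0" by (simp add: b_def content_ball_pos)
  obtain m where m: "norm m = 1" "cusp k \<delta> \<beta> x m \<inter> \<Gamma> = {}" "cusp k \<delta> \<beta> x (- m) \<inter> \<Gamma> = {}"
    using sq x unfolding squeezed_def by blast
  have "((\<lambda>d. 8 * k * d powr (\<beta> - 1)) \<longlongrightarrow> 8 * k * 0 powr (\<beta> - 1)) (at_right 0)"
    using assms by (intro tendsto_intros tendsto_ident_at tendsto_powr2) (auto intro: eventually_mono[OF eventually_at_right_less])
  then have 1: "\<forall>\<^sub>F d in at_right 0. 8 * k * d powr (\<beta> - 1) < e * b"
    using assms e b by (intro order_tendstoD) auto
  have 2: "\<forall>\<^sub>F d in at_right 0. d < min \<delta> r" "\<forall>\<^sub>F d::real in at_right 0. 0 < d"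
    using assms r by (auto simp: eventually_at_right_less eventually_at_right_field intro: exI[of _ "min \<delta> r"])
  obtain d where d: "8 * k * d powr (\<beta> - 1) < e * b" "d < min \<delta> r" "0 < d"
    using eventually_happens[OF eventually_conj[OF 1 eventually_conj[OF 2]]]
    by (auto simp: trivial_limit_at_right_real)
  obtain U where U: "{y. norm (y - x) \<le> d \<and> \<bar>(y - x) \<bullet> m\<bar> \<le> k * d powr \<beta>} \<subseteq> U" "U \<in> lmeasurable"
    "measure lebesgue U = 8 * d\<^sup>2 * (k * d powr \<beta>)"
    using measure_slab[OF m(1), of d "k * d powr \<beta>" x] d assms by auto
  have "\<Gamma> \<inter> ball x d \<subseteq> U"
  proof
    fix y assume y: "y \<in> \<Gamma> \<inter> ball x d"
    define s where "s = (y - x) \<bullet> m"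
    define w where "w = (y - x) - s *\<^sub>R m"
    have nyx: "norm (y - x) < d" using y by (simp add: dist_norm norm_minus_commute)
    have sle: "\<bar>s\<bar> < d" using Cauchy_Schwarz_ineq2[of "y - x" m] m nyx by (simp add: s_def)
    have w: "norm w < d" using norm_orthogonal_part_le[OF m(1), of "y - x"] nyx by (simp add: w_def s_def)
    have "y \<notin> cusp k \<delta> \<beta> x m" "y \<notin> cusp k \<delta> \<beta> x (- m)" using y m by blast+
    then have "\<bar>s\<bar> \<le> k * norm w powr \<beta>"
      using sle w d by (auto simp: cusp_def s_def[symmetric] w_def[symmetric])
    also have "\<dots> \<le> k * d powr \<beta>" using w assms by (intro mult_left_mono powr_mono2) auto
    finally show "y \<in> U" using U(1) nyx by (auto simp: s_def)
  qed
  moreover have "measure lebesgue U < e * measure lebesgue (ball x d)"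
  proof -
    have "measure lebesgue (ball x d) = b * d ^ 3"
      using d content_ball_conv_unit_ball[of d x] by (simp add: b_def)
    moreover have "measure lebesgue U = (8 * k * d powr (\<beta> - 1)) * d ^ 3"
      using d by (simp add: U(3) powr_diff power2_eq_square power3_eq_cube)
    moreover have "(8 * k * d powr (\<beta> - 1)) * d ^ 3 < (e * b) * d ^ 3"
      using d by (intro mult_strict_right_mono) auto
    ultimately show ?thesis by simp
  qed
  ultimately show "\<exists>d>0. d \<le> r \<and> (\<exists>U. \<Gamma> \<inter> ball x d \<subseteq> U \<and> U \<in> lmeasurable \<and>
       measure lebesgue U < e * measure lebesgue (ball x d))"
    using U(2) d by (intro exI[of _ d] conjI exI[of _ U]) auto
qed

lemma in_vertical_cusp:
  fixes x :: "real^3"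
  assumes "k * norm (tangential x) powr \<beta> < x $ 3 - t" "x $ 3 - t < \<delta>" "norm (tangential x) < \<delta>"
  shows "x \<in> cusp k \<delta> \<beta> (vector [0, 0, t]) (axis 3 1)"
proof -
  let ?y = "x - vector [0, 0, t]"
  have "tangential ?y = tangential x"
    by (simp add: tangential_def)
  moreover have "?y \<bullet> axis 3 1 = x $ 3 - t" by (simp add: inner_axis)
  ultimately show ?thesis
    using assms norm_tangential[of ?y] by (simp add: cusp_def)
qed

lemma in_downward_cusp:
  fixes x :: "real^3"
  assumes "k * norm (tangential x) powr \<beta> < - x $ 3" "- x $ 3 < \<delta>" "norm (tangential x) < \<delta>"
  shows "x \<in> cusp k \<delta> \<beta> 0 (- axis 3 1)"
  using assms norm_tangential[of x] by (simp add: cusp_def inner_axis)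

text \<open>The body keeps away from the ball of radius \<open>h\<close> about the origin, which forces the interior cusp at the
lowest point to be vertical.\<close>

lemma body_contains_cusp:
  assumes "open S" "squeezed k \<delta> \<beta> (frontier S)" "k > 0" "\<delta> > 0" "\<beta> > 1" "h > 0"
    and "vector [0, 0, h] \<in> frontier S" "ball 0 h \<inter> S = {}"
  shows "cusp k \<delta> \<beta> (vector [0, 0, h]) (axis 3 1) \<subseteq> S"
proof -
  obtain m where m: "norm m = 1" "cusp k \<delta> \<beta> (vector [0, 0, h]) m \<subseteq> S"
    using interior_cusp_exists[OF assms(1,7,2,3,4,5)] by blast
  have z: "vector [0, 0, h] + h *\<^sub>R (- axis 3 1) = (0::real^3)"
    by (simp add: vec_eq_iff forall_3 axis_def)
  have "cusp k \<delta> \<beta> (vector [0, 0, h]) m \<inter> ball (vector [0, 0, h] + h *\<^sub>R (- axis 3 1)) h = {}"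
    unfolding z using m(2) assms(8) by blast
  then have "m = - (- axis 3 1)"
    using m assms by (intro cusp_axis_unique[where r = h]) auto
  then show ?thesis using m by simp
qed

text \<open>One-sidedness makes the boundary of the cavity the boundary of the exterior too, so the exterior has its
own interior cusp.\<close>

lemma cavity_avoids_cusp:
  assumes "interior (closure \<Omega>) = \<Omega>" "squeezed k \<delta> \<beta> (frontier \<Omega>)" "k > 0" "\<delta> > 0" "\<beta> > 1" "h > 0"
    and "0 \<in> frontier \<Omega>" "ball (vector [0, 0, h]) h \<subseteq> \<Omega>"
  shows "cusp k \<delta> \<beta> 0 (- axis 3 1) \<inter> \<Omega> = {}"
proof -
  have fr: "frontier (- closure \<Omega>) = frontier \<Omega>"
  proof -
    have "interior \<Omega> = \<Omega>" using assms(1) by (metis interior_interior)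
    then have "frontier (closure \<Omega>) = frontier \<Omega>" using assms(1) by (simp add: frontier_def)
    then show ?thesis by (simp only: frontier_complement)
  qed
  obtain m where m: "norm m = 1" "cusp k \<delta> \<beta> 0 m \<subseteq> - closure \<Omega>"
    using interior_cusp_exists[of "- closure \<Omega>" 0 k \<delta> \<beta>] assms fr by auto
  have z: "0 + h *\<^sub>R axis 3 1 = (vector [0, 0, h]::real^3)"
    by (simp add: vec_eq_iff forall_3 axis_def)
  have "cusp k \<delta> \<beta> 0 m \<inter> ball (0 + h *\<^sub>R axis 3 1) h = {}"
    unfolding z using m(2) assms(8) closure_subset[of \<Omega>] by blast
  then have "m = - axis 3 1"
    by (intro cusp_axis_unique[OF assms(4,5) m(1) _ assms(6)]) (auto simp: norm_axis_1)
  then show ?thesis using m closure_subset[of \<Omega>] by blast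
qed

lemma gap_balls:
  fixes S \<Omega> :: "(real^3) set"
  assumes S: "S \<subseteq> \<Omega>" and h: "h = setdist S (frontier \<Omega>)" "h > 0"
    and "0 \<in> frontier \<Omega>" and P: "P \<in> frontier S"
  shows "ball 0 h \<inter> S = {}" "ball P h \<subseteq> \<Omega>"
proof -
  show "ball 0 h \<inter> S = {}"
    using setdist_le_dist[of _ S 0 "frontier \<Omega>"] assms by (force simp: dist_commute)
  have Pc: "P \<in> closure S" using P by (simp add: frontier_def)
  have disj: "ball P h \<inter> frontier \<Omega> = {}"
  proof -
    have "h \<le> dist P y" if "y \<in> frontier \<Omega>" for y
      using setdist_le_dist[OF Pc that] h by simp
    then show ?thesis by force
  qed
  have "ball P h \<inter> \<Omega> \<noteq> {}"
    using Pc S h(2) by (metis closure_approachable disjoint_iff dist_commute mem_ball subset_iff)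
  then show "ball P h \<subseteq> \<Omega>"
    using connected_Int_frontier[of "ball P h" \<Omega>] disj connected_ball[of P h] by blast
qed

section \<open>Integration by parts\<close>

definition C1_gradient :: "(real^3 \<Rightarrow> real) \<Rightarrow> (real^3 \<Rightarrow> real^3) \<Rightarrow> bool" where
  "C1_gradient f D \<longleftrightarrow> (\<forall>x. (f has_derivative (\<lambda>v. D x \<bullet> v)) (at x)) \<and> continuous_on UNIV D"

lemma C1_gradientD:
  assumes "C1_gradient f D"
  shows "(f has_derivative (\<lambda>v. D x \<bullet> v)) (at x)" "continuous_on UNIV D" "continuous_on UNIV f"
proof -
  show 1: "(f has_derivative (\<lambda>v. D x \<bullet> v)) (at x)" for x using assms by (simp add: C1_gradient_def)
  show "continuous_on UNIV D" using assms by (simp add: C1_gradient_def)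
  show "continuous_on UNIV f"
    using 1 has_derivative_continuous by (metis continuous_at_imp_continuous_on)
qed

lemma C1_gradient_mult:
  assumes "C1_gradient f D" "C1_gradient g E"
  shows "C1_gradient (\<lambda>x. f x * g x) (\<lambda>x. f x *\<^sub>R E x + g x *\<^sub>R D x)"
  unfolding C1_gradient_def
proof (intro conjI allI)
  show "((\<lambda>x. f x * g x) has_derivative (\<lambda>v. (f x *\<^sub>R E x + g x *\<^sub>R D x) \<bullet> v)) (at x)" for x
    by (rule has_derivative_eq_rhs[OF has_derivative_mult[OF C1_gradientD(1)[OF assms(1)] C1_gradientD(1)[OF assms(2)]]])
       (auto simp: inner_add_left algebra_simps)
  show "continuous_on UNIV (\<lambda>x. f x *\<^sub>R E x + g x *\<^sub>R D x)"
    by (intro continuous_intros C1_gradientD(2,3)[OF assms(1)] C1_gradientD(2,3)[OF assms(2)])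
qed

lemma integrable_continuous_bounded_support:
  fixes f :: "real^3 \<Rightarrow> 'b::euclidean_space"
  assumes "continuous_on UNIV f" "bounded K" "\<And>x. x \<notin> K \<Longrightarrow> f x = 0"
  shows "integrable lborel f" "integrable lebesgue f" "\<exists>B. \<forall>x. norm (f x) \<le> B"
proof -
  obtain r where r: "K \<subseteq> cball 0 r" using bounded_subset_ballD[OF assms(2), of 0] ball_subset_cball by blast
  have eq: "f = (\<lambda>x. indicator (cball 0 r) x *\<^sub>R f x)"
    using subsetD[OF r] assms(3) by (fastforce simp: indicator_def)
  have "set_integrable lborel (cball 0 r) f"
    unfolding set_integrable_def by (rule borel_integrable_compact) (auto intro: continuous_on_subset[OF assms(1)])
  then show 1: "integrable lborel f" unfolding set_integrable_def by (subst eq)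
  have "f \<in> borel_measurable borel" using assms(1) by (simp add: borel_measurable_continuous_onI)
  then show "integrable lebesgue f" using 1 by (simp add: integrable_completion)
  have "bounded (f ` cball 0 r)"
    by (intro compact_imp_bounded compact_continuous_image continuous_on_subset[OF assms(1)]) auto
  then obtain B where "\<And>x. x \<in> cball 0 r \<Longrightarrow> norm (f x) \<le> B" unfolding bounded_iff by blast
  then have "norm (f x) \<le> max B 0" for x
    by (metis assms(3) norm_zero max.cobounded1 max.cobounded2 order_trans r subsetD)
  then show "\<exists>B. \<forall>x. norm (f x) \<le> B" by blast
qed

lemma C1_gradient_eq_0:
  assumes f: "C1_gradient f D" and K: "closed K" "\<And>y. y \<notin> K \<Longrightarrow> f y = 0" "x \<notin> K"
  shows "D x = 0"
proof -
  have "((\<lambda>y. 0::real) has_derivative (\<lambda>v. 0)) (at x)" by simp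
  then have "(f has_derivative (\<lambda>v. 0)) (at x)"
    by (rule has_derivative_transform_within_open[of _ _ _ UNIV "- K"]) (use K in auto)
  then have "(\<lambda>v. D x \<bullet> v) = (\<lambda>v. 0)"
    using has_derivative_unique C1_gradientD(1)[OF f] by blast
  then show ?thesis by (metis inner_eq_zero_iff)
qed

text \<open>Translation invariance makes the integral of every difference quotient zero, and the difference
quotients converge boundedly on a bounded set.\<close>

lemma integral_partial_derivative_eq_0:
  assumes f: "C1_gradient f D" and K: "bounded K" "\<And>x. x \<notin> K \<Longrightarrow> f x = 0"
  shows "(LINT x|lebesgue. D x $ j) = 0"
proof -
  let ?e = "axis j (1::real) :: real^3"
  obtain r where r: "K \<subseteq> ball 0 r" using bounded_subset_ballD[OF K(1), of 0] by blast
  have D0: "D x = 0" if "x \<notin> cball 0 r" for x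
    using C1_gradient_eq_0[OF f closed_cball _ that] K(2) r by force
  have cont: "continuous_on UNIV D" "continuous_on UNIV f" using C1_gradientD[OF f] by auto
  have contj: "continuous_on UNIV (\<lambda>x. D x $ j)" by (intro continuous_intros cont)
  have Dj: "integrable lborel (\<lambda>x. D x $ j)"
    using contj D0 by (intro integrable_continuous_bounded_support[where K = "cball 0 r"]) auto
  have fint: "integrable lborel f"
    using cont K by (intro integrable_continuous_bounded_support[where K = K]) auto
  obtain B where B: "\<And>x. \<bar>D x $ j\<bar> \<le> B"
    using integrable_continuous_bounded_support(3)[OF contj, of "cball 0 r"] D0 by fastforce
  define q where "q n x = real (Suc n) * (f (x + (1 / real (Suc n)) *\<^sub>R ?e) - f x)" for n x
  have line: "((\<lambda>t. f (x + t *\<^sub>R ?e)) has_real_derivative D (x + t *\<^sub>R ?e) $ j) (at t)" for x t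
  proof -
    have "((\<lambda>t. f (x + t *\<^sub>R ?e)) has_derivative (\<lambda>s. D (x + t *\<^sub>R ?e) \<bullet> (s *\<^sub>R ?e))) (at t)"
      by (rule has_derivative_compose[OF _ C1_gradientD(1)[OF f], of "\<lambda>t. x + t *\<^sub>R ?e"])
         (auto intro!: derivative_eq_intros)
    then show ?thesis
      unfolding has_field_derivative_def by (rule has_derivative_eq_rhs) (auto simp: inner_axis)
  qed
  have bound: "\<bar>f (x + s *\<^sub>R ?e) - f x\<bar> \<le> B * s" if s: "s > 0" for x s
  proof -
    obtain z where "f (x + s *\<^sub>R ?e) - f (x + 0 *\<^sub>R ?e) = (s - 0) * (D (x + z *\<^sub>R ?e) $ j)"
      using MVT2[OF s, of "\<lambda>t. f (x + t *\<^sub>R ?e)" "\<lambda>t. D (x + t *\<^sub>R ?e) $ j"] line by blast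
    then show ?thesis using B[of "x + z *\<^sub>R ?e"] s by (simp add: abs_mult mult.commute mult_left_mono)
  qed
  have qint: "integral\<^sup>L lborel (q n) = 0" for n
  proof -
    let ?a = "(1 / real (Suc n)) *\<^sub>R ?e"
    have "(LINT x|lborel. f (?a + x)) = integral\<^sup>L (distr lborel borel ((+) ?a)) f"
      by (subst integral_distr) (auto intro: borel_measurable_continuous_onI cont)
    also have "\<dots> = integral\<^sup>L lborel f" by (simp add: lborel_distr_plus)
    finally have 1: "(LINT x|lborel. f (x + ?a)) = integral\<^sup>L lborel f" by (simp add: add.commute)
    have "integrable (distr lborel borel ((+) ?a)) f" using fint by (simp add: lborel_distr_plus)
    then have "integrable lborel (\<lambda>x. f (?a + x))"
      by (subst (asm) integrable_distr_eq) (auto intro: borel_measurable_continuous_onI cont)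
    then have 2: "integrable lborel (\<lambda>x. f (x + ?a))" by (simp add: add.commute)
    show ?thesis unfolding q_def using 1 2 fint by simp
  qed
  have "(\<lambda>n. integral\<^sup>L lborel (q n)) \<longlonglongrightarrow> (LINT x|lborel. D x $ j)"
  proof (rule integral_dominated_convergence[where w = "\<lambda>x. B * indicator (cball 0 (r + 1)) x"])
    show "(\<lambda>x. D x $ j) \<in> borel_measurable lborel"
      using contj by (auto intro: borel_measurable_continuous_onI)
    have "continuous_on UNIV (q n)" for n unfolding q_def
      by (intro continuous_intros continuous_on_compose2[OF cont(2)]) auto
    then show "q n \<in> borel_measurable lborel" for n by (auto intro: borel_measurable_continuous_onI)
    show "integrable lborel (\<lambda>x::real^3. B * indicator (cball 0 (r + 1)) x)"
      by (intro integrable_mult_right integrable_real_indicator) (use emeasure_bounded_finite[OF bounded_cball] in auto)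
    show "AE x in lborel. (\<lambda>n. q n x) \<longlonglongrightarrow> D x $ j"
    proof (rule AE_I2)
      fix x
      have "((\<lambda>s. (f (x + s *\<^sub>R ?e) - f x) / s) \<longlongrightarrow> D x $ j) (at 0)"
        using line[of x 0] by (simp add: DERIV_def)
      moreover have "filterlim (\<lambda>n. 1 / real (Suc n)) (at 0) sequentially"
        by (rule filterlim_atI) (use LIMSEQ_inverse_real_of_nat in \<open>auto simp: inverse_eq_divide\<close>)
      ultimately have "((\<lambda>n. (f (x + (1 / real (Suc n)) *\<^sub>R ?e) - f x) / (1 / real (Suc n))) \<longlongrightarrow> D x $ j) sequentially"
        by (rule filterlim_compose)
      then show "(\<lambda>n. q n x) \<longlonglongrightarrow> D x $ j" by (simp add: q_def mult.commute)
    qed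
    show "AE x in lborel. norm (q n x) \<le> B * indicator (cball 0 (r + 1)) x" for n
    proof (rule AE_I2)
      fix x
      show "norm (q n x) \<le> B * indicator (cball 0 (r + 1)) x"
      proof (cases "x \<in> cball 0 (r + 1)")
        case True
        have "\<bar>f (x + (1 / real (Suc n)) *\<^sub>R ?e) - f x\<bar> \<le> B * (1 / real (Suc n))"
          by (rule bound) simp
        then have "real (Suc n) * \<bar>f (x + (1 / real (Suc n)) *\<^sub>R ?e) - f x\<bar> \<le> real (Suc n) * (B * (1 / real (Suc n)))"
          by (intro mult_left_mono) auto
        then show ?thesis using True by (simp add: q_def abs_mult del: of_nat_Suc)
      next
        case False
        have "norm x \<le> norm (x + (1 / real (Suc n)) *\<^sub>R ?e) + norm ((1 / real (Suc n)) *\<^sub>R ?e)"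
          using norm_triangle_ineq4[of "x + (1 / real (Suc n)) *\<^sub>R ?e" "(1 / real (Suc n)) *\<^sub>R ?e"] by simp
        then have "norm x \<le> norm (x + (1 / real (Suc n)) *\<^sub>R ?e) + 1"
        proof -
          assume *: "norm x \<le> norm (x + (1 / real (Suc n)) *\<^sub>R ?e) + norm ((1 / real (Suc n)) *\<^sub>R ?e)"
          have "norm ((1 / real (Suc n)) *\<^sub>R ?e) \<le> 1" by (simp add: norm_axis_1)
          then show ?thesis using * by linarith
        qed
        then have "x \<notin> K" "x + (1 / real (Suc n)) *\<^sub>R ?e \<notin> K" using False r by auto
        then show ?thesis using K(2) False by (simp add: q_def)
      qed
    qed
  qed
  then have "(LINT x|lborel. D x $ j) = 0"
    using qint by (simp add: LIMSEQ_const_iff)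
  then show ?thesis using Dj by (simp add: integral_completion)
qed

lemma integration_by_parts:
  assumes f: "C1_gradient f D" and g: "C1_gradient g E" and K: "bounded K" "\<And>x. x \<notin> K \<Longrightarrow> f x = 0"
  shows "(LINT x|lebesgue. D x $ j * g x) = - (LINT x|lebesgue. f x * E x $ j)"
    and "integrable lebesgue (\<lambda>x. D x $ j * g x)" "integrable lebesgue (\<lambda>x. f x * E x $ j)"
proof -
  note cf = C1_gradientD(2,3)[OF f] and cg = C1_gradientD(2,3)[OF g]
  have D0: "D x = 0" if "x \<notin> closure K" for x
    using C1_gradient_eq_0[OF f closed_closure _ that] K(2) closure_subset[of K] by blast
  show 1: "integrable lebesgue (\<lambda>x. D x $ j * g x)"
    using K D0 by (intro integrable_continuous_bounded_support(2)[where K = "closure K"] continuous_intros cf cg) auto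
  show 2: "integrable lebesgue (\<lambda>x. f x * E x $ j)"
    using K by (intro integrable_continuous_bounded_support(2)[where K = "K"] continuous_intros cf cg) auto
  have "(LINT x|lebesgue. (f x *\<^sub>R E x + g x *\<^sub>R D x) $ j) = 0"
    using K by (intro integral_partial_derivative_eq_0[OF C1_gradient_mult[OF f g]]) auto
  then have "(LINT x|lebesgue. D x $ j * g x + f x * E x $ j) = 0"
    by (simp add: algebra_simps)
  then show "(LINT x|lebesgue. D x $ j * g x) = - (LINT x|lebesgue. f x * E x $ j)"
    using 1 2 by simp
qed

section \<open>Smooth bumps and the fundamental lemma\<close>

lemma Ck_add: "Ck k f \<Longrightarrow> Ck k g \<Longrightarrow> Ck k (\<lambda>x. f x + g x)"
proof (induction k arbitrary: f g)
  case (Suc k)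
  have "frechet_derivative (\<lambda>x. f x + g x) (at x) = (\<lambda>v. frechet_derivative f (at x) v + frechet_derivative g (at x) v)" for x
    using Suc.prems by (intro frechet_derivative_at[symmetric] has_derivative_add)
       (auto simp: frechet_derivative_works[symmetric])
  then show ?case using Suc by (auto intro: differentiable_add)
qed (auto intro: continuous_intros)

lemma Ck_mono_Suc: "Ck (Suc k) f \<Longrightarrow> Ck k f"
proof (induction k arbitrary: f)
  case 0
  then show ?case by (auto intro!: continuous_at_imp_continuous_on differentiable_imp_continuous_within)
qed simp_all

lemma Ck_mult:
  fixes f g :: "real^3 \<Rightarrow> real"
  shows "Ck k f \<Longrightarrow> Ck k g \<Longrightarrow> Ck k (\<lambda>x. f x * g x)"
proof (induction k arbitrary: f g)
  case (Suc k)
  have "frechet_derivative (\<lambda>x. f x * g x) (at x) =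
      (\<lambda>v. f x * frechet_derivative g (at x) v + frechet_derivative f (at x) v * g x)" for x
    using Suc.prems by (intro frechet_derivative_at[symmetric] has_derivative_mult)
       (auto simp: frechet_derivative_works[symmetric])
  then show ?case using Suc.prems Ck_mono_Suc[OF Suc.prems(1)] Ck_mono_Suc[OF Suc.prems(2)]
    by (auto intro!: differentiable_mult Ck_add Suc.IH)
qed (auto intro: continuous_intros)

text \<open>The flat function \<open>exp (- c / t)\<close> times powers of \<open>1/t\<close>: up to linear combinations this family is
closed under differentiation, so that all its members are smooth.\<close>

definition flat_exp :: "real \<Rightarrow> nat \<Rightarrow> real \<Rightarrow> real" where
  "flat_exp c m t = (if t > 0 then (1 / t) ^ m * exp (- c / t) else 0)"

lemma flat_exp_tendsto_0:
  assumes "c > 0"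
  shows "(flat_exp c m \<longlongrightarrow> 0) (at_right 0)"
proof -
  have "((\<lambda>s. s ^ m / exp (c * s)) \<longlongrightarrow> 0) at_top"
  proof -
    have "((\<lambda>s. (c * s) ^ m / exp (c * s) * (1 / c) ^ m) \<longlongrightarrow> 0 * (1 / c) ^ m) at_top"
      using assms
      by (intro tendsto_intros filterlim_compose[OF tendsto_power_div_exp_0]
          filterlim_tendsto_pos_mult_at_top[OF tendsto_const] filterlim_ident)
    moreover have "(\<lambda>s. (c * s) ^ m / exp (c * s) * (1 / c) ^ m) = (\<lambda>s. s ^ m / exp (c * s))"
      using assms by (auto simp: power_mult_distrib power_divide fun_eq_iff)
    ultimately show ?thesis by simp
  qed
  then have "((\<lambda>t. inverse t ^ m / exp (c * inverse t)) \<longlongrightarrow> 0) (at_right 0)"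
    by (rule filterlim_compose) (rule filterlim_inverse_at_top_right)
  then show ?thesis
  proof (rule Lim_transform_eventually)
    show "\<forall>\<^sub>F t in at_right 0. inverse t ^ m / exp (c * inverse t) = flat_exp c m t"
      using eventually_at_right_less
      by eventually_elim (simp add: flat_exp_def exp_minus divide_simps)
  qed
qed

lemma flat_exp_has_derivative:
  assumes c: "c > 0"
  shows "(flat_exp c m has_real_derivative - real m * flat_exp c (Suc m) t + c * flat_exp c (m + 2) t) (at t)"
proof -
  consider "t > 0" | "t < 0" | "t = 0" by linarith
  then show ?thesis
  proof cases
    case 1
    have "((\<lambda>t. (1 / t) ^ m * exp (- c / t)) has_real_derivative
        - real m * flat_exp c (Suc m) t + c * flat_exp c (m + 2) t) (at t)"
    proof -
      have inv: "((\<lambda>t. 1 / t) has_real_derivative - (1 / t)\<^sup>2) (at t)"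
        using 1 by (auto intro!: derivative_eq_intros simp: power2_eq_square)
      have ex: "((\<lambda>t. exp (- c / t)) has_real_derivative c * (1 / t)\<^sup>2 * exp (- c / t)) (at t)"
        using 1 by (auto intro!: derivative_eq_intros simp: power2_eq_square)
      show ?thesis
      proof (cases m)
        case 0
        then show ?thesis using ex 1 by (simp add: flat_exp_def power2_eq_square)
      next
        case (Suc n)
        show ?thesis unfolding Suc
          by (rule DERIV_cong[OF DERIV_mult[OF DERIV_power_Suc[OF inv, of n] ex]])
             (use 1 in \<open>simp add: flat_exp_def power2_eq_square field_simps\<close>)
      qed
    qed
    then show ?thesis
      by (rule has_field_derivative_transform_within_open[of _ _ _ "{0<..}"])
         (use 1 in \<open>auto simp: flat_exp_def\<close>)
  next
    case 2
    have "((\<lambda>t. 0) has_real_derivative 0) (at t)" by simp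
    then have "(flat_exp c m has_real_derivative 0) (at t)"
      by (rule has_field_derivative_transform_within_open[of _ _ _ "{..<0}"])
         (use 2 in \<open>auto simp: flat_exp_def\<close>)
    then show ?thesis using 2 by (simp add: flat_exp_def)
  next
    case 3
    have "((\<lambda>s. flat_exp c m s / s) \<longlongrightarrow> 0) (at_right 0)"
      using flat_exp_tendsto_0[OF c, of "Suc m"]
      by (rule Lim_transform_eventually)
         (rule eventually_mono[OF eventually_at_right_less], simp add: flat_exp_def field_simps)
    moreover have "((\<lambda>s. flat_exp c m s / s) \<longlongrightarrow> 0) (at_left 0)"
      by (rule Lim_transform_eventually[OF tendsto_const])
         (auto simp: eventually_at_left_field flat_exp_def intro: exI[of _ "-1"])
    ultimately have "((\<lambda>s. flat_exp c m s / s) \<longlongrightarrow> 0) (at 0)"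
      by (simp add: filterlim_split_at)
    then show ?thesis using 3 by (simp add: DERIV_def flat_exp_def)
  qed
qed

lemma Ck_flat_exp:
  assumes c: "c > 0"
  shows "Ck k (\<lambda>x. flat_exp c m (a * x $ i + b))"
proof (induction k arbitrary: m)
  case 0
  have "continuous_on UNIV (flat_exp c m)"
    by (intro continuous_at_imp_continuous_on ballI DERIV_isCont[OF flat_exp_has_derivative[OF c]])
  moreover have "continuous_on UNIV (\<lambda>x::real^3. a * x $ i + b)" by (intro continuous_intros)
  ultimately have "continuous_on UNIV (\<lambda>x::real^3. flat_exp c m (a * x $ i + b))"
    by (rule continuous_on_compose2[of UNIV "flat_exp c m" UNIV "\<lambda>x::real^3. a * x $ i + b"]) simp
  then show ?case by (simp only: Ck.simps)
next
  case (Suc k)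
  let ?d = "\<lambda>x. - real m * flat_exp c (Suc m) x + c * flat_exp c (m + 2) x"
  have der: "((\<lambda>x. flat_exp c m (a * x $ i + b)) has_derivative (\<lambda>v. ?d (a * x $ i + b) * (a * v $ i))) (at x)" for x :: "real^3"
  proof -
    have "((\<lambda>x::real^3. a * x $ i + b) has_derivative (\<lambda>v. a * v $ i)) (at x)"
      by (auto intro!: derivative_eq_intros bounded_linear.has_derivative[OF bounded_linear_vec_nth])
    then show ?thesis
      by (rule has_derivative_compose[OF _ flat_exp_has_derivative[OF c, unfolded has_field_derivative_def]])
  qed
  have "frechet_derivative (\<lambda>x. flat_exp c m (a * x $ i + b)) (at x) = (\<lambda>v. ?d (a * x $ i + b) * (a * v $ i))" for x :: "real^3"
    using frechet_derivative_at[OF der] by simp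
  moreover have const: "Ck k (\<lambda>x. z::real)" for k z
  proof (induction k arbitrary: z)
    case (Suc k)
    then show ?case by (simp add: frechet_derivative_const)
  qed simp
  have "Ck k (\<lambda>x. ((- real m) * flat_exp c (Suc m) (a * x $ i + b) + c * flat_exp c (m + 2) (a * x $ i + b)) * (a * axis j 1 $ i))" for j
    by (intro Ck_mult Ck_add const Suc.IH)
  ultimately show ?case using der by (auto simp: differentiable_def)
qed

text \<open>A smooth function that is positive exactly on the open box and tends to its indicator function
as \<open>c \<longlonglongrightarrow> 0\<close>; no mollification is needed.\<close>

definition box_bump :: "real \<Rightarrow> real^3 \<Rightarrow> real^3 \<Rightarrow> real^3 \<Rightarrow> real" where
  "box_bump c a b x = flat_exp c 0 (x$1 - a$1) * flat_exp c 0 (b$1 - x$1) *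
     (flat_exp c 0 (x$2 - a$2) * flat_exp c 0 (b$2 - x$2)) * (flat_exp c 0 (x$3 - a$3) * flat_exp c 0 (b$3 - x$3))"

lemma Ck_box_bump: assumes "c > 0" shows "Ck k (box_bump c a b)"
proof -
  have "Ck k (\<lambda>x. flat_exp c 0 (x$i - a$i))" "Ck k (\<lambda>x. flat_exp c 0 (b$i - x$i))" for i
    using Ck_flat_exp[OF assms, of k 0 1 i "- a$i"] Ck_flat_exp[OF assms, of k 0 "-1" i "b$i"] by simp_all
  then show ?thesis unfolding box_bump_def[abs_def] by (intro Ck_mult)
qed

lemma box_bump_eq_0: "x \<notin> box a b \<Longrightarrow> box_bump c a b x = 0"
  by (auto simp: box_bump_def flat_exp_def mem_box_cart forall_3)

lemma box_bump_bounds: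
  assumes "c \<ge> 0" shows "0 \<le> box_bump c a b x" "box_bump c a b x \<le> 1"
proof -
  have "0 \<le> flat_exp c 0 t" "flat_exp c 0 t \<le> 1" for t using assms by (auto simp: flat_exp_def)
  then show "0 \<le> box_bump c a b x" "box_bump c a b x \<le> 1"
    unfolding box_bump_def by (auto intro!: mult_nonneg_nonneg mult_le_one)
qed

lemma box_bump_tendsto: "(\<lambda>n. box_bump (1 / real (Suc n)) a b x) \<longlonglongrightarrow> indicator (box a b) x"
proof (cases "x \<in> box a b")
  case True
  have "(\<lambda>n. flat_exp (1 / real (Suc n)) 0 t) \<longlonglongrightarrow> 1" if "t > 0" for t
  proof -
    have "(\<lambda>n. exp (- (1 / real (Suc n)) / t)) \<longlonglongrightarrow> exp (- 0 / t)"
      using LIMSEQ_inverse_real_of_nat that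
      by (intro tendsto_intros) (auto simp: inverse_eq_divide)
    then show ?thesis using that by (simp add: flat_exp_def)
  qed
  then have "(\<lambda>n. box_bump (1 / real (Suc n)) a b x) \<longlonglongrightarrow> 1 * 1 * (1 * 1) * (1 * 1)"
    unfolding box_bump_def using True
    by (intro tendsto_mult) (auto simp: mem_box_cart)
  then show ?thesis using True by simp
qed (simp add: box_bump_eq_0)

lemma test_function_box_bump:
  assumes "c > 0" "cbox a b \<subseteq> U"
  shows "test_function U (box_bump c a b)"
proof -
  have "{x. box_bump c a b x \<noteq> 0} \<subseteq> cbox a b"
    using box_bump_eq_0 box_subset_cbox by blast
  then have "closure {x. box_bump c a b x \<noteq> 0} \<subseteq> cbox a b"
    by (rule closure_minimal) (rule closed_cbox)
  then show ?thesis using assms Ck_box_bump[OF assms(1)] unfolding test_function_def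
    by (meson closed_closure compact_cbox compact_closure bounded_subset bounded_cbox closure_subset order_trans)
qed

text \<open>Testing with the bumps shows that all integrals of \<open>g\<close> over boxes vanish; by Lebesgue differentiation so
does \<open>g\<close>.\<close>

lemma fundamental_lemma_of_variations:
  fixes g :: "real^3 \<Rightarrow> real"
  assumes U: "open U" and loc: "\<And>K. compact K \<Longrightarrow> K \<subseteq> U \<Longrightarrow> g absolutely_integrable_on K"
    and zero: "\<And>\<phi>. test_function U \<phi> \<Longrightarrow> (LINT x|lebesgue. g x * \<phi> x) = 0"
  shows "AE x in lebesgue. x \<in> U \<longrightarrow> g x = 0"
proof -
  have boxes: "integral (cbox a b) g = 0" if ab: "cbox a b \<subseteq> U" for a b
  proof -
    have gi: "set_integrable lebesgue (cbox a b) g" using loc[OF compact_cbox ab] .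
    have gm: "(\<lambda>x. indicator (cbox a b) x * g x) \<in> borel_measurable lebesgue"
      using gi by (auto simp: set_integrable_def dest: borel_measurable_integrable)
    have bm: "box_bump c a b \<in> borel_measurable lebesgue" if "c > 0" for c
      using Ck_box_bump[OF that, of 0] by (auto intro!: borel_measurable_continuous_onI measurable_completion)
    have eq: "g x * box_bump c a b x = (indicator (cbox a b) x * g x) * box_bump c a b x" for c x
      using box_bump_eq_0[of x a b c] box_subset_cbox[of a b] by (auto simp: indicator_def)
    have "(\<lambda>n. (LINT x|lebesgue. g x * box_bump (1 / real (Suc n)) a b x)) \<longlonglongrightarrow>
        (LINT x|lebesgue. (indicator (cbox a b) x * g x) * indicator (box a b) x)"
      unfolding eq
    proof (rule integral_dominated_convergence[where w = "\<lambda>x. \<bar>indicator (cbox a b) x * g x\<bar>"])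
      show "(\<lambda>x. indicator (cbox a b) x * g x * indicator (box a b) x) \<in> borel_measurable lebesgue"
        by (intro borel_measurable_times gm borel_measurable_indicator) auto
      show "(\<lambda>x. indicator (cbox a b) x * g x * box_bump (1 / real (Suc n)) a b x) \<in> borel_measurable lebesgue" for n
        by (intro borel_measurable_times gm bm) simp
      show "integrable lebesgue (\<lambda>x. \<bar>indicator (cbox a b) x * g x\<bar>)"
        using gi by (auto simp: set_integrable_def)
      show "AE x in lebesgue. (\<lambda>n. indicator (cbox a b) x * g x * box_bump (1 / real (Suc n)) a b x) \<longlonglongrightarrow>
          indicator (cbox a b) x * g x * indicator (box a b) x"
        by (intro AE_I2 tendsto_intros box_bump_tendsto)
      show "AE x in lebesgue. norm (indicator (cbox a b) x * g x * box_bump (1 / real (Suc n)) a b x)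
          \<le> \<bar>indicator (cbox a b) x * g x\<bar>" for n
      proof (rule AE_I2)
        fix x
        have "0 \<le> box_bump (1 / real (Suc n)) a b x" "box_bump (1 / real (Suc n)) a b x \<le> 1"
          by (rule box_bump_bounds, simp)+
        then show "norm (indicator (cbox a b) x * g x * box_bump (1 / real (Suc n)) a b x)
          \<le> \<bar>indicator (cbox a b) x * g x\<bar>"
          using mult_left_mono[of "box_bump (1 / real (Suc n)) a b x" 1 "\<bar>indicator (cbox a b) x * g x\<bar>"]
          by (simp add: abs_mult del: of_nat_Suc)
      qed
    qed
    moreover have "(LINT x|lebesgue. g x * box_bump (1 / real (Suc n)) a b x) = 0" for n
      by (rule zero, rule test_function_box_bump[OF _ ab]) simp
    ultimately have "(LINT x|lebesgue. (indicator (cbox a b) x * g x) * indicator (box a b) x) = 0"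
      by (simp add: LIMSEQ_const_iff)
    moreover have "(\<lambda>x. (indicator (cbox a b) x * g x) * indicator (box a b) x) = (\<lambda>x. indicator (box a b) x *\<^sub>R g x)"
      using box_subset_cbox[of a b] by (auto simp: indicator_def fun_eq_iff)
    ultimately have z: "(LINT x:box a b|lebesgue. g x) = 0" by (simp add: set_lebesgue_integral_def)
    have "set_integrable lebesgue (box a b) g"
      by (rule set_integrable_subset[OF gi]) (use box_subset_cbox[of a b] in auto)
    then have "integral (box a b) g = 0"
      using set_lebesgue_integral_eq_integral(2) z by metis
    then show ?thesis by (simp add: integral_open_interval)
  qed
  have on_box: "AE x in lebesgue. x \<in> cbox c d \<longrightarrow> g x = 0" if cd: "cbox c d \<subseteq> U" for c d
  proof -
    define f where "f x = (if x \<in> cbox c d then g x else 0)" for x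
    have gon: "g integrable_on cbox c d"
      using loc[OF compact_cbox cd] by (rule set_lebesgue_integral_eq_integral(1))
    have "f integrable_on UNIV"
      unfolding f_def using gon by (simp add: integrable_restrict_UNIV)
    then have fint: "f integrable_on cbox a b" for a b
      by (rule integrable_on_subcbox) simp
    have f0: "integral (cbox a b) f = 0" for a b
    proof -
      have "\<exists>e f'. cbox a b \<inter> cbox c d = cbox e f'" unfolding Int_interval by blast
      then obtain e f' where ef: "cbox a b \<inter> cbox c d = cbox e f'" by blast
      have "integral (cbox a b) f = integral (cbox a b \<inter> cbox c d) g"
        unfolding f_def by (simp add: integral_restrict_Int Int_commute)
      also have "\<dots> = 0" unfolding ef using boxes ef cd by (metis inf.cobounded2 order_trans)
      finally show ?thesis .
    qed
    obtain N where N: "negligible N" "\<And>x e. \<lbrakk>x \<notin> N; 0 < e\<rbrakk> \<Longrightarrow>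
        \<exists>d>0. \<forall>h. 0 < h \<and> h < d \<longrightarrow> norm (integral (cbox x (x + h *\<^sub>R One)) f /\<^sub>R h ^ DIM(real^3) - f x) < e"
      using integrable_ccontinuous_explicit[of f] fint by blast
    have "f x = 0" if x: "x \<notin> N" for x
    proof (rule ccontr)
      assume "f x \<noteq> 0"
      then obtain d where "d > 0" "\<forall>h. 0 < h \<and> h < d \<longrightarrow> norm (integral (cbox x (x + h *\<^sub>R One)) f /\<^sub>R h ^ DIM(real^3) - f x) < \<bar>f x\<bar>"
        using N(2)[OF x, of "\<bar>f x\<bar>"] by auto
      from this(2)[rule_format, of "d/2"] this(1) show False by (simp add: f0)
    qed
    then have "g x = 0" if "x \<in> cbox c d" "x \<notin> N" for x
      using that unfolding f_def by metis
    then have "{x. \<not> (x \<in> cbox c d \<longrightarrow> g x = 0)} \<subseteq> N" by blast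
    moreover have "N \<in> null_sets lebesgue" using N(1) by (simp add: negligible_iff_null_sets)
    ultimately show ?thesis by (intro AE_I') auto
  qed
  obtain \<D> where D: "countable \<D>" "\<D> \<subseteq> Pow U" "\<And>X. X \<in> \<D> \<Longrightarrow> \<exists>a b. X = cbox a b" "\<Union>\<D> = U"
    using open_countable_Union_open_cbox[OF U] by metis
  have "AE x in lebesgue. \<forall>X\<in>\<D>. x \<in> X \<longrightarrow> g x = 0"
    using D on_box by (subst AE_ball_countable) (auto, blast)
  then show ?thesis by eventually_elim (use D(4) in blast)
qed

section \<open>Weak gradients and their extension by zero\<close>

text \<open>Splitting at a threshold \<open>l\<close>. Optimising \<open>l\<close> after integration replaces Hoelder's inequality, at the
price of a factor 2.\<close>

lemma le_threshold_plus_scaled_powr: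
  fixes a l p :: real
  assumes "p \<ge> 1" "l > 0" "a \<ge> 0"
  shows "a \<le> l + l powr (1 - p) * a powr p"
proof (cases "a \<le> l")
  case True
  then show ?thesis by (simp add: add_increasing2)
next
  case False
  then have "a = a powr (1 - p) * a powr p"
    using assms by (simp flip: powr_add)
  also have "\<dots> \<le> l powr (1 - p) * a powr p"
    using False assms by (intro mult_right_mono powr_mono2') auto
  finally show ?thesis using assms by linarith
qed

lemma integral_norm_le_Lp:
  fixes f :: "'a \<Rightarrow> 'b::euclidean_space"
  assumes p: "p \<ge> 1" and f: "f \<in> borel_measurable M" "integrable M (\<lambda>x. norm (f x) powr p)"
    and E: "E \<in> sets M" "emeasure M E < \<infinity>" "measure M E \<le> V" "V > 0"
  shows "integrable M (\<lambda>x. indicator E x * norm (f x))"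
    and "(LINT x|M. indicator E x * norm (f x))
       \<le> 2 * V powr (1 - 1 / p) * ((LINT x|M. norm (f x) powr p)) powr (1 / p)"
proof -
  define I where "I = (LINT x|M. norm (f x) powr p)"
  have I: "I \<ge> 0" unfolding I_def by (intro integral_nonneg_AE) auto
  have iE: "integrable M (\<lambda>x. indicator E x :: real)" using E by (intro integrable_real_indicator) auto
  have dom: "integrable M (\<lambda>x. l * indicator E x + l powr (1 - p) * norm (f x) powr p)" for l
    by (intro Bochner_Integration.integrable_add integrable_mult_right iE f)
  have ptw: "indicator E x * norm (f x) \<le> l * indicator E x + l powr (1 - p) * norm (f x) powr p" if "l > 0" for l x
    using le_threshold_plus_scaled_powr[OF p that, of "norm (f x)"] by (auto simp: indicator_def)
  have meas: "(\<lambda>x. indicator E x * norm (f x)) \<in> borel_measurable M"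
    using E(1) f(1) by measurable
  show int: "integrable M (\<lambda>x. indicator E x * norm (f x))"
  proof (rule Bochner_Integration.integrable_bound[OF dom[of 1] meas], rule AE_I2)
    fix x
    show "norm (indicator E x * norm (f x)) \<le> norm (1 * indicator E x + 1 powr (1 - p) * norm (f x) powr p)"
      using ptw[of 1 x] by (simp add: indicator_def)
  qed
  have bd: "(LINT x|M. indicator E x * norm (f x)) \<le> l * V + l powr (1 - p) * I" if l: "l > 0" for l
  proof -
    have "(LINT x|M. indicator E x * norm (f x)) \<le>
        (LINT x|M. l * indicator E x + l powr (1 - p) * norm (f x) powr p)"
      by (intro integral_mono int dom ptw l)
    also have "\<dots> = l * measure M E + l powr (1 - p) * I"
      using iE f(2) E(1) by (simp add: I_def)
    also have "\<dots> \<le> l * V + l powr (1 - p) * I" using E l by simp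
    finally show ?thesis .
  qed
  show "(LINT x|M. indicator E x * norm (f x)) \<le> 2 * V powr (1 - 1 / p) * I powr (1 / p)"
  proof (cases "I = 0")
    case True
    have "(LINT x|M. indicator E x * norm (f x)) \<le> 0 + e" if "e > 0" for e
      using bd[of "e / V"] that E True by simp
    then have "(LINT x|M. indicator E x * norm (f x)) \<le> 0" by (rule field_le_epsilon)
    then show ?thesis using True by simp
  next
    case False
    then have I: "I > 0" using I by simp
    \<comment> \<open>the threshold at which both terms of the bound are equal\<close>
    define l where "l = (I / V) powr (1 / p)"
    have l: "l > 0" using I E by (simp add: l_def)
    have 1: "l * V = V powr (1 - 1 / p) * I powr (1 / p)"
      using I E by (simp add: l_def powr_divide powr_diff)
    have "l powr (1 - p) = (I / V) powr (1 / p - 1)"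
      using p by (simp add: l_def powr_powr field_simps)
    then have 2: "l powr (1 - p) * I = V powr (1 - 1 / p) * I powr (1 / p)"
      using I E by (simp add: powr_divide powr_diff)
    show ?thesis using bd[OF l] unfolding 1 2 by (simp add: ac_simps)
  qed
qed

lemma Lp_diff:
  assumes p: "p \<ge> 1" and f: "Lp p A f" and g: "Lp p A g"
  shows "Lp p A (\<lambda>x. f x - g x)"
proof -
  have fm: "f \<in> borel_measurable (lebesgue_on A)" and gm: "g \<in> borel_measurable (lebesgue_on A)"
    using f g by (auto simp: Lp_def)
  have "integrable (lebesgue_on A) (\<lambda>x. 2 powr p * (norm (f x) powr p + norm (g x) powr p))"
    using f g by (auto simp: Lp_def)
  then have "integrable (lebesgue_on A) (\<lambda>x. norm (f x - g x) powr p)"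
  proof (rule Bochner_Integration.integrable_bound)
    show "(\<lambda>x. norm (f x - g x) powr p) \<in> borel_measurable (lebesgue_on A)"
      using fm gm by measurable
    show "AE x in lebesgue_on A. norm (norm (f x - g x) powr p)
        \<le> norm (2 powr p * (norm (f x) powr p + norm (g x) powr p))"
    proof (rule AE_I2)
      fix x
      let ?m = "max (norm (f x)) (norm (g x))"
      have "norm (f x - g x) \<le> 2 * ?m" using norm_triangle_ineq4[of "f x" "g x"] by linarith
      then have "norm (f x - g x) powr p \<le> (2 * ?m) powr p" using p by (intro powr_mono2) auto
      also have "\<dots> = 2 powr p * ?m powr p" by (simp add: powr_mult)
      also have "\<dots> \<le> 2 powr p * (norm (f x) powr p + norm (g x) powr p)"
        by (intro mult_left_mono) (auto simp: max_def)
      finally show "norm (norm (f x - g x) powr p)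
        \<le> norm (2 powr p * (norm (f x) powr p + norm (g x) powr p))" by simp
    qed
  qed
  then show ?thesis using fm gm by (simp add: Lp_def)
qed

text \<open>The form in which \<open>L\<^sup>p\<close> convergence is used: integrals against bounded weights of bounded support are
continuous in the \<open>L\<^sup>p\<close> norm.\<close>

lemma Lp_local_integral:
  fixes F :: "real^3 \<Rightarrow> 'b::euclidean_space"
  assumes p: "p \<ge> 1" and F: "Lp p A F" and A: "A \<in> sets lebesgue"
    and g: "g \<in> borel_measurable (lebesgue_on A)" "\<And>x. \<bar>g x\<bar> \<le> B * norm (F x)"
    and Q: "Q \<in> lmeasurable" "\<And>x. x \<notin> Q \<Longrightarrow> g x = 0" "measure lebesgue Q \<le> V" "V > 0"
    and B: "B \<ge> 0"
  shows "integrable (lebesgue_on A) g"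
    and "\<bar>integral\<^sup>L (lebesgue_on A) g\<bar> \<le> B * (2 * V powr (1 - 1 / p) * Lp_norm p A F)"
proof -
  let ?M = "lebesgue_on A"
  have QA: "Q \<inter> A \<in> sets ?M" using Q A by (auto simp: sets_restrict_space fmeasurableD)
  have em: "emeasure ?M (Q \<inter> A) = emeasure lebesgue (Q \<inter> A)"
    using A by (intro emeasure_restrict_space) auto
  have QA': "Q \<inter> A \<in> lmeasurable" using Q(1) A by (intro fmeasurable_Int_fmeasurable) auto
  have fin: "emeasure ?M (Q \<inter> A) < \<infinity>" using QA' em by (auto simp: fmeasurable_def)
  have le: "measure ?M (Q \<inter> A) \<le> V"
  proof -
    have "measure ?M (Q \<inter> A) = measure lebesgue (Q \<inter> A)" using em by (simp add: measure_def)
    also have "\<dots> \<le> measure lebesgue Q" using Q A by (intro measure_mono_fmeasurable) (auto simp: fmeasurableD)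
    finally show ?thesis using Q by simp
  qed
  note H = integral_norm_le_Lp[OF p _ _ QA fin le Q(4), of F]
  have F': "F \<in> borel_measurable ?M" "integrable ?M (\<lambda>x. norm (F x) powr p)"
    using F by (auto simp: Lp_def)
  have dom: "integrable ?M (\<lambda>x. B * (indicator (Q \<inter> A) x * norm (F x)))"
    by (intro integrable_mult_right H(1) F')
  have ptw: "norm (g x) \<le> B * (indicator (Q \<inter> A) x * norm (F x))" if "x \<in> A" for x
    using g(2)[of x] Q(2)[of x] that B by (auto simp: indicator_def)
  show int: "integrable ?M g"
  proof (rule Bochner_Integration.integrable_bound[OF dom g(1)], rule AE_I2)
    fix x assume "x \<in> space ?M"
    then have "x \<in> A" by (simp add: space_restrict_space)
    then show "norm (g x) \<le> norm (B * (indicator (Q \<inter> A) x * norm (F x)))" using ptw[of x] B by simp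
  qed
  have "\<bar>integral\<^sup>L ?M g\<bar> \<le> (LINT x|?M. norm (g x))" using integral_norm_bound[of ?M g] by simp
  also have "\<dots> \<le> (LINT x|?M. B * (indicator (Q \<inter> A) x * norm (F x)))"
    using int ptw by (intro integral_mono dom) (auto simp: space_restrict_space)
  also have "\<dots> = B * (LINT x|?M. indicator (Q \<inter> A) x * norm (F x))" by simp
  also have "\<dots> \<le> B * (2 * V powr (1 - 1 / p) * Lp_norm p A F)"
    unfolding Lp_norm_def using H(2)[OF F'] B by (intro mult_left_mono) auto
  finally show "\<bar>integral\<^sup>L ?M g\<bar> \<le> B * (2 * V powr (1 - 1 / p) * Lp_norm p A F)" .
qed

lemma test_function_C1:
  assumes "test_function \<Omega> (\<phi> :: real^3 \<Rightarrow> real)"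
  shows "C1_gradient \<phi> (\<lambda>x. \<chi> j. frechet_derivative \<phi> (at x) (axis j 1))"
  unfolding C1_gradient_def
proof (intro conjI allI)
  have C: "Ck (Suc 0) \<phi>" using assms unfolding test_function_def by blast
  fix x
  have d: "(\<phi> has_derivative frechet_derivative \<phi> (at x)) (at x)"
    using C by (simp add: frechet_derivative_works[symmetric])
  then have lin: "linear (frechet_derivative \<phi> (at x))" by (rule has_derivative_linear)
  have "frechet_derivative \<phi> (at x) v = (\<chi> j. frechet_derivative \<phi> (at x) (axis j 1)) \<bullet> v" for v
  proof -
    have "v = (\<Sum>j\<in>UNIV. v $ j *\<^sub>R axis j 1)"
      by (simp add: vec_eq_iff axis_def if_distrib cong: if_cong)
    then have "frechet_derivative \<phi> (at x) v = frechet_derivative \<phi> (at x) (\<Sum>j\<in>UNIV. v $ j *\<^sub>R axis j 1)" by simp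
    also have "\<dots> = (\<Sum>j\<in>UNIV. v $ j * frechet_derivative \<phi> (at x) (axis j 1))"
      using lin by (simp add: linear_sum linear_scale)
    finally show ?thesis by (simp add: inner_vec_def mult.commute)
  qed
  then show "(\<phi> has_derivative (\<lambda>v. (\<chi> j. frechet_derivative \<phi> (at x) (axis j 1)) \<bullet> v)) (at x)"
    using d by (metis (no_types, lifting) ext)
next
  have C: "Ck (Suc 0) \<phi>" using assms unfolding test_function_def by blast
  then show "continuous_on UNIV (\<lambda>x. \<chi> j. frechet_derivative \<phi> (at x) (axis j 1))"
    by (intro continuous_on_vec_lambda) simp
qed

lemma vector_test_function_C1:
  assumes "test_function \<Omega> (\<phi> :: real^3 \<Rightarrow> real^3)"
  shows "C1_gradient (\<lambda>x. \<phi> x $ i) (\<lambda>x. jacobian \<phi> (at x) $ i)"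
  unfolding C1_gradient_def
proof (intro conjI allI)
  have C: "Ck (Suc 0) \<phi>" using assms unfolding test_function_def by blast
  fix x
  have "(\<phi> has_derivative (\<lambda>h. jacobian \<phi> (at x) *v h)) (at x)"
    using C by (simp add: jacobian_works[symmetric])
  then have "((\<lambda>x. \<phi> x $ i) has_derivative (\<lambda>h. (jacobian \<phi> (at x) *v h) $ i)) (at x)"
    by (rule bounded_linear.has_derivative[OF bounded_linear_vec_nth])
  then show "((\<lambda>x. \<phi> x $ i) has_derivative (\<lambda>v. jacobian \<phi> (at x) $ i \<bullet> v)) (at x)"
    by (simp add: matrix_vector_mul_component)
next
  have C: "Ck (Suc 0) \<phi>" using assms unfolding test_function_def by blast
  have "(\<lambda>x. jacobian \<phi> (at x) $ i) = (\<lambda>x. \<chi> j. frechet_derivative \<phi> (at x) (axis j 1) $ i)"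
    by (simp add: jacobian_def matrix_def)
  then show "continuous_on UNIV (\<lambda>x. jacobian \<phi> (at x) $ i)"
    using C by (simp only:) (intro continuous_on_vec_lambda continuous_on_component, simp)
qed

lemma test_function_support:
  assumes "test_function \<Omega> \<phi>"
  obtains K where "compact K" "K \<subseteq> \<Omega>" "\<And>x. x \<notin> K \<Longrightarrow> \<phi> x = 0" "bounded K" "closed K"
proof
  show "compact (closure {x. \<phi> x \<noteq> 0})" "closure {x. \<phi> x \<noteq> 0} \<subseteq> \<Omega>"
    using assms unfolding test_function_def by blast+
  then show "bounded (closure {x. \<phi> x \<noteq> 0})" by (simp add: compact_imp_bounded)
  show "x \<notin> closure {x. \<phi> x \<noteq> 0} \<Longrightarrow> \<phi> x = 0" for x
    using closure_subset[of "{x. \<phi> x \<noteq> 0}"] by blast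
qed simp

lemma Lp_continuous_bounded_support:
  fixes f :: "real^3 \<Rightarrow> 'b::euclidean_space"
  assumes p: "p \<ge> 1" and A: "A \<in> sets lebesgue"
    and f: "continuous_on UNIV f" "bounded K" "\<And>x. x \<notin> K \<Longrightarrow> f x = 0"
  shows "Lp p A f"
proof -
  have "continuous_on UNIV (\<lambda>x. norm (f x) powr p)"
    using p by (intro continuous_on_powr' continuous_intros f(1)) auto
  then have "integrable lebesgue (\<lambda>x. norm (f x) powr p)"
    using f by (intro integrable_continuous_bounded_support(2)[where K = K]) auto
  then have "integrable (lebesgue_on A) (\<lambda>x. norm (f x) powr p)"
    using A integrable_mult_indicator[OF A, of "\<lambda>x. norm (f x) powr p"]
    by (subst integrable_restrict_space) auto
  moreover have "f \<in> borel_measurable (lebesgue_on A)"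
    using f(1) by (intro measurable_restrict_space1 measurable_completion) (simp add: borel_measurable_continuous_onI)
  ultimately show ?thesis by (simp add: Lp_def)
qed

lemma integral_lebesgue_on_eq:
  fixes f :: "real^3 \<Rightarrow> real"
  assumes "\<Omega> \<in> sets lebesgue" "\<And>x. x \<notin> \<Omega> \<Longrightarrow> f x = 0"
  shows "integral\<^sup>L (lebesgue_on \<Omega>) f = integral\<^sup>L lebesgue f"
proof -
  have "(\<lambda>x. indicator \<Omega> x *\<^sub>R f x) = f" using assms(2) by (fastforce simp: indicator_def)
  then show ?thesis using assms(1) integral_restrict_space[of \<Omega> lebesgue f] by simp
qed

lemma weighted_integral_tendsto:
  fixes F :: "nat \<Rightarrow> real^3 \<Rightarrow> 'b::euclidean_space" and c :: "'b \<Rightarrow> real"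
  assumes p: "p \<ge> 1" and A: "A \<in> sets lebesgue" and F: "\<And>n. Lp p A (F n)" and L: "Lp p A L"
    and lim: "(\<lambda>n. Lp_norm p A (\<lambda>x. F n x - L x)) \<longlonglongrightarrow> 0"
    and c: "bounded_linear c" "\<And>y. \<bar>c y\<bar> \<le> norm y"
    and w: "continuous_on UNIV w" "r > 0" "\<And>x. x \<notin> cball 0 r \<Longrightarrow> w x = 0"
  shows "integrable (lebesgue_on A) (\<lambda>x. c (L x) * w x)"
    and "(\<lambda>n. integral\<^sup>L (lebesgue_on A) (\<lambda>x. c (F n x) * w x)) \<longlonglongrightarrow> integral\<^sup>L (lebesgue_on A) (\<lambda>x. c (L x) * w x)"
proof -
  let ?M = "lebesgue_on A"
  obtain B where B: "\<And>x. \<bar>w x\<bar> \<le> B"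
    using integrable_continuous_bounded_support(3)[OF w(1) bounded_cball w(3)] unfolding real_norm_def by blast
  have B0: "B \<ge> 0" by (rule order_trans[OF abs_ge_zero B])
  define V where "V = measure lebesgue (cball (0::real^3) r)"
  have V: "V > 0" using w(2) by (simp add: V_def content_cball_pos)
  have wm: "w \<in> borel_measurable ?M"
    using w(1) by (intro measurable_restrict_space1 measurable_completion) (simp add: borel_measurable_continuous_onI)
  have W: "integrable ?M (\<lambda>x. c (v x) * w x)"
      "\<bar>(LINT x|?M. c (v x) * w x)\<bar> \<le> B * (2 * V powr (1 - 1 / p) * Lp_norm p A v)"
    if v: "Lp p A v" for v :: "real^3 \<Rightarrow> 'b"
  proof -
    have "v \<in> borel_measurable ?M" using v unfolding Lp_def by blast
    then have "(\<lambda>x. c (v x)) \<in> borel_measurable ?M"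
      by (rule measurable_compose[OF _ borel_measurable_continuous_onI[OF linear_continuous_on[OF c(1)]]])
    then have m: "(\<lambda>x. c (v x) * w x) \<in> borel_measurable ?M" using wm by (rule borel_measurable_times)
    have b: "\<bar>c (v x) * w x\<bar> \<le> B * norm (v x)" for x
      unfolding abs_mult using mult_mono[OF B[of x] c(2)[of "v x"] B0] by (simp add: mult.commute)
    show "integrable ?M (\<lambda>x. c (v x) * w x)"
      "\<bar>(LINT x|?M. c (v x) * w x)\<bar> \<le> B * (2 * V powr (1 - 1 / p) * Lp_norm p A v)"
      by (rule Lp_local_integral[OF p v A m b lmeasurable_cball[of 0 r] _ _ V B0]; simp add: w(3) V_def)+
  qed
  show "integrable ?M (\<lambda>x. c (L x) * w x)" by (rule W(1)[OF L])
  have "(\<lambda>n. (LINT x|?M. c (F n x) * w x) - (LINT x|?M. c (L x) * w x)) \<longlonglongrightarrow> 0"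
  proof (rule Lim_null_comparison)
    show "\<forall>\<^sub>F n in sequentially. norm ((LINT x|?M. c (F n x) * w x) - (LINT x|?M. c (L x) * w x))
        \<le> B * (2 * V powr (1 - 1 / p) * Lp_norm p A (\<lambda>x. F n x - L x))"
    proof (rule always_eventually, rule allI)
      fix n
      have "(LINT x|?M. c (F n x) * w x) - (LINT x|?M. c (L x) * w x)
          = (LINT x|?M. c (F n x - L x) * w x)"
        using W(1)[OF F[of n]] W(1)[OF L] by (simp add: left_diff_distrib linear_diff[OF bounded_linear.linear[OF c(1)]])
      then show "norm ((LINT x|?M. c (F n x) * w x) - (LINT x|?M. c (L x) * w x))
        \<le> B * (2 * V powr (1 - 1 / p) * Lp_norm p A (\<lambda>x. F n x - L x))"
        using W(2)[OF Lp_diff[OF p F[of n] L]] by simp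
    qed
    show "(\<lambda>n. B * (2 * V powr (1 - 1 / p) * Lp_norm p A (\<lambda>x. F n x - L x))) \<longlonglongrightarrow> 0"
      by (intro tendsto_mult_right_zero lim)
  qed
  then show "(\<lambda>n. (LINT x|?M. c (F n x) * w x)) \<longlonglongrightarrow> (LINT x|?M. c (L x) * w x)"
    by (rule LIM_zero_cancel)
qed

text \<open>The approximating test functions vanish near the boundary, so they can be integrated by parts against
a \<open>\<psi>\<close> that does not; both sides pass to the limit.\<close>

lemma zero_extension_weak_derivative:
  fixes i j :: 3
  assumes p: "p \<ge> 1" and \<Omega>: "open \<Omega>" and u: "Lp p \<Omega> u" and G: "Lp p \<Omega> G"
    and \<phi>: "\<And>n. test_function \<Omega> (\<phi> n)"
    and lim: "(\<lambda>n. Lp_norm p \<Omega> (\<lambda>x. \<phi> n x - u x)) \<longlonglongrightarrow> 0"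
      "(\<lambda>n. Lp_norm p \<Omega> (\<lambda>x. jacobian (\<phi> n) (at x) - G x)) \<longlonglongrightarrow> 0"
    and \<psi>: "C1_gradient \<psi> D" "bounded K" "\<And>x. x \<notin> K \<Longrightarrow> \<psi> x = 0"
  shows "integrable (lebesgue_on \<Omega>) (\<lambda>x. u x $ i * D x $ j)"
    and "integrable (lebesgue_on \<Omega>) (\<lambda>x. G x $ i $ j * \<psi> x)"
    and "(LINT x|lebesgue_on \<Omega>. u x $ i * D x $ j)
       = - (LINT x|lebesgue_on \<Omega>. G x $ i $ j * \<psi> x)"
proof -
  let ?M = "lebesgue_on \<Omega>"
  have \<Omega>L: "\<Omega> \<in> sets lebesgue" using \<Omega> by simp
  obtain r where r: "0 < r" "K \<subseteq> ball 0 r" using bounded_subset_ballD[OF \<psi>(2), of 0] by blast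
  have \<psi>0: "\<psi> x = 0" if "x \<notin> cball 0 r" for x using that \<psi>(3) r by force
  have D0: "D x $ j = 0" if "x \<notin> cball 0 r" for x
    using C1_gradient_eq_0[OF \<psi>(1) closed_cball \<psi>0 that] by simp
  note c = C1_gradientD(2,3)[OF \<psi>(1)]
  have "\<exists>K. K \<subseteq> \<Omega> \<and> (\<forall>x. x \<notin> K \<longrightarrow> \<phi> n x = 0) \<and> bounded K \<and> closed K" for n
    using test_function_support[OF \<phi>[of n]] by metis
  then obtain KK where KK: "\<And>n. KK n \<subseteq> \<Omega>" "\<And>n x. x \<notin> KK n \<Longrightarrow> \<phi> n x = 0"
    "\<And>n. bounded (KK n)" "\<And>n. closed (KK n)" by metis
  have out: "\<phi> n x = 0" if "x \<notin> \<Omega>" for n x using KK(1,2) that by blast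
  have \<phi>L: "Lp p \<Omega> (\<phi> n)" for n
  proof (rule Lp_continuous_bounded_support[OF p \<Omega>L _ KK(3)[of n]])
    have "Ck 0 (\<phi> n)" using \<phi>[of n] unfolding test_function_def by blast
    then show "continuous_on UNIV (\<phi> n)" by simp
  qed (rule KK(2))
  have J0: "jacobian (\<phi> n) (at x) $ k = 0" if "x \<notin> KK n" for n x k
    by (rule C1_gradient_eq_0[OF vector_test_function_C1[OF \<phi>[of n], of k] KK(4) _ that])
       (simp add: KK(2))
  have JL: "Lp p \<Omega> (\<lambda>x. jacobian (\<phi> n) (at x))" for n
  proof (rule Lp_continuous_bounded_support[OF p \<Omega>L _ KK(3)[of n]])
    have "continuous_on UNIV (\<lambda>x. \<chi> k. jacobian (\<phi> n) (at x) $ k)"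
      by (intro continuous_on_vec_lambda C1_gradientD(2)[OF vector_test_function_C1[OF \<phi>]])
    then show "continuous_on UNIV (\<lambda>x. jacobian (\<phi> n) (at x))" by simp
    show "\<And>x. x \<notin> KK n \<Longrightarrow> jacobian (\<phi> n) (at x) = 0"
      using J0 by (simp add: vec_eq_iff)
  qed
  have parts: "(LINT x|?M. \<phi> n x $ i * D x $ j) = - (LINT x|?M. jacobian (\<phi> n) (at x) $ i $ j * \<psi> x)" for n
  proof -
    have "(LINT x|lebesgue. jacobian (\<phi> n) (at x) $ i $ j * \<psi> x) = - (LINT x|lebesgue. \<phi> n x $ i * D x $ j)"
      by (rule integration_by_parts(1)[OF vector_test_function_C1[OF \<phi>] \<psi>(1) KK(3)[of n]])
         (simp add: KK(2))
    moreover have "(LINT x|?M. \<phi> n x $ i * D x $ j) = (LINT x|lebesgue. \<phi> n x $ i * D x $ j)"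
      by (rule integral_lebesgue_on_eq[OF \<Omega>L]) (simp add: out)
    moreover have "(LINT x|?M. jacobian (\<phi> n) (at x) $ i $ j * \<psi> x) = (LINT x|lebesgue. jacobian (\<phi> n) (at x) $ i $ j * \<psi> x)"
    proof (rule integral_lebesgue_on_eq[OF \<Omega>L])
      fix x assume "x \<notin> \<Omega>"
      then have "x \<notin> KK n" using KK(1)[of n] by blast
      then show "jacobian (\<phi> n) (at x) $ i $ j * \<psi> x = 0" using J0[of x n i] by simp
    qed
    ultimately show ?thesis by simp
  qed
  have li: "bounded_linear (\<lambda>y::real^3. y $ i)" "\<And>y::real^3. \<bar>y $ i\<bar> \<le> norm y"
    by (auto intro: bounded_linear_vec_nth component_le_norm_cart)
  have lij: "bounded_linear (\<lambda>y::real^3^3. y $ i $ j)" "\<And>y::real^3^3. \<bar>y $ i $ j\<bar> \<le> norm y"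
    using bounded_linear_compose[OF bounded_linear_vec_nth bounded_linear_vec_nth]
      order_trans[OF component_le_norm_cart Finite_Cartesian_Product.norm_nth_le] by auto
  note l1 = weighted_integral_tendsto[OF p \<Omega>L \<phi>L u lim(1) li continuous_on_component[OF c(1)] r(1) D0]
  note l2 = weighted_integral_tendsto[OF p \<Omega>L JL G lim(2) lij c(2) r(1) \<psi>0]
  show "integrable ?M (\<lambda>x. u x $ i * D x $ j)" by (rule l1(1))
  show "integrable ?M (\<lambda>x. G x $ i $ j * \<psi> x)" by (rule l2(1))
  show "(LINT x|?M. u x $ i * D x $ j) = - (LINT x|?M. G x $ i $ j * \<psi> x)"
    by (rule LIMSEQ_unique[OF l1(2)[unfolded parts] tendsto_minus[OF l2(2)]])
qed

lemma weak_integrable_test: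
  fixes g :: "real^3 \<Rightarrow> real"
  assumes T: "\<And>K. compact K \<Longrightarrow> K \<subseteq> T \<Longrightarrow> g absolutely_integrable_on K" and \<phi>: "test_function T (\<phi> :: real^3 \<Rightarrow> real)"
  shows "integrable lebesgue (\<lambda>x. g x * \<phi> x)"
proof -
  obtain K where s: "compact K" "K \<subseteq> T" "\<And>x. x \<notin> K \<Longrightarrow> \<phi> x = 0" "bounded K" "closed K"
    using test_function_support[OF \<phi>] by metis
  have "Ck 0 \<phi>" using \<phi> unfolding test_function_def by blast
  then have c: "continuous_on UNIV \<phi>" by simp
  obtain B where B: "\<And>x. \<bar>\<phi> x\<bar> \<le> B"
    using integrable_continuous_bounded_support(3)[OF c s(4) s(3)] unfolding real_norm_def by blast
  have i: "integrable lebesgue (\<lambda>x. indicator K x *\<^sub>R g x)"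
    using T[OF s(1,2)] unfolding set_integrable_def .
  have m: "(\<lambda>x. indicator K x *\<^sub>R g x * \<phi> x) \<in> borel_measurable lebesgue"
    using borel_measurable_integrable[OF i] c
    by (intro borel_measurable_times) (auto intro!: measurable_completion borel_measurable_continuous_onI)
  have "integrable lebesgue (\<lambda>x. indicator K x *\<^sub>R g x * \<phi> x)"
  proof (rule Bochner_Integration.integrable_bound[OF integrable_mult_right[OF i, of B] m], rule AE_I2)
    fix x
    show "norm (indicator K x *\<^sub>R g x * \<phi> x) \<le> norm (B * (indicator K x *\<^sub>R g x))"
      using mult_right_mono[OF order_trans[OF B[of x] abs_ge_self], of "\<bar>indicator K x *\<^sub>R g x\<bar>"]
      by (simp add: abs_mult mult.commute)
  qed
  moreover have "(\<lambda>x. indicator K x *\<^sub>R g x * \<phi> x) = (\<lambda>x. g x * \<phi> x)"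
    using s(3) by (fastforce simp: indicator_def)
  ultimately show ?thesis by simp
qed

lemma weak_equality:
  fixes g k :: "real^3 \<Rightarrow> real"
  assumes T: "open T"
    and g: "\<And>K. compact K \<Longrightarrow> K \<subseteq> T \<Longrightarrow> g absolutely_integrable_on K"
    and k: "\<And>K. compact K \<Longrightarrow> K \<subseteq> T \<Longrightarrow> k absolutely_integrable_on K"
    and eq: "\<And>\<phi>. test_function T \<phi> \<Longrightarrow> (LINT x|lebesgue. g x * \<phi> x) = (LINT x|lebesgue. k x * \<phi> x)"
  shows "AE x in lebesgue. x \<in> T \<longrightarrow> g x = k x"
proof -
  have "AE x in lebesgue. x \<in> T \<longrightarrow> g x - k x = 0"
  proof (rule fundamental_lemma_of_variations[OF T])
    show "(\<lambda>x. g x - k x) absolutely_integrable_on K" if "compact K" "K \<subseteq> T" for K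
      using g[OF that] k[OF that] by (rule set_integral_diff)
    show "(LINT x|lebesgue. (g x - k x) * \<phi> x) = 0" if "test_function T \<phi>" for \<phi>
      using eq[OF that] weak_integrable_test[OF g that] weak_integrable_test[OF k that]
      by (simp add: left_diff_distrib)
  qed
  then show ?thesis by simp
qed

lemma absolutely_integrable_matrix_component:
  fixes G :: "real^3 \<Rightarrow> real^3^3"
  assumes "G absolutely_integrable_on K"
  shows "(\<lambda>x. G x $ i $ j) absolutely_integrable_on K"
proof -
  have "bounded_linear (\<lambda>M::real^3^3. M $ i $ j)"
    by (rule bounded_linear_compose[OF bounded_linear_vec_nth bounded_linear_vec_nth])
  from absolutely_integrable_linear[OF assms this] show ?thesis by (simp add: o_def)
qed

lemma weak_gradient_test:
  assumes \<Omega>: "open \<Omega>" and G: "weak_gradient \<Omega> u G" and \<phi>: "test_function T (\<phi> :: real^3 \<Rightarrow> real)" and T: "T \<subseteq> \<Omega>"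
  shows "(LINT x|lebesgue. G x $ i $ j * \<phi> x) = - (LINT x|lebesgue. u x $ i * frechet_derivative \<phi> (at x) (axis j 1))"
proof -
  obtain K where s: "compact K" "K \<subseteq> T" "\<And>x. x \<notin> K \<Longrightarrow> \<phi> x = 0" "bounded K" "closed K"
    using test_function_support[OF \<phi>] by metis
  have \<phi>': "test_function \<Omega> \<phi>" using \<phi> T unfolding test_function_def by blast
  have \<Omega>L: "\<Omega> \<in> sets lebesgue" using \<Omega> by simp
  have "(\<chi> j. frechet_derivative \<phi> (at x) (axis j 1)) = (0::real^3)" if "x \<notin> K" for x
    by (rule C1_gradient_eq_0[OF test_function_C1[OF \<phi>] s(5) _ that]) (simp add: s(3))
  then have d0: "frechet_derivative \<phi> (at x) (axis j 1) = 0" if "x \<notin> K" for x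
    using that by (simp add: vec_eq_iff)
  have "(LINT x|lebesgue_on \<Omega>. u x $ i * frechet_derivative \<phi> (at x) (axis j 1))
      = (LINT x|lebesgue. u x $ i * frechet_derivative \<phi> (at x) (axis j 1))"
    by (rule integral_lebesgue_on_eq[OF \<Omega>L]) (metis d0 mult_zero_right s(2) subsetD T)
  moreover have "(LINT x|lebesgue_on \<Omega>. G x $ i $ j * \<phi> x) = (LINT x|lebesgue. G x $ i $ j * \<phi> x)"
    by (rule integral_lebesgue_on_eq[OF \<Omega>L]) (metis s(3) mult_zero_right s(2) subsetD T)
  ultimately show ?thesis using G \<phi>' unfolding weak_gradient_def by simp
qed

lemma weak_gradient_unique:
  assumes \<Omega>: "open \<Omega>" and G: "weak_gradient \<Omega> u G" and H: "weak_gradient \<Omega> u H"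
  shows "AE x in lebesgue. x \<in> \<Omega> \<longrightarrow> G x = H x"
proof -
  have "AE x in lebesgue. x \<in> \<Omega> \<longrightarrow> G x $ i $ j = H x $ i $ j" for i j
  proof (rule weak_equality[OF \<Omega>])
    show "(\<lambda>x. G x $ i $ j) absolutely_integrable_on K" "(\<lambda>x. H x $ i $ j) absolutely_integrable_on K"
      if "compact K" "K \<subseteq> \<Omega>" for K
      using G H that unfolding weak_gradient_def by (auto intro!: absolutely_integrable_matrix_component)
    show "(LINT x|lebesgue. G x $ i $ j * \<phi> x) = (LINT x|lebesgue. H x $ i $ j * \<phi> x)"
      if "test_function \<Omega> \<phi>" for \<phi>
      using weak_gradient_test[OF \<Omega> G that] weak_gradient_test[OF \<Omega> H that] by simp
  qed
  then have "AE x in lebesgue. \<forall>i j. x \<in> \<Omega> \<longrightarrow> G x $ i $ j = H x $ i $ j"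
    by (intro AE_all_countable[THEN iffD2] allI)
  then show ?thesis by eventually_elim (simp add: vec_eq_iff)
qed

text \<open>On the body both \<open>G\<close> and the gradient of the rigid motion are weak gradients of \<open>u\<close>.\<close>

lemma weak_gradient_rigid:
  assumes \<Omega>: "open \<Omega>" and S: "open S" "S \<subseteq> \<Omega>" and G: "weak_gradient \<Omega> u G" and rig: "rigid_on S xs us \<omega> u"
  shows "AE x in lebesgue. x \<in> S \<longrightarrow> (\<forall>i j. G x $ i $ j = cross3 \<omega> (axis j 1) $ i)"
proof -
  have "AE x in lebesgue. x \<in> S \<longrightarrow> G x $ i $ j = cross3 \<omega> (axis j 1) $ i" for i j
  proof (rule weak_equality[OF S(1)])
    show "(\<lambda>x. G x $ i $ j) absolutely_integrable_on K" if "compact K" "K \<subseteq> S" for K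
      using G S that unfolding weak_gradient_def by (auto intro!: absolutely_integrable_matrix_component)
    show "(\<lambda>x. cross3 \<omega> (axis j 1) $ i) absolutely_integrable_on K" if "compact K" "K \<subseteq> S" for K
      using that(1) by (intro absolutely_integrable_on_const lmeasurable_compact)
    fix \<phi> :: "real^3 \<Rightarrow> real" assume \<phi>: "test_function S \<phi>"
    obtain K where s: "compact K" "K \<subseteq> S" "\<And>x. x \<notin> K \<Longrightarrow> \<phi> x = 0" "bounded K" "closed K"
      using test_function_support[OF \<phi>] by metis
    define r where "r x = (us + cross3 \<omega> (x - xs)) $ i" for x
    define D where "D = (\<chi> k. cross3 \<omega> (axis k 1) $ i)"
    have rC: "C1_gradient r (\<lambda>_. D)"
      unfolding C1_gradient_def
    proof (intro conjI allI)
      fix x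
      have "((\<lambda>x. us + cross3 \<omega> (x - xs)) has_derivative (\<lambda>v. 0 + cross3 \<omega> (v - 0))) (at x)"
        by (intro has_derivative_add has_derivative_const bounded_linear.has_derivative[of "cross3 \<omega>"]
            has_derivative_diff has_derivative_ident)
           (use bilinear_cross in \<open>simp add: bilinear_def linear_conv_bounded_linear\<close>)
      then have "(r has_derivative (\<lambda>v. (0 + cross3 \<omega> (v - 0)) $ i)) (at x)"
        unfolding r_def by (rule bounded_linear.has_derivative[OF bounded_linear_vec_nth])
      moreover have "(\<lambda>v. (0 + cross3 \<omega> (v - 0)) $ i) = (\<lambda>v. D \<bullet> v)"
        using exhaust_3[of i] by (auto simp: fun_eq_iff D_def inner_vec_def sum_3 cross3_def axis_def)
      ultimately show "(r has_derivative (\<lambda>v. D \<bullet> v)) (at x)" by simp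
    qed simp
    have ae: "AE x in lebesgue. u x $ i * frechet_derivative \<phi> (at x) (axis j 1) = frechet_derivative \<phi> (at x) (axis j 1) * r x"
      using rig unfolding rigid_on_def
    proof eventually_elim
      case (elim x)
      show ?case
      proof (cases "x \<in> S")
        case True
        then show ?thesis using elim by (simp add: r_def)
      next
        case False
        then have "x \<notin> K" using s(2) by blast
        then have "(\<chi> j. frechet_derivative \<phi> (at x) (axis j 1)) = (0::real^3)"
          by (rule C1_gradient_eq_0[OF test_function_C1[OF \<phi>] s(5), rotated]) (simp add: s(3))
        then have "frechet_derivative \<phi> (at x) (axis j 1) = 0" by (simp add: vec_eq_iff)
        then show ?thesis by simp
      qed
    qed
    have ibp: "(LINT x|lebesgue. frechet_derivative \<phi> (at x) (axis j 1) * r x) = - (LINT x|lebesgue. \<phi> x * D $ j)"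
      "integrable lebesgue (\<lambda>x. frechet_derivative \<phi> (at x) (axis j 1) * r x)"
      using integration_by_parts(1,2)[OF test_function_C1[OF \<phi>] rC s(4), of j] s(3) by auto
    have "(LINT x|lebesgue. u x $ i * frechet_derivative \<phi> (at x) (axis j 1))
        = (LINT x|lebesgue. frechet_derivative \<phi> (at x) (axis j 1) * r x)"
    proof (rule integral_cong_AE[OF _ _ ae])
      show m: "(\<lambda>x. frechet_derivative \<phi> (at x) (axis j 1) * r x) \<in> borel_measurable lebesgue"
        using ibp(2) by (rule borel_measurable_integrable)
      have "AE x in lebesgue. frechet_derivative \<phi> (at x) (axis j 1) * r x = u x $ i * frechet_derivative \<phi> (at x) (axis j 1)"
        using ae by eventually_elim (rule sym)
      then show "(\<lambda>x. u x $ i * frechet_derivative \<phi> (at x) (axis j 1)) \<in> borel_measurable lebesgue"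
        by (rule borel_measurable_AE[OF m])
    qed
    then show "(LINT x|lebesgue. G x $ i $ j * \<phi> x) = (LINT x|lebesgue. cross3 \<omega> (axis j 1) $ i * \<phi> x)"
      using weak_gradient_test[OF \<Omega> G \<phi> S(2)] ibp(1) by (simp add: D_def mult.commute)
  qed
  then have "AE x in lebesgue. \<forall>i j. x \<in> S \<longrightarrow> G x $ i $ j = cross3 \<omega> (axis j 1) $ i"
    by (intro AE_all_countable[THEN iffD2] allI)
  then show ?thesis by eventually_elim simp
qed

section \<open>Profiles and moments\<close>

text \<open>The cube of the positive part is twice continuously differentiable, and composing polynomials with it
yields all cut-off functions that are needed.\<close>

definition cube_pos :: "real \<Rightarrow> real" where "cube_pos t = max 0 t ^ 3"

definition C2 :: "(real \<Rightarrow> real) \<Rightarrow> (real \<Rightarrow> real) \<Rightarrow> (real \<Rightarrow> real) \<Rightarrow> bool" where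
  "C2 f f' f'' \<longleftrightarrow> (\<forall>t. (f has_real_derivative f' t) (at t)) \<and>
     (\<forall>t. (f' has_real_derivative f'' t) (at t)) \<and> continuous_on UNIV f''"

lemma C2D:
  assumes "C2 f f' f''"
  shows "(f has_real_derivative f' t) (at t)" "(f' has_real_derivative f'' t) (at t)"
    "continuous_on UNIV f" "continuous_on UNIV f'" "continuous_on UNIV f''"
proof -
  show 1: "(f has_real_derivative f' t) (at t)" and 2: "(f' has_real_derivative f'' t) (at t)" for t
    using assms unfolding C2_def by auto
  show "continuous_on UNIV f" by (intro continuous_at_imp_continuous_on ballI DERIV_isCont[OF 1])
  show "continuous_on UNIV f'" by (intro continuous_at_imp_continuous_on ballI DERIV_isCont[OF 2])
  show "continuous_on UNIV f''" using assms unfolding C2_def by auto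
qed

lemma max_power_has_derivative:
  assumes "n \<ge> 1"
  shows "((\<lambda>t. max 0 t ^ Suc n) has_real_derivative real (Suc n) * max 0 t ^ n) (at (t::real))"
proof -
  consider "t > 0" | "t < 0" | "t = 0" by linarith
  then show ?thesis
  proof cases
    case 1
    have "((\<lambda>t. t ^ Suc n) has_real_derivative real (Suc n) * max 0 t ^ n) (at t)"
      by (rule DERIV_cong[OF DERIV_power_Suc[OF DERIV_ident]]) (use 1 in auto)
    then show ?thesis
      by (rule has_field_derivative_transform_within_open[of _ _ _ "{0<..}"]) (use 1 in auto)
  next
    case 2
    have "((\<lambda>t. 0) has_real_derivative real (Suc n) * max 0 t ^ n) (at t)"
      using 2 assms by (simp add: power_0_left)
    then show ?thesis
      by (rule has_field_derivative_transform_within_open[of _ _ _ "{..<0}"]) (use 2 in auto)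
  next
    case 3
    have "((\<lambda>s::real. max 0 s ^ n) \<longlongrightarrow> max 0 0 ^ n) (at 0)" by (intro tendsto_intros)
    then have l: "((\<lambda>s::real. max 0 s ^ n) \<longlongrightarrow> 0) (at 0)" using assms by (simp add: power_0_left)
    have "((\<lambda>s::real. max 0 s ^ Suc n / s) \<longlongrightarrow> 0) (at 0)"
    proof (rule Lim_null_comparison[OF _ l])
      show "\<forall>\<^sub>F s in at 0. norm (max 0 s ^ Suc n / s) \<le> max 0 (s::real) ^ n"
        using assms by (intro always_eventually allI) (auto simp: max_def abs_mult divide_simps power_0_left)
    qed
    then show ?thesis using 3 assms by (simp add: DERIV_def power_0_left)
  qed
qed

lemma C2_cube_pos:
  assumes f: "C2 f f' f''"
  shows "\<exists>g' g''. C2 (\<lambda>t. cube_pos (f t)) g' g''"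
proof (intro exI)
  let ?m = "\<lambda>t. max 0 (f t)"
  show "C2 (\<lambda>t. cube_pos (f t)) (\<lambda>t. 3 * ?m t ^ 2 * f' t) (\<lambda>t. 6 * ?m t * f' t * f' t + 3 * ?m t ^ 2 * f'' t)"
    unfolding C2_def
  proof (intro conjI allI)
    fix t
    have 1: "((\<lambda>t. ?m t ^ 3) has_real_derivative 3 * ?m t ^ 2 * f' t) (at t)"
      using DERIV_chain2[OF max_power_has_derivative[of 2 "f t"] C2D(1)[OF f]] by (simp add: numeral_3_eq_3 numeral_2_eq_2)
    then show "((\<lambda>t. cube_pos (f t)) has_real_derivative 3 * ?m t ^ 2 * f' t) (at t)"
      by (simp add: cube_pos_def)
    have 2: "((\<lambda>t. ?m t ^ 2) has_real_derivative 2 * ?m t * f' t) (at t)"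
      using DERIV_chain2[OF max_power_has_derivative[of 1 "f t"] C2D(1)[OF f]] by (simp add: numeral_2_eq_2)
    show "((\<lambda>t. 3 * ?m t ^ 2 * f' t) has_real_derivative 6 * ?m t * f' t * f' t + 3 * ?m t ^ 2 * f'' t) (at t)"
      by (rule DERIV_cong[OF DERIV_mult[OF DERIV_cmult[OF 2] C2D(2)[OF f]]]) (simp add: algebra_simps)
  qed (intro continuous_intros C2D(3-5)[OF f])
qed

lemma C2_affine: "C2 (\<lambda>t. a * t + b) (\<lambda>t. a) (\<lambda>t. 0)"
  unfolding C2_def by (auto intro!: derivative_eq_intros)

lemma C2_mult:
  assumes f: "C2 f f' f''" and g: "C2 g g' g''"
  shows "C2 (\<lambda>t. f t * g t) (\<lambda>t. f' t * g t + g' t * f t) (\<lambda>t. f'' t * g t + 2 * f' t * g' t + g'' t * f t)"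
  unfolding C2_def
proof (intro conjI allI)
  show "((\<lambda>t. f t * g t) has_real_derivative f' t * g t + g' t * f t) (at t)" for t
    by (rule DERIV_mult[OF C2D(1)[OF f] C2D(1)[OF g]])
  show "((\<lambda>t. f' t * g t + g' t * f t) has_real_derivative f'' t * g t + 2 * f' t * g' t + g'' t * f t) (at t)" for t
    by (rule DERIV_cong[OF DERIV_add[OF DERIV_mult[OF C2D(2)[OF f] C2D(1)[OF g]] DERIV_mult[OF C2D(2)[OF g] C2D(1)[OF f]]]])
       (simp add: algebra_simps)
qed (intro continuous_intros C2D(3-5)[OF f] C2D(3-5)[OF g])

lemma C2_diff_const:
  assumes f: "C2 f f' f''"
  shows "C2 (\<lambda>t. c - f t) (\<lambda>t. - f' t) (\<lambda>t. - f'' t)"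
  unfolding C2_def using C2D[OF f]
  by (auto intro!: derivative_eq_intros continuous_intros)

lemma derivative_0_on_open:
  assumes "(f has_real_derivative d) (at t)" "open T" "t \<in> T" "\<And>s. s \<in> T \<Longrightarrow> f s = c"
  shows "d = 0"
proof -
  have "((\<lambda>s. c) has_real_derivative d) (at t)"
    by (rule has_field_derivative_transform_within_open[OF assms(1,2,3)]) (use assms(4) in auto)
  then show ?thesis using DERIV_unique DERIV_const by blast
qed

lemma horizontal_profile:
  obtains a a' a'' where "C2 a a' a''" "\<And>t. \<bar>t\<bar> \<ge> 1 \<Longrightarrow> a t = 0" "\<And>t. a (- t) = a t" "\<And>t. a t \<ge> 0"
    "\<And>t. \<bar>t\<bar> \<le> 1/2 \<Longrightarrow> a t \<ge> 27 / 64"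
proof -
  have "C2 (\<lambda>t. 1 - (1 * t + 0) * (1 * t + 0)) (\<lambda>t. - (1 * (1 * t + 0) + 1 * (1 * t + 0))) (\<lambda>t. - (0 * (1 * t + 0) + 2 * 1 * 1 + 0 * (1 * t + 0)))"
    by (rule C2_diff_const[OF C2_mult[OF C2_affine C2_affine]])
  from C2_cube_pos[OF this] obtain a' a'' where a: "C2 (\<lambda>t. cube_pos (1 - t * t)) a' a''" by auto
  show ?thesis
  proof (rule that[OF a])
    show "cube_pos (1 - t * t) = 0" if "\<bar>t\<bar> \<ge> 1" for t
      using mult_mono[OF that that] by (simp add: cube_pos_def)
    show "cube_pos (1 - t * t) \<ge> 27 / 64" if "\<bar>t\<bar> \<le> 1/2" for t
    proof -
      have "\<bar>t\<bar> * \<bar>t\<bar> \<le> 1/2 * (1/2)" using that by (intro mult_mono) auto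
      then have "3/4 \<le> 1 - t * t" by simp
      then have "3/4 \<le> max 0 (1 - t * t)" by (rule max.coboundedI2)
      then have "(3/4) ^ 3 \<le> max 0 (1 - t * t) ^ 3" by (rule power_mono) simp
      then show ?thesis by (simp add: cube_pos_def power3_eq_cube)
    qed
  qed (auto simp: cube_pos_def)
qed

text \<open>Take \<open>\<Theta> t = t\<close> times a plateau function. It is linear in the gap, so \<open>\<Theta>''\<close> is
carried by the two slabs, and \<open>\<Theta>' (1/2) = 1\<close> fixes the integral of \<open>\<Theta>''\<close> over the upper slab to \<open>-1\<close>.\<close>

lemma vertical_profile:
  obtains \<Theta> \<Theta>' \<Theta>'' where "C2 \<Theta> \<Theta>' \<Theta>''" "\<And>t. t \<notin> {-2..3} \<Longrightarrow> \<Theta> t = 0 \<and> \<Theta>' t = 0"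
    "\<And>t. t \<notin> {-2<..<-1} \<Longrightarrow> t \<notin> {2<..<3} \<Longrightarrow> \<Theta>'' t = 0" "\<Theta>' (1/2) = 1"
proof -
  define w where "w s = cube_pos (1 - cube_pos (1 - s))" for s
  have w: "\<exists>g' g''. C2 (\<lambda>t. w (a * t + b)) g' g''" for a b
  proof -
    from C2_diff_const[OF C2_affine] have "C2 (\<lambda>t. 1 - (a * t + b)) (\<lambda>t. - a) (\<lambda>t. - 0)" .
    from C2_cube_pos[OF this] obtain g' g'' where "C2 (\<lambda>t. cube_pos (1 - (a * t + b))) g' g''" by auto
    from C2_cube_pos[OF C2_diff_const[OF this, of 1]] show ?thesis by (auto simp: w_def)
  qed
  have w0: "w s = 0" if "s \<le> 0" for s
  proof -
    have "1 ^ 3 \<le> max 0 (1 - s) ^ 3" using that by (intro power_mono) auto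
    then show ?thesis by (simp add: w_def cube_pos_def)
  qed
  have w1: "w s = 1" if "s \<ge> 1" for s using that by (simp add: w_def cube_pos_def)
  obtain l1 l2 where l: "C2 (\<lambda>t. w (1 * t + 2)) l1 l2" using w by blast
  obtain r1 r2 where r: "C2 (\<lambda>t. w (-1 * t + 3)) r1 r2" using w by blast
  define \<Theta> where "\<Theta> t = (1 * t + 0) * (w (1 * t + 2) * w (-1 * t + 3))" for t
  obtain \<Theta>' \<Theta>'' where \<Theta>: "C2 \<Theta> \<Theta>' \<Theta>''"
    unfolding \<Theta>_def[abs_def] using C2_mult[OF C2_affine C2_mult[OF l r]] by blast
  note d = C2D[OF \<Theta>]
  have low: "\<Theta> t = 0" if "t \<in> {..<-2}" for t using that w0 by (simp add: \<Theta>_def)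
  have high: "\<Theta> t = 0" if "t \<in> {3<..}" for t using that w0 by (simp add: \<Theta>_def)
  have mid: "\<Theta> t = t" if "t \<in> {-1<..<2}" for t using that w1 by (simp add: \<Theta>_def)
  have low1: "\<Theta>' t = 0" if "t \<in> {..<-2}" for t
    by (rule derivative_0_on_open[OF d(1) open_lessThan that low])
  have high1: "\<Theta>' t = 0" if "t \<in> {3<..}" for t
    by (rule derivative_0_on_open[OF d(1) open_greaterThan that high])
  have mid1: "\<Theta>' t = 1" if "t \<in> {-1<..<2}" for t
  proof -
    have "((\<lambda>t. \<Theta> t - t) has_real_derivative \<Theta>' t - 1) (at t)"
      by (intro DERIV_diff d DERIV_ident)
    then have "\<Theta>' t - 1 = 0"
      by (rule derivative_0_on_open[OF _ open_greaterThanLessThan that]) (simp add: mid)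
    then show ?thesis by simp
  qed
  have low2: "\<Theta>'' t = 0" if "t \<in> {..<-2}" for t
    by (rule derivative_0_on_open[OF d(2) open_lessThan that low1])
  have high2: "\<Theta>'' t = 0" if "t \<in> {3<..}" for t
    by (rule derivative_0_on_open[OF d(2) open_greaterThan that high1])
  have mid2: "\<Theta>'' t = 0" if "t \<in> {-1<..<2}" for t
    by (rule derivative_0_on_open[OF d(2) open_greaterThanLessThan that mid1])
  have cont: "continuous_on X \<Theta>''" for X by (rule continuous_on_subset[OF d(5)]) simp
  have "\<Theta>'' t = 0" if "t \<le> -2" for t
    by (rule continuous_constant_on_closure[OF cont, of "{..<-2}"]) (use that low2 in auto)
  moreover have "\<Theta>'' t = 0" if "t \<ge> 3" for t
    by (rule continuous_constant_on_closure[OF cont, of "{3<..}"]) (use that high2 in auto)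
  moreover have "\<Theta>'' t = 0" if "-1 \<le> t" "t \<le> 2" for t
    by (rule continuous_constant_on_closure[OF cont, of "{-1<..<2}"]) (use that mid2 in auto)
  ultimately have z: "\<Theta>'' t = 0" if "t \<notin> {-2<..<-1}" "t \<notin> {2<..<3}" for t
    using that by (metis greaterThanLessThan_iff linorder_not_less)
  show ?thesis
    by (rule that[OF \<Theta> _ z]) (use low high low1 high1 mid1 in auto)
qed

lemma integral_product3:
  fixes f g q :: "real \<Rightarrow> real"
  assumes "integrable lborel f" "integrable lborel g" "integrable lborel q"
  shows "integrable lebesgue (\<lambda>x::real^3. f (x$1) * g (x$2) * q (x$3))"
    and "integral\<^sup>L lebesgue (\<lambda>x::real^3. f (x$1) * g (x$2) * q (x$3)) =
      integral\<^sup>L lborel f * integral\<^sup>L lborel g * integral\<^sup>L lborel q"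
proof -
  interpret P: product_sigma_finite "\<lambda>_::real^3. lborel :: real measure" ..
  define F where "F b = (if b = axis 1 1 then f else if b = axis 2 1 then g else q)" for b :: "real^3"
  have B: "(\<Prod>b\<in>Basis. H b) = H (axis 1 1) * H (axis 2 1) * H (axis 3 1)" for H :: "real^3 \<Rightarrow> real"
  proof -
    have BB: "(Basis :: (real^3) set) = {axis 1 1, axis 2 1, axis 3 1}"
      by (auto simp: Basis_vec_def UNIV_3)
    show ?thesis unfolding BB by (simp add: axis_eq_axis)
  qed
  have F: "F (axis 1 1) = f" "F (axis 2 1) = g" "F (axis 3 1) = q"
    by (simp_all add: F_def axis_eq_axis)
  have Fi: "integrable lborel (F b)" for b using assms by (simp add: F_def)
  have fm: "f \<in> borel_measurable borel" "g \<in> borel_measurable borel" "q \<in> borel_measurable borel"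
    using assms[THEN borel_measurable_integrable] by simp_all
  have nth: "(\<lambda>x::real^3. x $ i) \<in> borel_measurable borel" for i
    by (intro borel_measurable_continuous_onI continuous_intros)
  have m: "(\<lambda>x::real^3. f (x$1) * g (x$2) * q (x$3)) \<in> borel_measurable borel"
    by (intro borel_measurable_times measurable_compose[OF nth] fm)
  have T: "(\<lambda>y. \<Sum>b\<in>Basis. y b *\<^sub>R b) \<in> measurable (Pi\<^sub>M Basis (\<lambda>_. lborel)) (borel :: (real^3) measure)"
    by measurable
  have val: "f ((\<Sum>b\<in>Basis. y b *\<^sub>R b) $ 1) * g ((\<Sum>b\<in>Basis. y b *\<^sub>R b) $ 2) * q ((\<Sum>b\<in>Basis. y b *\<^sub>R b) $ 3)
      = (\<Prod>b\<in>Basis. F b (y b))" for y :: "real^3 \<Rightarrow> real"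
  proof -
    have "(\<Sum>b\<in>Basis. y b *\<^sub>R b) $ i = y (axis i 1)" for i
    proof -
      have "(\<Sum>b\<in>Basis. y b *\<^sub>R b) \<bullet> axis i 1 = y (axis i 1)"
        by (rule inner_sum_left_Basis) (simp add: axis_in_Basis_iff)
      then show ?thesis by (simp add: inner_axis)
    qed
    then show ?thesis by (simp add: B F)
  qed
  have "integrable (Pi\<^sub>M Basis (\<lambda>_. lborel)) (\<lambda>y. \<Prod>b\<in>Basis. F b (y b))"
    by (rule P.product_integrable_prod) (auto simp: Fi)
  then have "integrable lborel (\<lambda>x::real^3. f (x$1) * g (x$2) * q (x$3))"
    unfolding lborel_eq[where 'a="real^3"] by (subst integrable_distr_eq[OF T m]) (simp only: val)
  then show "integrable lebesgue (\<lambda>x::real^3. f (x$1) * g (x$2) * q (x$3))"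
    using m by (simp add: integrable_completion)
  have "integral\<^sup>L lborel (\<lambda>x::real^3. f (x$1) * g (x$2) * q (x$3)) = integral\<^sup>L (Pi\<^sub>M Basis (\<lambda>_. lborel)) (\<lambda>y. \<Prod>b\<in>Basis. F b (y b))"
    unfolding lborel_eq[where 'a="real^3"] by (subst integral_distr[OF T m]) (simp only: val)
  also have "\<dots> = (\<Prod>b\<in>Basis. integral\<^sup>L lborel (F b))"
    by (rule P.product_integral_prod) (auto simp: Fi)
  finally show "integral\<^sup>L lebesgue (\<lambda>x::real^3. f (x$1) * g (x$2) * q (x$3)) =
      integral\<^sup>L lborel f * integral\<^sup>L lborel g * integral\<^sup>L lborel q"
    using m by (simp add: integral_completion B F)
qed

lemma integrable_scaled:
  fixes f :: "real \<Rightarrow> real"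
  assumes "integrable lborel f" "s > 0"
  shows "integrable lborel (\<lambda>t. f (t / s))" "(LINT t|lborel. f (t / s)) = s * integral\<^sup>L lborel f"
proof -
  show "integrable lborel (\<lambda>t. f (t / s))"
    using lborel_integrable_real_affine[of f "1 / s" 0] assms by simp
  show "(LINT t|lborel. f (t / s)) = s * integral\<^sup>L lborel f"
    using lborel_integral_real_affine[of s "\<lambda>t. f (t / s)" 0] assms by simp
qed

text \<open>Components of a rigid motion are affine, so their weighted integrals reduce to the zeroth and first
moments of the three profiles. The third moment is centred at \<open>1\<close> because \<open>P\<close> has height \<open>h\<close>.\<close>

lemma affine_moment:
  fixes f g q :: "real \<Rightarrow> real"
  assumes f: "integrable lborel f" "integrable lborel (\<lambda>t. t * f t)"
    and g: "integrable lborel g" "integrable lborel (\<lambda>t. t * g t)"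
    and q: "integrable lborel q" "integrable lborel (\<lambda>t. (t - 1) * q t)"
    and s: "s > 0" and h: "h > 0"
  shows "integral\<^sup>L lebesgue (\<lambda>x::real^3. (c0 + c1 * x$1 + c2 * x$2 + c3 * (x$3 - h)) *
      (f (x$1 / s) * g (x$2 / s) * q (x$3 / h))) =
    s\<^sup>2 * h * (c0 * (integral\<^sup>L lborel f * integral\<^sup>L lborel g * integral\<^sup>L lborel q)
      + c1 * s * ((LINT t|lborel. t * f t) * integral\<^sup>L lborel g * integral\<^sup>L lborel q)
      + c2 * s * (integral\<^sup>L lborel f * (LINT t|lborel. t * g t) * integral\<^sup>L lborel q)
      + c3 * h * (integral\<^sup>L lborel f * integral\<^sup>L lborel g * (LINT t|lborel. (t - 1) * q t)))"
proof -
  note fs = integrable_scaled[OF f(1) s] and fs1 = integrable_scaled[OF f(2) s]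
  note gs = integrable_scaled[OF g(1) s] and gs1 = integrable_scaled[OF g(2) s]
  note qs = integrable_scaled[OF q(1) h] and qs1 = integrable_scaled[OF q(2) h]
  note I0 = integral_product3[OF fs(1) gs(1) qs(1)]
  note I1 = integral_product3[OF fs1(1) gs(1) qs(1)]
  note I2 = integral_product3[OF fs(1) gs1(1) qs(1)]
  note I3 = integral_product3[OF fs(1) gs(1) qs1(1)]
  have eq: "(\<lambda>x::real^3. (c0 + c1 * x$1 + c2 * x$2 + c3 * (x$3 - h)) *
      (f (x$1 / s) * g (x$2 / s) * q (x$3 / h))) =
    (\<lambda>x. c0 * (f (x$1 / s) * g (x$2 / s) * q (x$3 / h))
       + (c1 * s) * ((x$1 / s * f (x$1 / s)) * g (x$2 / s) * q (x$3 / h))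
       + (c2 * s) * (f (x$1 / s) * (x$2 / s * g (x$2 / s)) * q (x$3 / h))
       + (c3 * h) * (f (x$1 / s) * g (x$2 / s) * ((x$3 / h - 1) * q (x$3 / h))))"
  proof
    fix x :: "real^3"
    show "(c0 + c1 * x$1 + c2 * x$2 + c3 * (x$3 - h)) *
      (f (x$1 / s) * g (x$2 / s) * q (x$3 / h)) =
      c0 * (f (x$1 / s) * g (x$2 / s) * q (x$3 / h))
       + (c1 * s) * ((x$1 / s * f (x$1 / s)) * g (x$2 / s) * q (x$3 / h))
       + (c2 * s) * (f (x$1 / s) * (x$2 / s * g (x$2 / s)) * q (x$3 / h))
       + (c3 * h) * (f (x$1 / s) * g (x$2 / s) * ((x$3 / h - 1) * q (x$3 / h)))"
      using s h by (simp add: algebra_simps)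
  qed
  have lin: "(LINT x|lebesgue. d0 * F0 x + d1 * F1 x + d2 * F2 x + d3 * F3 x) =
      d0 * integral\<^sup>L lebesgue F0 + d1 * integral\<^sup>L lebesgue F1 + d2 * integral\<^sup>L lebesgue F2 + d3 * integral\<^sup>L lebesgue F3"
    if "integrable lebesgue F0" "integrable lebesgue F1" "integrable lebesgue F2" "integrable lebesgue F3"
    for d0 d1 d2 d3 and F0 F1 F2 F3 :: "real^3 \<Rightarrow> real"
    using that by simp
  show ?thesis
    unfolding eq lin[OF I0(1) I1(1) I2(1) I3(1)]
    unfolding I0(2) I1(2) I2(2) I3(2) fs(2) fs1(2) gs(2) gs1(2) qs(2) qs1(2)
    by (simp add: distrib_left power2_eq_square mult.assoc mult.left_commute)
qed

lemma C1_gradient_product3: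
  assumes a: "\<And>t. (a has_real_derivative a' t) (at t)" "continuous_on UNIV a'"
    and b: "\<And>t. (b has_real_derivative b' t) (at t)" "continuous_on UNIV b'"
    and c: "\<And>t. (c has_real_derivative c' t) (at t)" "continuous_on UNIV c'"
  shows "C1_gradient (\<lambda>x. a (x$1) * b (x$2) * c (x$3))
    (\<lambda>x. vector [a' (x$1) * b (x$2) * c (x$3), a (x$1) * b' (x$2) * c (x$3), a (x$1) * b (x$2) * c' (x$3)])"
proof -
  have nth: "C1_gradient (\<lambda>x. f (x$i)) (\<lambda>x. f' (x$i) *\<^sub>R axis i 1)"
    if f: "\<And>t. (f has_real_derivative f' t) (at t)" "continuous_on UNIV f'" for f f' i
    unfolding C1_gradient_def
  proof (intro conjI allI)
    fix x :: "real^3"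
    have "((\<lambda>x::real^3. x $ i) has_derivative (\<lambda>v. v $ i)) (at x)"
      by (rule bounded_linear.has_derivative[OF bounded_linear_vec_nth has_derivative_ident])
    then have "((\<lambda>x. f (x$i)) has_derivative (\<lambda>v. f' (x$i) * v$i)) (at x)"
      by (rule has_derivative_compose[OF _ f(1)[unfolded has_field_derivative_def]])
    then show "((\<lambda>x. f (x$i)) has_derivative (\<lambda>v. (f' (x$i) *\<^sub>R axis i 1) \<bullet> v)) (at x)"
      by (simp add: inner_axis')
    have "continuous_on UNIV (\<lambda>x::real^3. f' (x$i))"
      by (rule continuous_on_compose2[OF f(2)]) (auto intro!: continuous_on_component continuous_on_id)
    then show "continuous_on UNIV (\<lambda>x::real^3. f' (x$i) *\<^sub>R (axis i 1 :: real^3))"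
      by (intro continuous_intros)
  qed
  have "C1_gradient (\<lambda>x. a (x$1) * b (x$2) * c (x$3))
     (\<lambda>x. (a (x$1) * b (x$2)) *\<^sub>R (c' (x$3) *\<^sub>R axis 3 1) + c (x$3) *\<^sub>R
       (a (x$1) *\<^sub>R (b' (x$2) *\<^sub>R axis 2 1) + b (x$2) *\<^sub>R (a' (x$1) *\<^sub>R axis 1 1)))"
    by (intro C1_gradient_mult nth a b c)
  moreover have "(\<lambda>x. (a (x$1) * b (x$2)) *\<^sub>R (c' (x$3) *\<^sub>R axis 3 1) + c (x$3) *\<^sub>R
       (a (x$1) *\<^sub>R (b' (x$2) *\<^sub>R axis 2 1) + b (x$2) *\<^sub>R (a' (x$1) *\<^sub>R axis 1 1)))
    = (\<lambda>x::real^3. vector [a' (x$1) * b (x$2) * c (x$3), a (x$1) * b' (x$2) * c (x$3), a (x$1) * b (x$2) * c' (x$3)] :: real^3)"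
    by (auto simp: fun_eq_iff vec_eq_iff forall_3 axis_def)
  ultimately show ?thesis by simp
qed

section \<open>Momentum and flux across the gap\<close>

definition gap_box :: "real \<Rightarrow> real \<Rightarrow> (real^3) set" where
  "gap_box s h = cbox (vector [- s, - s, - 2 * h]) (vector [s, s, 3 * h])"

text \<open>The properties of the zero extensions \<open>U\<close>, \<open>\<Gamma>\<close> of the velocity and its gradient that the estimates use; \<open>v\<close> is
the velocity at \<open>P\<close>. Only the third column of \<open>\<Gamma>\<close> is measured, because on the body it involves \<open>\<omega>\<close> through its
tangential part alone.\<close>

locale gap_flow =
  fixes s h Y :: real and U :: "real^3 \<Rightarrow> real^3" and \<Gamma> :: "real^3 \<Rightarrow> real^3^3" and v \<omega> :: "real^3"
  assumes velocity_integrable: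
      "\<lbrakk>C1_gradient \<psi> D; bounded K; \<And>x. x \<notin> K \<Longrightarrow> \<psi> x = 0\<rbrakk> \<Longrightarrow> integrable lebesgue (\<lambda>x. U x $ i * D x $ j)"
    and gradient_integrable:
      "\<lbrakk>C1_gradient \<psi> D; bounded K; \<And>x. x \<notin> K \<Longrightarrow> \<psi> x = 0\<rbrakk> \<Longrightarrow> integrable lebesgue (\<lambda>x. \<Gamma> x $ i $ j * \<psi> x)"
    and weak_identity: "\<lbrakk>C1_gradient \<psi> D; bounded K; \<And>x. x \<notin> K \<Longrightarrow> \<psi> x = 0\<rbrakk> \<Longrightarrow>
        (LINT x|lebesgue. U x $ i * D x $ j) = - (LINT x|lebesgue. \<Gamma> x $ i $ j * \<psi> x)"
    and divergence_free: "AE x in lebesgue. trace (\<Gamma> x) = 0"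
    and rigid_above: "AE x in lebesgue. \<bar>x$1\<bar> < s \<longrightarrow> \<bar>x$2\<bar> < s \<longrightarrow> 2 * h < x$3 \<longrightarrow> x$3 < 3 * h \<longrightarrow>
        U x = v + cross3 \<omega> (x - vector [0, 0, h])"
    and zero_below: "AE x in lebesgue. \<bar>x$1\<bar> < s \<longrightarrow> \<bar>x$2\<bar> < s \<longrightarrow> - 2 * h < x$3 \<longrightarrow> x$3 < - h \<longrightarrow> U x = 0"
    and column_integrable: "integrable lebesgue (\<lambda>x. indicator (gap_box s h) x * \<bar>\<Gamma> x $ i $ 3\<bar>)"
    and column_bound: "(LINT x|lebesgue. indicator (gap_box s h) x * \<bar>\<Gamma> x $ i $ 3\<bar>) \<le> Y"

definition horizontal :: "real \<Rightarrow> (real \<Rightarrow> real) \<Rightarrow> (real \<Rightarrow> real) \<Rightarrow> (real \<Rightarrow> real) \<Rightarrow> bool" where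
  "horizontal M f f' f'' \<longleftrightarrow> C2 f f' f'' \<and> (\<forall>t. \<bar>t\<bar> \<ge> 1 \<longrightarrow> f t = 0) \<and> (\<forall>t. \<bar>f t\<bar> \<le> M \<and> \<bar>f' t\<bar> \<le> M)"

definition vertical :: "real \<Rightarrow> (real \<Rightarrow> real) \<Rightarrow> (real \<Rightarrow> real) \<Rightarrow> (real \<Rightarrow> real) \<Rightarrow> bool" where
  "vertical M \<Theta> \<Theta>' \<Theta>'' \<longleftrightarrow> C2 \<Theta> \<Theta>' \<Theta>'' \<and> (\<forall>t. t \<notin> {-2..3} \<longrightarrow> \<Theta> t = 0 \<and> \<Theta>' t = 0) \<and>
     (\<forall>t. t \<notin> {-2<..<-1} \<longrightarrow> t \<notin> {2<..<3} \<longrightarrow> \<Theta>'' t = 0) \<and> (\<forall>t. \<bar>\<Theta> t\<bar> \<le> M \<and> \<bar>\<Theta>' t\<bar> \<le> M)"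

lemma outside_gap_box:
  assumes "x \<notin> gap_box s h" "s > 0" "h > 0"
  shows "\<bar>x$1 / s\<bar> > 1 \<or> \<bar>x$2 / s\<bar> > 1 \<or> x$3 / h \<notin> {-2..3}"
  using assms by (auto simp: gap_box_def mem_box_cart forall_3 field_simps abs_if split: if_splits)

lemma horizontal_derivative_0:
  assumes "horizontal M f f' f''" "\<bar>t\<bar> > 1"
  shows "f' t = 0"
proof -
  have "open (- {-1..1::real})" by (intro open_Compl closed_atLeastAtMost)
  moreover have "(f has_real_derivative f' t) (at t)" and "\<And>r. r \<in> - {-1..1} \<Longrightarrow> f r = 0"
    using assms(1) C2D(1)[of f f' f''] unfolding horizontal_def by auto
  ultimately show ?thesis
    using derivative_0_on_open[of f "f' t" t "- {-1..1}" 0] assms(2) by (simp add: abs_if not_le split: if_splits)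
qed

lemma scaled_C2:
  assumes "C2 f f' f''" "s > 0"
  shows "((\<lambda>t. f (t / s)) has_real_derivative f' (t / s) / s) (at t)"
    "((\<lambda>t. f' (t / s)) has_real_derivative f'' (t / s) / s) (at t)"
    "continuous_on UNIV (\<lambda>t. f' (t / s) / s)" "continuous_on UNIV (\<lambda>t. f'' (t / s) / s)"
proof -
  have d: "((\<lambda>t. t / s) has_real_derivative 1 / s) (at t)"
    using assms by (auto intro!: derivative_eq_intros)
  show "((\<lambda>t. f (t / s)) has_real_derivative f' (t / s) / s) (at t)"
    using DERIV_chain2[OF C2D(1)[OF assms(1)] d] by simp
  show "((\<lambda>t. f' (t / s)) has_real_derivative f'' (t / s) / s) (at t)"
    using DERIV_chain2[OF C2D(2)[OF assms(1)] d] by simp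
  have c: "continuous_on UNIV (\<lambda>t. t / s)" using assms by (intro continuous_intros) auto
  have "continuous_on UNIV (\<lambda>t. g (t / s) / s)" if "continuous_on UNIV g" for g :: "real \<Rightarrow> real"
    using assms(2) continuous_on_compose2[OF that c] by (intro continuous_intros) auto
  then show "continuous_on UNIV (\<lambda>t. f' (t / s) / s)" "continuous_on UNIV (\<lambda>t. f'' (t / s) / s)"
    using C2D(4,5)[OF assms(1)] by blast+
qed

context
  fixes s h Y M :: real and U :: "real^3 \<Rightarrow> real^3" and \<Gamma> v \<omega> a a' a'' b b' b'' \<Theta> \<Theta>' \<Theta>''
  assumes flow: "gap_flow s h Y U \<Gamma> v \<omega>" and s: "s > 0" and h: "h > 0"
    and a: "horizontal M a a' a''" and b: "horizontal M b b' b''" and \<Theta>: "vertical M \<Theta> \<Theta>' \<Theta>''"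
begin

lemma profiles:
  shows aC: "C2 a a' a''" and bC: "C2 b b' b''" and \<Theta>C: "C2 \<Theta> \<Theta>' \<Theta>''"
    and a0: "\<bar>t\<bar> \<ge> 1 \<Longrightarrow> a t = 0" and b0: "\<bar>t\<bar> \<ge> 1 \<Longrightarrow> b t = 0"
    and a0': "\<bar>t\<bar> > 1 \<Longrightarrow> a' t = 0" and b0': "\<bar>t\<bar> > 1 \<Longrightarrow> b' t = 0"
    and \<Theta>0: "t \<notin> {-2..3} \<Longrightarrow> \<Theta> t = 0" and \<Theta>0': "t \<notin> {-2..3} \<Longrightarrow> \<Theta>' t = 0"
    and \<Theta>0'': "t \<notin> {-2<..<-1} \<Longrightarrow> t \<notin> {2<..<3} \<Longrightarrow> \<Theta>'' t = 0"
  using a b \<Theta> horizontal_derivative_0[OF a] horizontal_derivative_0[OF b]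
  unfolding horizontal_def vertical_def by auto

lemma weighted_gradient_bound:
  assumes "integrable lebesgue (\<lambda>x. \<Gamma> x $ i $ 3 * w x)" "\<And>x. \<bar>w x\<bar> \<le> B" "\<And>x. x \<notin> gap_box s h \<Longrightarrow> w x = 0" "B \<ge> 0"
  shows "\<bar>(LINT x|lebesgue. \<Gamma> x $ i $ 3 * w x)\<bar> \<le> B * Y"
proof -
  have "\<bar>(LINT x|lebesgue. \<Gamma> x $ i $ 3 * w x)\<bar> \<le> (LINT x|lebesgue. norm (\<Gamma> x $ i $ 3 * w x))"
    using integral_norm_bound[of lebesgue "\<lambda>x. \<Gamma> x $ i $ 3 * w x"] by simp
  also have "\<dots> \<le> (LINT x|lebesgue. B * (indicator (gap_box s h) x * \<bar>\<Gamma> x $ i $ 3\<bar>))"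
  proof (rule integral_mono)
    show "integrable lebesgue (\<lambda>x. norm (\<Gamma> x $ i $ 3 * w x))" using assms(1) by (rule integrable_norm)
    show "integrable lebesgue (\<lambda>x. B * (indicator (gap_box s h) x * \<bar>\<Gamma> x $ i $ 3\<bar>))"
      by (intro integrable_mult_right gap_flow.column_integrable[OF flow])
    show "norm (\<Gamma> x $ i $ 3 * w x) \<le> B * (indicator (gap_box s h) x * \<bar>\<Gamma> x $ i $ 3\<bar>)" for x
      using assms(2)[of x] assms(3)[of x] mult_right_mono[OF assms(2)[of x], of "\<bar>\<Gamma> x $ i $ 3\<bar>"]
      by (cases "x \<in> gap_box s h") (auto simp: abs_mult mult.commute)
  qed
  also have "\<dots> \<le> B * Y" using gap_flow.column_bound[OF flow, of i] assms(4) by (simp add: mult_left_mono)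
  finally show ?thesis .
qed

lemma M_nonneg: "M \<ge> 0"
  using a order_trans[OF abs_ge_zero] unfolding horizontal_def by blast

lemma prod3_bound:
  assumes "\<bar>p1\<bar> \<le> M" "\<bar>p2\<bar> \<le> M" "\<bar>p3\<bar> \<le> M"
  shows "\<bar>p1 * p2 * p3\<bar> \<le> M ^ 3"
  unfolding abs_mult power3_eq_cube using assms M_nonneg by (intro mult_mono) auto

lemma bounds: "\<bar>a t\<bar> \<le> M" "\<bar>a' t\<bar> \<le> M" "\<bar>b t\<bar> \<le> M" "\<bar>b' t\<bar> \<le> M" "\<bar>\<Theta> t\<bar> \<le> M" "\<bar>\<Theta>' t\<bar> \<le> M"
  using a b \<Theta> unfolding horizontal_def vertical_def by auto

text \<open>The weak identity for \<open>\<partial>\<^sub>3\<close> with weight \<open>a b \<Theta>'\<close>: a tangential velocity on the upper slab costs a vertical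
gradient, since \<open>U\<close> vanishes on the lower one.\<close>

lemma vertical_identity:
  shows "integrable lebesgue (\<lambda>x. U x $ i * (a (x$1 / s) * b (x$2 / s) * \<Theta>'' (x$3 / h)))"
    and "\<bar>(LINT x|lebesgue. U x $ i * (a (x$1 / s) * b (x$2 / s) * \<Theta>'' (x$3 / h)))\<bar> \<le> h * (M ^ 3 * Y)"
proof -
  let ?\<psi> = "\<lambda>x::real^3. a (x$1 / s) * b (x$2 / s) * \<Theta>' (x$3 / h)"
  let ?I = "\<lambda>x. U x $ i * (a (x$1 / s) * b (x$2 / s) * \<Theta>'' (x$3 / h))"
  have C: "C1_gradient ?\<psi> (\<lambda>x. vector [a' (x$1 / s) / s * b (x$2 / s) * \<Theta>' (x$3 / h),
      a (x$1 / s) * (b' (x$2 / s) / s) * \<Theta>' (x$3 / h), a (x$1 / s) * b (x$2 / s) * (\<Theta>'' (x$3 / h) / h)])"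
    by (rule C1_gradient_product3[OF scaled_C2(1,3)[OF aC s] scaled_C2(1,3)[OF bC s] scaled_C2(2,4)[OF \<Theta>C h]])
  have out: "?\<psi> x = 0" if "x \<notin> gap_box s h" for x
  proof -
    have "a (x$1 / s) = 0 \<or> b (x$2 / s) = 0 \<or> \<Theta>' (x$3 / h) = 0"
      using outside_gap_box[OF that s h] a0 b0 \<Theta>0' less_imp_le by metis
    then show ?thesis by auto
  qed
  have bd: "bounded (gap_box s h)" by (simp add: gap_box_def bounded_cbox)
  have f: "(\<lambda>x. U x $ i * (vector [a' (x$1 / s) / s * b (x$2 / s) * \<Theta>' (x$3 / h),
      a (x$1 / s) * (b' (x$2 / s) / s) * \<Theta>' (x$3 / h), a (x$1 / s) * b (x$2 / s) * (\<Theta>'' (x$3 / h) / h)] :: real^3) $ 3)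
     = (\<lambda>x. (1 / h) * ?I x)" by (simp add: fun_eq_iff)
  have "integrable lebesgue (\<lambda>x. (1 / h) * ?I x)"
    using gap_flow.velocity_integrable[OF flow C bd out, of i 3] unfolding f .
  then have "integrable lebesgue (\<lambda>x. h * ((1 / h) * ?I x))" by (rule integrable_mult_right)
  then show int: "integrable lebesgue ?I" using h by simp
  have "(LINT x|lebesgue. (1 / h) * ?I x) = - (LINT x|lebesgue. \<Gamma> x $ i $ 3 * ?\<psi> x)"
    using gap_flow.weak_identity[OF flow C bd out, of i 3] unfolding f .
  then have eq: "integral\<^sup>L lebesgue ?I = h * (- (LINT x|lebesgue. \<Gamma> x $ i $ 3 * ?\<psi> x))"
    using h by (simp add: field_simps)
  have "\<bar>(LINT x|lebesgue. \<Gamma> x $ i $ 3 * ?\<psi> x)\<bar> \<le> M ^ 3 * Y"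
    by (rule weighted_gradient_bound[OF gap_flow.gradient_integrable[OF flow C bd out] _ out])
       (use prod3_bound bounds M_nonneg in auto)
  then show "\<bar>integral\<^sup>L lebesgue ?I\<bar> \<le> h * (M ^ 3 * Y)"
    unfolding eq using h by (simp add: abs_mult)
qed

text \<open>What crosses the upper slab has to leave sideways: the divergence condition with weight \<open>a b \<Theta>'\<close> turns the
vertical flux into \<open>(h/s) (\<integral> U\<^sub>1 a' b \<Theta>' + \<integral> U\<^sub>2 a b' \<Theta>')\<close> up to sign, and each of these integrals is in turn a vertical
identity with weight \<open>a' b \<Theta>\<close> or \<open>a b' \<Theta>\<close>.\<close>

lemma flux_identity:
  shows "\<bar>(LINT x|lebesgue. U x $ 3 * (a (x$1 / s) * b (x$2 / s) * \<Theta>'' (x$3 / h)))\<bar> \<le> h\<^sup>2 / s * (2 * M ^ 3 * Y)"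
proof -
  let ?\<psi> = "\<lambda>x::real^3. a (x$1 / s) * b (x$2 / s) * \<Theta>' (x$3 / h)"
  let ?I = "\<lambda>x. U x $ 3 * (a (x$1 / s) * b (x$2 / s) * \<Theta>'' (x$3 / h))"
  let ?I1 = "\<lambda>x. U x $ 1 * (a' (x$1 / s) * b (x$2 / s) * \<Theta>' (x$3 / h))"
  let ?I2 = "\<lambda>x. U x $ 2 * (a (x$1 / s) * b' (x$2 / s) * \<Theta>' (x$3 / h))"
  let ?\<psi>1 = "\<lambda>x::real^3. a' (x$1 / s) * b (x$2 / s) * \<Theta> (x$3 / h)"
  let ?\<psi>2 = "\<lambda>x::real^3. a (x$1 / s) * b' (x$2 / s) * \<Theta> (x$3 / h)"
  let ?D = "\<lambda>x::real^3. vector [a' (x$1 / s) / s * b (x$2 / s) * \<Theta>' (x$3 / h),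
      a (x$1 / s) * (b' (x$2 / s) / s) * \<Theta>' (x$3 / h), a (x$1 / s) * b (x$2 / s) * (\<Theta>'' (x$3 / h) / h)] :: real^3"
  have C: "C1_gradient ?\<psi> ?D"
    by (rule C1_gradient_product3[OF scaled_C2(1,3)[OF aC s] scaled_C2(1,3)[OF bC s] scaled_C2(2,4)[OF \<Theta>C h]])
  have out: "?\<psi> x = 0" "?\<psi>1 x = 0" "?\<psi>2 x = 0" if "x \<notin> gap_box s h" for x
  proof -
    have "(a (x$1 / s) = 0 \<and> a' (x$1 / s) = 0) \<or> (b (x$2 / s) = 0 \<and> b' (x$2 / s) = 0) \<or>
        (\<Theta> (x$3 / h) = 0 \<and> \<Theta>' (x$3 / h) = 0)"
      using outside_gap_box[OF that s h] a0 a0' b0 b0' \<Theta>0 \<Theta>0' less_imp_le by metis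
    then show "?\<psi> x = 0" "?\<psi>1 x = 0" "?\<psi>2 x = 0" by auto
  qed
  have bd: "bounded (gap_box s h)" by (simp add: gap_box_def bounded_cbox)
  have j: "U x $ 1 * ?D x $ 1 = (1 / s) * ?I1 x" "U x $ 2 * ?D x $ 2 = (1 / s) * ?I2 x"
     "U x $ 3 * ?D x $ 3 = (1 / h) * ?I x" for x by simp_all
  have div: "(LINT x|lebesgue. (1 / s) * ?I1 x) + (LINT x|lebesgue. (1 / s) * ?I2 x)
      + (LINT x|lebesgue. (1 / h) * ?I x) = 0"
  proof -
    have "(LINT x|lebesgue. \<Gamma> x $ 1 $ 1 * ?\<psi> x) + (LINT x|lebesgue. \<Gamma> x $ 2 $ 2 * ?\<psi> x)
      + (LINT x|lebesgue. \<Gamma> x $ 3 $ 3 * ?\<psi> x) = (LINT x|lebesgue. \<Gamma> x $ 1 $ 1 * ?\<psi> x + \<Gamma> x $ 2 $ 2 * ?\<psi> x + \<Gamma> x $ 3 $ 3 * ?\<psi> x)"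
      using gap_flow.gradient_integrable[OF flow C bd out(1), of 1 1] gap_flow.gradient_integrable[OF flow C bd out(1), of 2 2]
        gap_flow.gradient_integrable[OF flow C bd out(1), of 3 3] by simp
    also have "\<dots> = 0"
    proof (rule integral_eq_zero_AE)
      show "AE x in lebesgue. \<Gamma> x $ 1 $ 1 * ?\<psi> x + \<Gamma> x $ 2 $ 2 * ?\<psi> x + \<Gamma> x $ 3 $ 3 * ?\<psi> x = 0"
        using gap_flow.divergence_free[OF flow]
      proof eventually_elim
        case (elim x)
        then have "\<Gamma> x $ 1 $ 1 + \<Gamma> x $ 2 $ 2 + \<Gamma> x $ 3 $ 3 = 0" by (simp add: trace_def sum_3)
        then have "(\<Gamma> x $ 1 $ 1 + \<Gamma> x $ 2 $ 2 + \<Gamma> x $ 3 $ 3) * ?\<psi> x = 0" by simp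
        then show ?case by (simp only: distrib_right)
      qed
    qed
    finally show ?thesis
      using gap_flow.weak_identity[OF flow C bd out(1), of 1 1] gap_flow.weak_identity[OF flow C bd out(1), of 2 2]
        gap_flow.weak_identity[OF flow C bd out(1), of 3 3] unfolding j by linarith
  qed
  have C1: "C1_gradient ?\<psi>1 (\<lambda>x. vector [a'' (x$1 / s) / s * b (x$2 / s) * \<Theta> (x$3 / h),
      a' (x$1 / s) * (b' (x$2 / s) / s) * \<Theta> (x$3 / h), a' (x$1 / s) * b (x$2 / s) * (\<Theta>' (x$3 / h) / h)])"
    by (rule C1_gradient_product3[OF scaled_C2(2,4)[OF aC s] scaled_C2(1,3)[OF bC s] scaled_C2(1,3)[OF \<Theta>C h]])
  have C2: "C1_gradient ?\<psi>2 (\<lambda>x. vector [a' (x$1 / s) / s * b' (x$2 / s) * \<Theta> (x$3 / h),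
      a (x$1 / s) * (b'' (x$2 / s) / s) * \<Theta> (x$3 / h), a (x$1 / s) * b' (x$2 / s) * (\<Theta>' (x$3 / h) / h)])"
    by (rule C1_gradient_product3[OF scaled_C2(1,3)[OF aC s] scaled_C2(2,4)[OF bC s] scaled_C2(1,3)[OF \<Theta>C h]])
  have 1: "(LINT x|lebesgue. (1 / h) * ?I1 x) = - (LINT x|lebesgue. \<Gamma> x $ 1 $ 3 * ?\<psi>1 x)"
    using gap_flow.weak_identity[OF flow C1 bd out(2), of 1 3] by simp
  have 2: "(LINT x|lebesgue. (1 / h) * ?I2 x) = - (LINT x|lebesgue. \<Gamma> x $ 2 $ 3 * ?\<psi>2 x)"
    using gap_flow.weak_identity[OF flow C2 bd out(3), of 2 3] by simp
  have "\<bar>(LINT x|lebesgue. \<Gamma> x $ 1 $ 3 * ?\<psi>1 x)\<bar> \<le> M ^ 3 * Y"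
    by (rule weighted_gradient_bound[OF gap_flow.gradient_integrable[OF flow C1 bd out(2)] _ out(2)])
       (use prod3_bound bounds M_nonneg in auto)
  moreover have "\<bar>(LINT x|lebesgue. \<Gamma> x $ 2 $ 3 * ?\<psi>2 x)\<bar> \<le> M ^ 3 * Y"
    by (rule weighted_gradient_bound[OF gap_flow.gradient_integrable[OF flow C2 bd out(3)] _ out(3)])
       (use prod3_bound bounds M_nonneg in auto)
  ultimately have "\<bar>(LINT x|lebesgue. \<Gamma> x $ 1 $ 3 * ?\<psi>1 x) + (LINT x|lebesgue. \<Gamma> x $ 2 $ 3 * ?\<psi>2 x)\<bar> \<le> 2 * M ^ 3 * Y"
    by linarith
  moreover have "integral\<^sup>L lebesgue ?I = h\<^sup>2 / s * ((LINT x|lebesgue. \<Gamma> x $ 1 $ 3 * ?\<psi>1 x) + (LINT x|lebesgue. \<Gamma> x $ 2 $ 3 * ?\<psi>2 x))"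
  proof -
    have "integral\<^sup>L lebesgue ?I = - (h / s) * (integral\<^sup>L lebesgue ?I1 + integral\<^sup>L lebesgue ?I2)"
      using div s h by (simp add: field_simps)
    moreover have "integral\<^sup>L lebesgue ?I1 = - h * (LINT x|lebesgue. \<Gamma> x $ 1 $ 3 * ?\<psi>1 x)"
      using 1 h by (simp add: field_simps)
    moreover have "integral\<^sup>L lebesgue ?I2 = - h * (LINT x|lebesgue. \<Gamma> x $ 2 $ 3 * ?\<psi>2 x)"
      using 2 h by (simp add: field_simps)
    ultimately show ?thesis by (simp add: power2_eq_square algebra_simps)
  qed
  moreover have "\<bar>h\<^sup>2 / s * z\<bar> \<le> h\<^sup>2 / s * B" if "\<bar>z\<bar> \<le> B" for z B
    using s that by (simp add: abs_mult divide_right_mono mult_left_mono)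
  ultimately show ?thesis by simp
qed

lemma rigid_on_top:
  "(LINT x|lebesgue. U x $ i * (a (x$1 / s) * b (x$2 / s) * \<Theta>'' (x$3 / h))) =
   (LINT x|lebesgue. (v + cross3 \<omega> (x - vector [0, 0, h])) $ i *
     (a (x$1 / s) * b (x$2 / s) * (indicator {1/2..5} (x$3 / h) * \<Theta>'' (x$3 / h))))"
proof -
  have ae: "AE x in lebesgue. U x $ i * (a (x$1 / s) * b (x$2 / s) * \<Theta>'' (x$3 / h)) =
     (v + cross3 \<omega> (x - vector [0, 0, h])) $ i *
     (a (x$1 / s) * b (x$2 / s) * (indicator {1/2..5} (x$3 / h) * \<Theta>'' (x$3 / h)))"
    using gap_flow.rigid_above[OF flow] gap_flow.zero_below[OF flow]
  proof eventually_elim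
    case (elim x)
    consider "\<bar>x$1\<bar> \<ge> s \<or> \<bar>x$2\<bar> \<ge> s" | "x$3 / h \<notin> {-2<..<-1}" "x$3 / h \<notin> {2<..<3}"
      | "\<bar>x$1\<bar> < s" "\<bar>x$2\<bar> < s" "x$3 / h \<in> {-2<..<-1}"
      | "\<bar>x$1\<bar> < s" "\<bar>x$2\<bar> < s" "x$3 / h \<in> {2<..<3}" by linarith
    then show ?case
    proof cases
      case 1
      then have "a (x$1 / s) = 0 \<or> b (x$2 / s) = 0" using a0[of "x$1 / s"] b0[of "x$2 / s"] s by (auto simp: abs_divide)
      then show ?thesis by auto
    next
      case 2
      then show ?thesis using \<Theta>0'' by simp
    next
      case 3
      then have "U x = 0" using elim(2) h by (simp add: field_simps)
      moreover have "x$3 / h \<notin> {1/2..5}" using 3(3) unfolding atLeastAtMost_iff greaterThanLessThan_iff by linarith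
      ultimately show ?thesis by (simp only: indicator_simps) simp
    next
      case 4
      then have "U x = v + cross3 \<omega> (x - vector [0, 0, h])" using elim(1) h by (simp add: field_simps)
      moreover have "x$3 / h \<in> {1/2..5}" using 4(3) unfolding atLeastAtMost_iff greaterThanLessThan_iff by linarith
      ultimately show ?thesis by (simp only: indicator_simps mult_1)
    qed
  qed
  note m = borel_measurable_integrable[OF vertical_identity(1)[of i]]
  show ?thesis by (rule integral_cong_AE[OF m borel_measurable_AE[OF m ae] ae])
qed

end

lemma integrable_bounded_real:
  fixes f :: "real \<Rightarrow> real"
  assumes f: "continuous_on UNIV f" "\<And>t. t \<notin> {l..r} \<Longrightarrow> f t = 0"
  shows "integrable lborel f" "\<exists>B. \<forall>t. \<bar>f t\<bar> \<le> B"
proof -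
  have "(\<lambda>x. indicator {l..r} x *\<^sub>R f x) = f" using f(2) by (fastforce simp: indicator_def)
  then show "integrable lborel f"
    using borel_integrable_compact[of "{l..r}" f] continuous_on_subset[OF f(1)] by simp
  have "bounded (f ` {l..r})"
    by (intro compact_imp_bounded compact_continuous_image continuous_on_subset[OF f(1)]) auto
  then obtain B where B: "\<And>t. t \<in> {l..r} \<Longrightarrow> \<bar>f t\<bar> \<le> B" unfolding bounded_iff real_norm_def by blast
  have "\<bar>f t\<bar> \<le> max B 0" for t
    using B[of t] f(2)[of t] by (cases "t \<in> {l..r}") auto
  then show "\<exists>B. \<forall>t. \<bar>f t\<bar> \<le> B" by blast
qed

lemma integral_odd_eq_0:
  fixes f :: "real \<Rightarrow> real"
  assumes "\<And>t. f (- t) = - f t"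
  shows "integral\<^sup>L lborel f = 0"
  using lborel_integral_real_affine[of "-1" f 0] assms by simp

lemma integral_ge_on_interval:
  fixes f :: "real \<Rightarrow> real"
  assumes "integrable lborel f" "\<And>t. f t \<ge> 0" "\<And>t. t \<in> {l..r} \<Longrightarrow> f t \<ge> c" "l \<le> r"
  shows "c * (r - l) \<le> integral\<^sup>L lborel f"
proof -
  have "c * (r - l) = (LINT t|lborel. c * indicator {l..r} t)"
    using assms(4) by simp
  also have "\<dots> \<le> integral\<^sup>L lborel f"
  proof (rule integral_mono[OF _ assms(1)])
    show "integrable lborel (\<lambda>t. c * indicator {l..r} t :: real)"
      by (intro integrable_mult_right integrable_real_indicator) (auto simp: emeasure_lborel_Icc_eq)
    show "c * indicator {l..r} t \<le> f t" for t
      using assms(2,3)[of t] by (cases "t \<in> {l..r}") auto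
  qed
  finally show ?thesis .
qed

text \<open>With \<open>a\<close> even and \<open>b t = t a t\<close> odd, the weights \<open>a a\<close>, \<open>a b\<close>, \<open>b a\<close> applied to the affine components of the
rigid motion single out its value at \<open>P\<close> and the individual components of \<open>\<omega>\<close>. The height \<open>x\<^sub>3 - h\<close> enters the
horizontal components and cannot be removed by parity; it produces the terms \<open>h \<bar>\<omega>\<^sub>i\<bar>\<close>.\<close>

lemma gap_estimates:
  "\<exists>C>0. \<forall>s h Y U \<Gamma> v \<omega>. gap_flow s h Y U \<Gamma> v \<omega> \<longrightarrow> s > 0 \<longrightarrow> h > 0 \<longrightarrow>
     \<bar>v$3\<bar> \<le> C * (h / s ^ 3 * Y) \<and> \<bar>\<omega>$1\<bar> \<le> C * (h / s ^ 4 * Y) \<and> \<bar>\<omega>$2\<bar> \<le> C * (h / s ^ 4 * Y) \<and>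
     \<bar>\<omega>$3\<bar> \<le> C * (Y / s ^ 3) \<and> \<bar>v$1\<bar> \<le> C * (Y / s ^ 2 + h * \<bar>\<omega>$2\<bar>) \<and> \<bar>v$2\<bar> \<le> C * (Y / s ^ 2 + h * \<bar>\<omega>$1\<bar>)"
proof -
  obtain a a' a'' where a: "C2 a a' a''" "\<And>t. \<bar>t\<bar> \<ge> 1 \<Longrightarrow> a t = 0" "\<And>t. a (- t) = a t" "\<And>t. a t \<ge> 0"
    "\<And>t. \<bar>t\<bar> \<le> 1/2 \<Longrightarrow> a t \<ge> 27 / 64" by (rule horizontal_profile) blast
  define b where "b t = t * a t" for t
  have "C2 (\<lambda>t. (1 * t + 0) * a t) (\<lambda>t. 1 * a t + a' t * (1 * t + 0)) (\<lambda>t. 0 * a t + 2 * 1 * a' t + a'' t * (1 * t + 0))"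
    by (rule C2_mult[OF C2_affine a(1)])
  then obtain b' b'' where b: "C2 b b' b''" unfolding b_def[abs_def] by auto
  obtain \<Theta> \<Theta>' \<Theta>'' where \<Theta>: "C2 \<Theta> \<Theta>' \<Theta>''" "\<And>t. t \<notin> {-2..3} \<Longrightarrow> \<Theta> t = 0 \<and> \<Theta>' t = 0"
    "\<And>t. t \<notin> {-2<..<-1} \<Longrightarrow> t \<notin> {2<..<3} \<Longrightarrow> \<Theta>'' t = 0" "\<Theta>' (1/2) = 1" by (rule vertical_profile) blast
  have a0: "a t = 0" if "t \<notin> {-1..1}" for t using a(2)[of t] that by (auto simp: abs_if)
  have b0: "b t = 0" if "t \<notin> {-1..1}" for t using a0[OF that] by (simp add: b_def)
  have d0: "f' t = 0" if "C2 f f' f''" "\<And>t. t \<notin> {-1..1} \<Longrightarrow> f t = 0" "t \<notin> {-1..1}" for f f' f'' :: "real \<Rightarrow> real" and t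
    by (rule derivative_0_on_open[OF C2D(1)[OF that(1)], of "- {-1..1}"]) (use that in \<open>auto intro: open_Compl\<close>)
  obtain M where M: "\<And>t. \<bar>a t\<bar> \<le> M" "\<And>t. \<bar>a' t\<bar> \<le> M" "\<And>t. \<bar>b t\<bar> \<le> M" "\<And>t. \<bar>b' t\<bar> \<le> M"
    "\<And>t. \<bar>\<Theta> t\<bar> \<le> M" "\<And>t. \<bar>\<Theta>' t\<bar> \<le> M"
  proof -
    obtain B1 where B1: "\<forall>t. \<bar>a t\<bar> \<le> B1" using integrable_bounded_real(2)[OF C2D(3)[OF a(1)] a0] by blast
    obtain B2 where B2: "\<forall>t. \<bar>a' t\<bar> \<le> B2" using integrable_bounded_real(2)[OF C2D(4)[OF a(1)] d0[OF a(1) a0]] by blast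
    obtain B3 where B3: "\<forall>t. \<bar>b t\<bar> \<le> B3" using integrable_bounded_real(2)[OF C2D(3)[OF b] b0] by blast
    obtain B4 where B4: "\<forall>t. \<bar>b' t\<bar> \<le> B4" using integrable_bounded_real(2)[OF C2D(4)[OF b] d0[OF b b0]] by blast
    obtain B5 where B5: "\<forall>t. \<bar>\<Theta> t\<bar> \<le> B5" using integrable_bounded_real(2)[OF C2D(3)[OF \<Theta>(1)], of "-2" 3] \<Theta>(2) by blast
    obtain B6 where B6: "\<forall>t. \<bar>\<Theta>' t\<bar> \<le> B6" using integrable_bounded_real(2)[OF C2D(4)[OF \<Theta>(1)], of "-2" 3] \<Theta>(2) by blast
    show ?thesis
      by (rule that[of "max B1 (max B2 (max B3 (max B4 (max B5 B6))))"])
         (use B1 B2 B3 B4 B5 B6 in \<open>auto simp: le_max_iff_disj\<close>)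
  qed
  have M0: "M \<ge> 0" using order_trans[OF abs_ge_zero M(1)] .
  have Ha: "horizontal M a a' a''" unfolding horizontal_def using a(1,2) M by blast
  have Hb: "horizontal M b b' b''" unfolding horizontal_def b_def[symmetric] using b a(2) M by (auto simp: b_def)
  have V: "vertical M \<Theta> \<Theta>' \<Theta>''" unfolding vertical_def using \<Theta> M by blast
  \<comment> \<open>the part of \<open>\<Theta>''\<close> on the upper slab; the interval only has to separate the slabs and contain the upper one\<close>
  define \<tau> where "\<tau> t = indicator {1/2..5} t * \<Theta>'' t" for t
  have c\<tau>: "integrable lborel (\<lambda>t. f t * \<tau> t)" if "continuous_on UNIV f" for f
  proof -
    have "integrable lborel (\<lambda>t. indicator {1/2..5} t *\<^sub>R (f t * \<Theta>'' t))"
      by (intro borel_integrable_compact continuous_on_mult continuous_on_subset[OF that] continuous_on_subset[OF C2D(5)[OF \<Theta>(1)]]) auto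
    then show ?thesis by (simp add: \<tau>_def mult.left_commute)
  qed
  have \<tau>i: "integrable lborel \<tau>" "integrable lborel (\<lambda>t. (t - 1) * \<tau> t)"
    using c\<tau>[of "\<lambda>_. 1"] c\<tau>[OF continuous_on_diff[OF continuous_on_id continuous_on_const], of 1] by auto
  have J0: "integral\<^sup>L lborel \<tau> = - 1"
  proof -
    have "(\<integral>x. indicator {1/2..5} x *\<^sub>R \<Theta>'' x \<partial>lborel) = \<Theta>' 5 - \<Theta>' (1/2)"
    proof (rule integral_FTC_Icc)
      show "(\<Theta>' has_vector_derivative \<Theta>'' x) (at x within {1/2..5})" for x
        using C2D(2)[OF \<Theta>(1), of x] has_field_derivative_at_within has_real_derivative_iff_has_vector_derivative by blast
      show "continuous_on {1/2..5} \<Theta>''" by (rule continuous_on_subset[OF C2D(5)[OF \<Theta>(1)]]) simp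
    qed simp
    also have "\<dots> = - 1" using \<Theta>(2)[of 5] \<Theta>(4) by simp
    finally show ?thesis by (simp add: \<tau>_def[abs_def])
  qed
  define J1 where "J1 = (LINT t|lborel. (t - 1) * \<tau> t)"
  have bi: "integrable lborel b" using integrable_bounded_real(1)[OF C2D(3)[OF b] b0] .
  have ai: "integrable lborel a" using integrable_bounded_real(1)[OF C2D(3)[OF a(1)] a0] .
  have ai1: "integrable lborel (\<lambda>t. t * a t)" using bi by (simp add: b_def[abs_def])
  have bi1: "integrable lborel (\<lambda>t. t * b t)"
    by (rule integrable_bounded_real(1)[of _ "-1" 1]) (use b0 in \<open>auto intro!: continuous_intros C2D(3)[OF b]\<close>)
  define m0 where "m0 = integral\<^sup>L lborel a"
  define m2 where "m2 = (LINT t|lborel. t * b t)"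
  have ta0: "(LINT t|lborel. t * a t) = 0" by (rule integral_odd_eq_0) (simp add: a(3))
  have b00: "integral\<^sup>L lborel b = 0" by (rule integral_odd_eq_0) (simp add: a(3) b_def)
  have m0: "m0 > 0"
  proof -
    have "27 / 64 * (1/2 - (- 1/2)) \<le> m0"
      unfolding m0_def by (rule integral_ge_on_interval[OF ai]) (use a(4,5) in \<open>auto simp: abs_if\<close>)
    then show ?thesis by simp
  qed
  have m2: "m2 > 0"
  proof -
    have "27 / 1024 * (1/2 - 1/4) \<le> m2"
      unfolding m2_def
    proof (rule integral_ge_on_interval[OF bi1])
      show "0 \<le> t * b t" for t using a(4)[of t] mult_nonneg_nonneg[of "t * t" "a t"] by (simp add: b_def mult.assoc)
      show "27 / 1024 \<le> t * b t" if "t \<in> {1/4..1/2}" for t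
      proof -
        have "1/4 * (1/4) * (27/64) \<le> t * t * a t"
          using that a(5)[of t] by (intro mult_mono) auto
        then show ?thesis by (simp add: b_def mult.assoc)
      qed
    qed simp
    then show ?thesis by simp
  qed
  define C where "C = 2 * M ^ 3 / (m0 * m0) + 2 * M ^ 3 / (m0 * m2) + \<bar>J1\<bar> + 1"
  have Cpos: "C > 0" using M0 m0 m2 unfolding C_def by (intro add_nonneg_pos add_nonneg_nonneg) auto
  have C1: "2 * M ^ 3 / (m0 * m0) \<le> C" "2 * M ^ 3 / (m0 * m2) \<le> C" "\<bar>J1\<bar> \<le> C"
     "M ^ 3 / (m0 * m0) \<le> C" "M ^ 3 / (m0 * m2) \<le> C"
    using M0 m0 m2 unfolding C_def by (auto simp: field_simps intro!: add_nonneg_nonneg)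
  show ?thesis
  proof (intro exI conjI allI impI)
    show "C > 0" by (rule Cpos)
  next
    fix s h Y U \<Gamma> v \<omega>
    assume flow: "gap_flow s h Y U \<Gamma> v \<omega>" and s: "s > 0" and h: "h > 0"
    have Y: "Y \<ge> 0" using order_trans[OF integral_nonneg_AE gap_flow.column_bound[OF flow, of 1]] by simp
    let ?r = "\<lambda>x. v + cross3 \<omega> (x - vector [0, 0, h])"
    note mom = affine_moment[OF _ _ _ _ \<tau>i s h, folded J1_def, unfolded J0]
    note top = rigid_on_top[OF flow s h _ _ V, folded \<tau>_def]
    have r1: "?r x $ 1 = v$1 + 0 * x$1 + (- \<omega>$3) * x$2 + \<omega>$2 * (x$3 - h)" for x by (simp add: cross3_def algebra_simps)
    have r2: "?r x $ 2 = v$2 + \<omega>$3 * x$1 + 0 * x$2 + (- \<omega>$1) * (x$3 - h)" for x by (simp add: cross3_def algebra_simps)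
    have r3: "?r x $ 3 = v$3 + (- \<omega>$2) * x$1 + \<omega>$1 * x$2 + 0 * (x$3 - h)" for x by (simp add: cross3_def algebra_simps)
    have r3aa: "\<bar>s\<^sup>2 * h * (v$3 * (m0 * m0))\<bar> \<le> h\<^sup>2 / s * (2 * M ^ 3 * Y)"
      using flux_identity[OF flow s h Ha Ha V] unfolding top[OF Ha Ha] r3
        mom[OF ai ai1 ai ai1] by (simp add: m0_def ta0)
    have r3ab: "\<bar>s\<^sup>2 * h * (\<omega>$1 * s * (m0 * m2))\<bar> \<le> h\<^sup>2 / s * (2 * M ^ 3 * Y)"
      using flux_identity[OF flow s h Ha Hb V] unfolding top[OF Ha Hb] r3
        mom[OF ai ai1 bi bi1] by (simp add: m0_def m2_def ta0 b00)
    then have r3ab': "\<bar>s\<^sup>2 * h * s * (\<omega>$1 * (m0 * m2))\<bar> \<le> h\<^sup>2 / s * (2 * M ^ 3 * Y)"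
      by (simp only: ac_simps)
    have r3ba: "\<bar>s\<^sup>2 * h * (\<omega>$2 * s * (m0 * m2))\<bar> \<le> h\<^sup>2 / s * (2 * M ^ 3 * Y)"
      using flux_identity[OF flow s h Hb Ha V] unfolding top[OF Hb Ha] r3
        mom[OF bi bi1 ai ai1] by (simp add: m0_def m2_def ta0 b00 mult.commute)
    then have r3ba': "\<bar>s\<^sup>2 * h * s * (\<omega>$2 * (m0 * m2))\<bar> \<le> h\<^sup>2 / s * (2 * M ^ 3 * Y)"
      by (simp only: ac_simps)
    have r1aa: "\<bar>s\<^sup>2 * h * ((\<omega>$2 * h * J1 - v$1) * (m0 * m0))\<bar> \<le> h * (M ^ 3 * Y)"
      using vertical_identity(2)[OF flow s h Ha Ha V, of 1] unfolding top[OF Ha Ha] r1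
        mom[OF ai ai1 ai ai1] by (simp add: m0_def ta0 algebra_simps)
    have r2aa: "\<bar>s\<^sup>2 * h * ((\<omega>$1 * h * J1 + v$2) * (m0 * m0))\<bar> \<le> h * (M ^ 3 * Y)"
      using vertical_identity(2)[OF flow s h Ha Ha V, of 2] unfolding top[OF Ha Ha] r2
        mom[OF ai ai1 ai ai1] by (simp add: m0_def ta0 algebra_simps)
    have r2ba: "\<bar>s\<^sup>2 * h * (\<omega>$3 * s * (m0 * m2))\<bar> \<le> h * (M ^ 3 * Y)"
      using vertical_identity(2)[OF flow s h Hb Ha V, of 2] unfolding top[OF Hb Ha] r2
        mom[OF bi bi1 ai ai1] by (simp add: m0_def m2_def ta0 b00 mult.commute)
    then have r2ba': "\<bar>s\<^sup>2 * h * s * (\<omega>$3 * (m0 * m2))\<bar> \<le> h * (M ^ 3 * Y)"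
      by (simp only: ac_simps)
    have div: "\<bar>z\<bar> \<le> C * E" if "\<bar>k * (z * m)\<bar> \<le> B" "k > 0" "m > 0" "B / k = Z * E" "Z / m \<le> C" "E \<ge> 0" for z k m B E Z :: real
    proof -
      have "\<bar>z\<bar> * m \<le> B / k" using that by (simp add: abs_mult field_simps)
      then have "\<bar>z\<bar> \<le> Z / m * E" using that by (simp add: field_simps)
      also have "\<dots> \<le> C * E" using that by (intro mult_right_mono) auto
      finally show ?thesis .
    qed
    show "\<bar>v$3\<bar> \<le> C * (h / s ^ 3 * Y)"
      by (rule div[OF r3aa _ _ _ C1(1)]) (use s h m0 Y in \<open>auto simp: field_simps power2_eq_square power3_eq_cube\<close>)
    show "\<bar>\<omega>$1\<bar> \<le> C * (h / s ^ 4 * Y)"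
      by (rule div[OF r3ab' _ _ _ C1(2)])
         (use s h m0 m2 Y in \<open>auto simp: field_simps power2_eq_square power4_eq_xxxx\<close>)
    show "\<bar>\<omega>$2\<bar> \<le> C * (h / s ^ 4 * Y)"
      by (rule div[OF r3ba' _ _ _ C1(2)])
         (use s h m0 m2 Y in \<open>auto simp: field_simps power2_eq_square power4_eq_xxxx\<close>)
    show "\<bar>\<omega>$3\<bar> \<le> C * (Y / s ^ 3)"
      by (rule div[OF r2ba' _ _ _ C1(5)])
         (use s h m0 m2 Y in \<open>auto simp: field_simps power2_eq_square power3_eq_cube\<close>)
    have 1: "\<bar>\<omega>$2 * h * J1 - v$1\<bar> \<le> C * (Y / s ^ 2)"
      by (rule div[OF r1aa _ _ _ C1(4)]) (use s h m0 Y in \<open>auto simp: field_simps power2_eq_square\<close>)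
    have "\<bar>\<omega>$2 * h * J1\<bar> \<le> C * (h * \<bar>\<omega>$2\<bar>)"
      using mult_right_mono[OF C1(3), of "h * \<bar>\<omega>$2\<bar>"] h by (simp add: abs_mult mult.commute mult.left_commute)
    then show "\<bar>v$1\<bar> \<le> C * (Y / s ^ 2 + h * \<bar>\<omega>$2\<bar>)" using 1 unfolding distrib_left by linarith
    have 2: "\<bar>\<omega>$1 * h * J1 + v$2\<bar> \<le> C * (Y / s ^ 2)"
      by (rule div[OF r2aa _ _ _ C1(4)]) (use s h m0 Y in \<open>auto simp: field_simps power2_eq_square\<close>)
    have "\<bar>\<omega>$1 * h * J1\<bar> \<le> C * (h * \<bar>\<omega>$1\<bar>)"
      using mult_right_mono[OF C1(3), of "h * \<bar>\<omega>$1\<bar>"] h by (simp add: abs_mult mult.commute mult.left_commute)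
    then show "\<bar>v$2\<bar> \<le> C * (Y / s ^ 2 + h * \<bar>\<omega>$1\<bar>)" using 2 unfolding distrib_left by linarith
  qed
qed

text \<open>The gradient in the definition of \<^const>\<open>W1p0\<close> agrees with any given weak gradient almost everywhere.\<close>

lemma zero_extension_weak_gradient:
  fixes i j :: 3
  assumes p: "p \<ge> 1" and \<Omega>: "open \<Omega>" and u: "u \<in> W1p0 p \<Omega>" and G: "weak_gradient \<Omega> u G"
    and \<psi>: "C1_gradient \<psi> D" "bounded K" "\<And>x. x \<notin> K \<Longrightarrow> \<psi> x = 0"
  shows "integrable lebesgue (\<lambda>x. (indicator \<Omega> x *\<^sub>R u x) $ i * D x $ j)"
    and "integrable lebesgue (\<lambda>x. (indicator \<Omega> x *\<^sub>R G x) $ i $ j * \<psi> x)"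
    and "(LINT x|lebesgue. (indicator \<Omega> x *\<^sub>R u x) $ i * D x $ j)
       = - (LINT x|lebesgue. (indicator \<Omega> x *\<^sub>R G x) $ i $ j * \<psi> x)"
proof -
  obtain H \<phi> where H: "weak_gradient \<Omega> u H" "Lp p \<Omega> u" "Lp p \<Omega> H"
    and \<phi>: "\<And>n. test_function \<Omega> (\<phi> n)" "(\<lambda>n. Lp_norm p \<Omega> (\<lambda>x. \<phi> n x - u x)) \<longlonglongrightarrow> 0"
      "(\<lambda>n. Lp_norm p \<Omega> (\<lambda>x. jacobian (\<phi> n) (at x) - H x)) \<longlonglongrightarrow> 0"
    using u unfolding W1p0_def by blast
  note z = zero_extension_weak_derivative[OF p \<Omega> H(2,3) \<phi> \<psi>, of i j]
  have \<Omega>L: "\<Omega> \<inter> space lebesgue \<in> sets lebesgue" using \<Omega> by simp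
  have e1: "(\<lambda>x. indicator \<Omega> x *\<^sub>R (u x $ i * D x $ j)) = (\<lambda>x. (indicator \<Omega> x *\<^sub>R u x) $ i * D x $ j)"
    by (simp add: fun_eq_iff)
  have e2: "(\<lambda>x. indicator \<Omega> x *\<^sub>R (H x $ i $ j * \<psi> x)) = (\<lambda>x. (indicator \<Omega> x *\<^sub>R H x) $ i $ j * \<psi> x)"
    by (simp add: fun_eq_iff)
  show "integrable lebesgue (\<lambda>x. (indicator \<Omega> x *\<^sub>R u x) $ i * D x $ j)"
    using z(1) unfolding integrable_restrict_space[OF \<Omega>L] e1 .
  have iH: "integrable lebesgue (\<lambda>x. (indicator \<Omega> x *\<^sub>R H x) $ i $ j * \<psi> x)"
    using z(2) unfolding integrable_restrict_space[OF \<Omega>L] e2 .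
  have ae: "AE x in lebesgue. (indicator \<Omega> x *\<^sub>R H x) $ i $ j * \<psi> x = (indicator \<Omega> x *\<^sub>R G x) $ i $ j * \<psi> x"
    using weak_gradient_unique[OF \<Omega> H(1) G]
  proof eventually_elim
    case (elim x)
    then show ?case by (cases "x \<in> \<Omega>") auto
  qed
  note m = borel_measurable_integrable[OF iH]
  have m': "(\<lambda>x. (indicator \<Omega> x *\<^sub>R G x) $ i $ j * \<psi> x) \<in> borel_measurable lebesgue"
    by (rule borel_measurable_AE[OF m ae])
  show "integrable lebesgue (\<lambda>x. (indicator \<Omega> x *\<^sub>R G x) $ i $ j * \<psi> x)"
    using integrable_cong_AE[OF m m' ae] iH by blast
  have "(LINT x|lebesgue. (indicator \<Omega> x *\<^sub>R H x) $ i $ j * \<psi> x) = (LINT x|lebesgue. (indicator \<Omega> x *\<^sub>R G x) $ i $ j * \<psi> x)"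
    by (rule integral_cong_AE[OF m m' ae])
  then show "(LINT x|lebesgue. (indicator \<Omega> x *\<^sub>R u x) $ i * D x $ j)
       = - (LINT x|lebesgue. (indicator \<Omega> x *\<^sub>R G x) $ i $ j * \<psi> x)"
    using z(3) unfolding integral_restrict_space[OF \<Omega>L] e1 e2 by simp
qed

lemma measure_gap_box:
  assumes "s > 0" "h > 0"
  shows "measure lebesgue (gap_box s h) = 20 * s\<^sup>2 * h"
proof -
  have "gap_box s h \<noteq> {}"
    using assms by (auto simp: gap_box_def interval_eq_empty_cart forall_3 not_less)
  then have "measure lborel (gap_box s h) = 20 * s\<^sup>2 * h"
    unfolding gap_box_def content_cbox_cart[OF \<open>gap_box s h \<noteq> {}\<close>[unfolded gap_box_def]] UNIV_3
    by (simp add: power2_eq_square)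
  then show ?thesis by (simp add: gap_box_def)
qed

lemma norm_tangential_le: "norm (tangential x) \<le> \<bar>x$1\<bar> + \<bar>x$2\<bar>"
  using norm_le_l1_cart[of "tangential x"] by (simp add: tangential_def sum_2)

lemma norm_tangential_less:
  assumes "\<bar>x$1\<bar> \<le> s" "\<bar>x$2\<bar> \<le> s" "s > 0"
  shows "norm (tangential x) < 2 * s"
proof -
  have "(norm (tangential x))\<^sup>2 = (x $ 1)\<^sup>2 + (x $ 2)\<^sup>2"
    unfolding power2_norm_eq_inner inner_vec_def tangential_def
    by (simp add: sum_2 power2_eq_square)
  also have "\<dots> \<le> s\<^sup>2 + s\<^sup>2" using assms by (intro add_mono) (auto simp: abs_le_square_iff[symmetric])
  also have "\<dots> < (2 * s)\<^sup>2" using assms by (simp add: power2_eq_square)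
  finally show ?thesis by (rule power_less_imp_less_base) (use assms in auto)
qed

text \<open>On the box the gradient is controlled by its norm over the fluid part, by \<open>\<bar>\<omega>\<^sub>1\<bar> + \<bar>\<omega>\<^sub>2\<bar>\<close> on the body, and
it is zero outside the cavity; the boundary of the body has measure zero.\<close>

lemma gap_flow_of_rigid_body:
  assumes p: "p \<ge> 1" and \<Omega>: "open \<Omega>" and S: "open S" "S \<subseteq> \<Omega>" "negligible (frontier S)"
    and u: "u \<in> W1p0 p \<Omega>" "rigid_on S xs us \<omega> u" and G: "weak_gradient \<Omega> u G"
    and tr: "AE x in lebesgue_on \<Omega>. trace (G x) = 0" and s: "s > 0" and h: "h > 0"
    and top: "\<And>x. \<bar>x$1\<bar> < s \<Longrightarrow> \<bar>x$2\<bar> < s \<Longrightarrow> 2 * h < x$3 \<Longrightarrow> x$3 < 3 * h \<Longrightarrow> x \<in> S"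
    and bot: "\<And>x. \<bar>x$1\<bar> < s \<Longrightarrow> \<bar>x$2\<bar> < s \<Longrightarrow> - 2 * h < x$3 \<Longrightarrow> x$3 < - h \<Longrightarrow> x \<notin> \<Omega>"
    and V: "V = 20 * s\<^sup>2 * h" and N: "N = Lp_norm p (cylinder (2 * s) \<inter> (\<Omega> - closure S)) G"
  shows "gap_flow s h (2 * V powr (1 - 1 / p) * N + (\<bar>\<omega>$1\<bar> + \<bar>\<omega>$2\<bar>) * V)
    (\<lambda>x. indicator \<Omega> x *\<^sub>R u x) (\<lambda>x. indicator \<Omega> x *\<^sub>R G x) (us + cross3 \<omega> (vector [0, 0, h] - xs)) \<omega>"
proof -
  define U where "U x = indicator \<Omega> x *\<^sub>R u x" for x
  define \<Gamma> where "\<Gamma> x = indicator \<Omega> x *\<^sub>R G x" for x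
  define E where "E = cylinder (2 * s) \<inter> (\<Omega> - closure S)"
  define f where "f x = indicator E x *\<^sub>R G x" for x
  let ?Q = "gap_box s h"
  have \<Omega>L: "\<Omega> \<inter> space lebesgue \<in> sets lebesgue" using \<Omega> by simp
  have Lp\<Gamma>: "\<Gamma> \<in> borel_measurable lebesgue \<and> integrable lebesgue (\<lambda>x. norm (\<Gamma> x) powr p)"
  proof -
    obtain H where H: "weak_gradient \<Omega> u H" "Lp p \<Omega> H" using u(1) unfolding W1p0_def by blast
    have ae: "AE x in lebesgue. indicator \<Omega> x *\<^sub>R H x = \<Gamma> x"
      using weak_gradient_unique[OF \<Omega> H(1) G]
    proof eventually_elim
      case (elim x)
      then show ?case by (cases "x \<in> \<Omega>") (auto simp: \<Gamma>_def)
    qed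
    have m: "(\<lambda>x. indicator \<Omega> x *\<^sub>R H x) \<in> borel_measurable lebesgue"
      using H(2) borel_measurable_restrict_space_iff[OF \<Omega>L, of H] unfolding Lp_def by blast
    have m': "\<Gamma> \<in> borel_measurable lebesgue" by (rule borel_measurable_AE[OF m ae])
    have e: "(\<lambda>x. indicator \<Omega> x *\<^sub>R (norm (H x) powr p)) = (\<lambda>x. norm (indicator \<Omega> x *\<^sub>R H x) powr p)"
      using p by (auto simp: fun_eq_iff indicator_def)
    have "integrable lebesgue (\<lambda>x. norm (indicator \<Omega> x *\<^sub>R H x) powr p)"
      using H(2) unfolding Lp_def integrable_restrict_space[OF \<Omega>L] e by blast
    moreover have "AE x in lebesgue. norm (indicator \<Omega> x *\<^sub>R H x) powr p = norm (\<Gamma> x) powr p"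
      using ae by eventually_elim simp
    moreover have "(\<lambda>x. norm (indicator \<Omega> x *\<^sub>R H x) powr p) \<in> borel_measurable lebesgue"
      "(\<lambda>x. norm (\<Gamma> x) powr p) \<in> borel_measurable lebesgue"
      using m m' by measurable
    ultimately show ?thesis using m' integrable_cong_AE by blast
  qed
  have "open (cylinder (2 * s))"
    unfolding cylinder_def norm_tangential by (intro open_Collect_less continuous_intros)
  then have "open E" unfolding E_def using \<Omega> by (intro open_Int open_Diff) auto
  then have EL: "E \<inter> space lebesgue \<in> sets lebesgue" by simp
  have f\<Gamma>: "f = (\<lambda>x. indicator E x *\<^sub>R \<Gamma> x)" by (auto simp: f_def \<Gamma>_def E_def fun_eq_iff indicator_def)
  have nf: "(\<lambda>x. norm (f x) powr p) = (\<lambda>x. indicator E x *\<^sub>R (norm (\<Gamma> x) powr p))"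
    unfolding f\<Gamma> using p by (auto simp: fun_eq_iff indicator_def)
  have nfG: "(\<lambda>x. norm (f x) powr p) = (\<lambda>x. indicator E x *\<^sub>R (norm (G x) powr p))"
    unfolding f_def using p by (auto simp: fun_eq_iff indicator_def)
  have fm: "f \<in> borel_measurable lebesgue"
    unfolding f\<Gamma> using Lp\<Gamma> EL by (intro borel_measurable_scaleR borel_measurable_indicator) auto
  have fi: "integrable lebesgue (\<lambda>x. norm (f x) powr p)"
    unfolding nf using Lp\<Gamma> EL by (intro integrable_mult_indicator) auto
  have QL: "?Q \<in> sets lebesgue" by (simp add: gap_box_def)
  have Qf: "emeasure lebesgue ?Q < \<infinity>" using emeasure_bounded_finite[of ?Q] by (simp add: gap_box_def bounded_cbox)
  have Qm: "measure lebesgue ?Q = V" using measure_gap_box[OF s h] V by simp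
  have Vpos: "V > 0" using V s h by simp
  note Hoe = integral_norm_le_Lp[OF p fm fi QL Qf _ Vpos, unfolded Qm, OF order_refl]
  have NN: "N = (LINT x|lebesgue. norm (f x) powr p) powr (1 / p)"
    unfolding N E_def[symmetric] Lp_norm_def integral_restrict_space[OF EL] nfG ..
  define b where "b = \<bar>\<omega>$1\<bar> + \<bar>\<omega>$2\<bar>"
  have iQ: "integrable lebesgue (\<lambda>x. b * indicator ?Q x :: real)"
    using QL Qf by (intro integrable_mult_right integrable_real_indicator)
  have rs: "AE x in lebesgue. x \<in> S \<longrightarrow> (\<forall>i j. G x $ i $ j = cross3 \<omega> (axis j 1) $ i)"
    by (rule weak_gradient_rigid[OF \<Omega> S(1,2) G u(2)])
  have fr: "AE x in lebesgue. x \<notin> frontier S"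
    using S(3) by (intro AE_not_in) (simp add: negligible_iff_null_sets)
  have ptw: "AE x in lebesgue. indicator ?Q x * \<bar>\<Gamma> x $ i $ 3\<bar> \<le> indicator ?Q x * norm (f x) + b * indicator ?Q x" for i
    using rs fr
  proof eventually_elim
    case (elim x)
    have b0: "b \<ge> 0" by (simp add: b_def)
    show ?case
    proof (cases "x \<in> ?Q \<and> x \<in> \<Omega>")
      case False
      then show ?thesis using b0 by (auto simp: \<Gamma>_def indicator_def)
    next
      case True
      show ?thesis
      proof (cases "x \<in> S")
        case inS: True
        have "\<bar>cross3 \<omega> (axis 3 1) $ i\<bar> \<le> b"
          using exhaust_3[of i] by (auto simp: b_def cross3_def axis_def)
        then have "\<bar>\<Gamma> x $ i $ 3\<bar> \<le> b" using elim(1) inS True by (simp add: \<Gamma>_def)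
        then show ?thesis using True norm_ge_zero[of "f x"] by (simp del: norm_ge_zero)
      next
        case False
        then have "x \<notin> closure S" using elim(2) S(1) by (simp add: frontier_def interior_open)
        moreover have "x \<in> cylinder (2 * s)"
        proof -
          have "\<bar>x$1\<bar> \<le> s" "\<bar>x$2\<bar> \<le> s" using True by (auto simp: gap_box_def mem_box_cart forall_3)
          then show ?thesis using norm_tangential_less[of x s] s by (simp add: cylinder_def)
        qed
        ultimately have "x \<in> E" using True by (simp add: E_def)
        then have "f x = \<Gamma> x" unfolding f\<Gamma> by simp
        moreover have "\<bar>\<Gamma> x $ i $ 3\<bar> \<le> norm (\<Gamma> x)"
          using component_le_norm_cart[of "\<Gamma> x $ i" 3] Finite_Cartesian_Product.norm_nth_le[of "\<Gamma> x" i] by simp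
        ultimately show ?thesis using True b0 by simp
      qed
    qed
  qed
  have int: "integrable lebesgue (\<lambda>x. indicator ?Q x * \<bar>\<Gamma> x $ i $ 3\<bar>)" for i
  proof (rule Bochner_Integration.integrable_bound[OF Bochner_Integration.integrable_add[OF Hoe(1) iQ]])
    have "(\<lambda>y::real^3^3. y $ i $ 3) \<in> borel_measurable borel"
      by (intro borel_measurable_continuous_onI continuous_on_component continuous_on_id)
    from measurable_compose[OF conjunct1[OF Lp\<Gamma>] this]
    show "(\<lambda>x. indicator ?Q x * \<bar>\<Gamma> x $ i $ 3\<bar>) \<in> borel_measurable lebesgue"
      using QL by (intro borel_measurable_times borel_measurable_indicator borel_measurable_abs)
    show "AE x in lebesgue. norm (indicator ?Q x * \<bar>\<Gamma> x $ i $ 3\<bar>)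
        \<le> norm (indicator ?Q x * norm (f x) + b * indicator ?Q x)"
      using ptw[of i] by eventually_elim (simp add: abs_mult)
  qed
  have bound: "(LINT x|lebesgue. indicator ?Q x * \<bar>\<Gamma> x $ i $ 3\<bar>) \<le> 2 * V powr (1 - 1 / p) * N + b * V" for i
  proof -
    have "(LINT x|lebesgue. indicator ?Q x * \<bar>\<Gamma> x $ i $ 3\<bar>)
        \<le> (LINT x|lebesgue. indicator ?Q x * norm (f x) + b * indicator ?Q x)"
      by (rule integral_mono_AE[OF int Bochner_Integration.integrable_add[OF Hoe(1) iQ] ptw])
    also have "\<dots> = (LINT x|lebesgue. indicator ?Q x * norm (f x)) + b * V"
      using Hoe(1) iQ QL by (simp add: Qm)
    also have "\<dots> \<le> 2 * V powr (1 - 1 / p) * N + b * V" using Hoe(2) unfolding NN by simp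
    finally show ?thesis .
  qed
  have rig: "AE x in lebesgue. \<bar>x$1\<bar> < s \<longrightarrow> \<bar>x$2\<bar> < s \<longrightarrow> 2 * h < x$3 \<longrightarrow> x$3 < 3 * h \<longrightarrow>
        U x = us + cross3 \<omega> (vector [0, 0, h] - xs) + cross3 \<omega> (x - vector [0, 0, h])"
    using u(2) unfolding rigid_on_def
  proof eventually_elim
    case (elim x)
    have "cross3 \<omega> (x - xs) = cross3 \<omega> (vector [0, 0, h] - xs) + cross3 \<omega> (x - vector [0, 0, h])"
      by (simp add: vec_eq_iff forall_3 cross3_def algebra_simps)
    then show ?case using elim top[of x] S(2) by (auto simp: U_def)
  qed
  have tr': "AE x in lebesgue. trace (\<Gamma> x) = 0"
  proof -
    have "AE x in lebesgue. x \<in> \<Omega> \<longrightarrow> trace (G x) = 0"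
      using tr unfolding AE_restrict_space_iff[OF \<Omega>L] by simp
    then show ?thesis
    proof eventually_elim
      case (elim x)
      then show ?case by (cases "x \<in> \<Omega>") (auto simp: \<Gamma>_def trace_def)
    qed
  qed
  have bot': "AE x in lebesgue. \<bar>x$1\<bar> < s \<longrightarrow> \<bar>x$2\<bar> < s \<longrightarrow> - 2 * h < x$3 \<longrightarrow> x$3 < - h \<longrightarrow> U x = 0"
    using bot by (intro AE_I2) (auto simp: U_def)
  show ?thesis
    unfolding U_def[symmetric] \<Gamma>_def[symmetric] b_def[symmetric]
  proof
    note z = zero_extension_weak_gradient[OF p \<Omega> u(1) G, folded U_def \<Gamma>_def]
    fix \<psi> D K and i j :: 3
    assume *: "C1_gradient \<psi> D" "bounded K" "\<And>x. x \<notin> K \<Longrightarrow> \<psi> x = 0"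
    show "integrable lebesgue (\<lambda>x. U x $ i * D x $ j)" by (rule z(1)[OF *])
    show "integrable lebesgue (\<lambda>x. \<Gamma> x $ i $ j * \<psi> x)" by (rule z(2)[OF *])
    show "(LINT x|lebesgue. U x $ i * D x $ j) = - (LINT x|lebesgue. \<Gamma> x $ i $ j * \<psi> x)"
      by (rule z(3)[OF *])
  qed (rule tr' rig bot' int bound)+
qed

section \<open>From the gap to the stated powers of the distance\<close>

text \<open>Here \<open>Y\<close> is the bound for the gradient integrals over the box, of volume \<open>20 s\<^sup>2 h\<close>. The estimates of \<open>w1\<close> and
\<open>w2\<close> contain \<open>b\<close> on the right with a factor at most \<open>1/2\<close>, so \<open>b \<le> 2 A\<close>, and then \<open>Y\<close> is of order \<open>s\<^sup>2 h A\<close> for the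
remaining ones.\<close>

lemma absorption:
  fixes h s A b C w1 w2 w3 v1 v2 v3 Y :: real
  assumes pos: "h > 0" "s > 0" "A \<ge> 0" "C > 0"
    and b: "b = \<bar>w1\<bar> + \<bar>w2\<bar>" and Y: "Y = 20 * s\<^sup>2 * h * (2 * A + b)"
    and small: "40 * C * (h / s)\<^sup>2 \<le> 1 / 2"
    and est: "\<bar>v3\<bar> \<le> C * (h / s ^ 3 * Y)" "\<bar>w1\<bar> \<le> C * (h / s ^ 4 * Y)" "\<bar>w2\<bar> \<le> C * (h / s ^ 4 * Y)"
      "\<bar>w3\<bar> \<le> C * (Y / s ^ 3)" "\<bar>v1\<bar> \<le> C * (Y / s ^ 2 + h * \<bar>w2\<bar>)" "\<bar>v2\<bar> \<le> C * (Y / s ^ 2 + h * \<bar>w1\<bar>)"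
  shows "\<bar>v3\<bar> \<le> 80 * C * (h\<^sup>2 / s * A)" "\<bar>v1\<bar> + \<bar>v2\<bar> \<le> 164 * C * (h * A)"
    "b \<le> 160 * C * ((h / s)\<^sup>2 * A)" "\<bar>w3\<bar> \<le> 80 * C * (h / s * A)"
proof -
  define q where "q = 40 * C * (h / s)\<^sup>2"
  have q: "0 \<le> q" "q \<le> 1 / 2" using pos small by (auto simp: q_def)
  have b0: "b \<ge> 0" by (simp add: b)
  have "C * (h / s ^ 4 * Y) = q / 2 * (2 * A + b)"
    using pos by (simp add: Y q_def power2_eq_square power4_eq_xxxx field_simps)
  then have b1: "b \<le> q * (2 * A + b)" using est(2,3) b by linarith
  have "q * b \<le> 1 / 2 * b" using q b0 by (intro mult_right_mono) auto
  then have b2: "b \<le> 4 * (q * A)" using b1 by (simp add: algebra_simps)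
  have "q * A \<le> 1 / 2 * A" using q pos by (intro mult_right_mono) auto
  then have b3: "b \<le> 2 * A" using b2 by linarith
  show "b \<le> 160 * C * ((h / s)\<^sup>2 * A)" using b2 by (simp add: q_def)
  have Y4: "Y \<le> 80 * s\<^sup>2 * h * A"
  proof -
    have "20 * s\<^sup>2 * h * (2 * A + b) \<le> 20 * s\<^sup>2 * h * (4 * A)"
      using b3 pos by (intro mult_left_mono) auto
    then show ?thesis by (simp add: Y)
  qed
  have "C * (h / s ^ 3 * Y) \<le> C * (h / s ^ 3 * (80 * s\<^sup>2 * h * A))"
    using Y4 pos by (intro mult_left_mono) auto
  also have "\<dots> = 80 * C * (h\<^sup>2 / s * A)" using pos by (simp add: power2_eq_square power3_eq_cube)
  finally show "\<bar>v3\<bar> \<le> 80 * C * (h\<^sup>2 / s * A)" using est(1) by linarith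
  have "C * (Y / s ^ 3) \<le> C * ((80 * s\<^sup>2 * h * A) / s ^ 3)"
    using Y4 pos by (intro mult_left_mono divide_right_mono) auto
  also have "\<dots> = 80 * C * (h / s * A)" using pos by (simp add: power2_eq_square power3_eq_cube)
  finally show "\<bar>w3\<bar> \<le> 80 * C * (h / s * A)" using est(4) by linarith
  have "Y / s ^ 2 \<le> (80 * s\<^sup>2 * h * A) / s ^ 2" using Y4 pos by (intro divide_right_mono) auto
  also have "\<dots> = 80 * h * A" using pos by (simp add: power2_eq_square)
  finally have Y5: "Y / s ^ 2 \<le> 80 * h * A" .
  have "\<bar>v1\<bar> + \<bar>v2\<bar> \<le> C * (2 * (Y / s ^ 2) + h * b)"
  proof -
    have "C * (z + h * \<bar>w2\<bar>) + C * (z + h * \<bar>w1\<bar>) = C * (2 * z + h * b)" for z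
      by (simp add: b algebra_simps)
    then show ?thesis using est(5,6) by (metis add_mono)
  qed
  also have "\<dots> \<le> C * (2 * (80 * h * A) + h * (2 * A))"
    using Y5 b3 pos by (intro mult_left_mono add_mono) auto
  also have "\<dots> \<le> 164 * C * (h * A)" using pos by (simp add: algebra_simps)
  finally show "\<bar>v1\<bar> + \<bar>v2\<bar> \<le> 164 * C * (h * A)" .
qed

text \<open>The bookkeeping of exponents: with \<open>e = 1/(1+\<alpha>)\<close> one has \<open>s\<close> of order \<open>h\<^sup>e\<close> and \<open>V\<close> of order
\<open>h\<^bsup>2e+1\<^esup>\<close>.\<close>

lemma gap_scaling:
  fixes p \<alpha> c0 h s V A N :: real
  assumes p: "p \<ge> 1" and \<alpha>: "0 < \<alpha>" and c0: "c0 > 0" and h: "h > 0"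
    and s: "s = c0 * h powr (1 / (1 + \<alpha>)) / 2" and V: "V = 20 * s\<^sup>2 * h" and A: "A = V powr (- 1 / p) * N"
  defines "\<kappa> \<equiv> (5 * c0\<^sup>2) powr (- 1 / p)"
  shows "h\<^sup>2 / s * A = 2 / c0 * \<kappa> * h powr ((1 + 2*\<alpha>) / (p * (1 + \<alpha>)) * (p - (3 + \<alpha>) / (1 + 2*\<alpha>))) * N"
    and "h * A = \<kappa> * h powr (1 / p * (p - (3 + \<alpha>) / (1 + \<alpha>))) * N"
    and "(h / s)\<^sup>2 * A = 4 / c0\<^sup>2 * \<kappa> * h powr (2*\<alpha> / (p * (1 + \<alpha>)) * (p - (3 + \<alpha>) / (2*\<alpha>))) * N"
    and "h / s * A = 2 / c0 * \<kappa> * h powr (\<alpha> / (p * (1 + \<alpha>)) * (p - (3 + \<alpha>) / \<alpha>)) * N"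
    and "(h / s)\<^sup>2 = 4 / c0\<^sup>2 * h powr (2 * \<alpha> / (1 + \<alpha>))"
proof -
  define e where "e = 1 / (1 + \<alpha>)"
  define d where "d = (3 + \<alpha>) / (p * (1 + \<alpha>))"
  have se: "s = c0 / 2 * h powr e" using s by (simp add: e_def)
  have "V = 5 * c0\<^sup>2 * (h powr (2 * e) * h powr 1)"
    using h by (simp add: V se power_mult_distrib powr_power power_divide mult.commute)
  also have "h powr (2 * e) * h powr 1 = h powr (2 * e + 1)" by (simp add: powr_add)
  also have "2 * e + 1 = (3 + \<alpha>) / (1 + \<alpha>)" using \<alpha> by (simp add: e_def field_simps)
  finally have V': "V = 5 * c0\<^sup>2 * h powr ((3 + \<alpha>) / (1 + \<alpha>))" .
  have "V powr (- 1 / p) = \<kappa> * (h powr ((3 + \<alpha>) / (1 + \<alpha>))) powr (- 1 / p)"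
    unfolding V' \<kappa>_def by (rule powr_mult)
  also have "(h powr ((3 + \<alpha>) / (1 + \<alpha>))) powr (- 1 / p) = h powr (- d)"
    by (simp add: powr_powr d_def mult.commute)
  finally have A': "A = \<kappa> * h powr (- d) * N" using A by simp
  have comb: "h powr x * h powr (- d) = h powr (x - d)" for x by (simp add: powr_diff powr_minus divide_inverse)
  have hs: "h / s = 2 / c0 * h powr (1 - e)" using h c0 by (simp add: se powr_diff field_simps)
  have e1: "1 - e = \<alpha> / (1 + \<alpha>)" using \<alpha> by (simp add: e_def field_simps)
  have hs2: "(h / s)\<^sup>2 = 4 / c0\<^sup>2 * h powr (2 * (1 - e))"
    unfolding hs using h by (simp add: power_mult_distrib powr_power power_divide mult.commute)
  then show "(h / s)\<^sup>2 = 4 / c0\<^sup>2 * h powr (2 * \<alpha> / (1 + \<alpha>))" unfolding e1 by simp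
  have hhs: "h\<^sup>2 / s = 2 / c0 * h powr (2 - e)"
    using h c0 by (simp add: se powr_diff field_simps powr_numeral)
  have x1: "(1 + 2*\<alpha>) / (p * (1 + \<alpha>)) * (p - (3 + \<alpha>) / (1 + 2*\<alpha>)) = 2 - e - d"
    using p \<alpha> by (simp add: e_def d_def divide_simps)
  have x2: "1 / p * (p - (3 + \<alpha>) / (1 + \<alpha>)) = 1 - d"
    using p \<alpha> by (simp add: d_def divide_simps)
  have x3: "2*\<alpha> / (p * (1 + \<alpha>)) * (p - (3 + \<alpha>) / (2*\<alpha>)) = 2 * (1 - e) - d"
    unfolding e1 using p \<alpha> by (simp add: d_def divide_simps)
  have x4: "\<alpha> / (p * (1 + \<alpha>)) * (p - (3 + \<alpha>) / \<alpha>) = 1 - e - d"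
    unfolding e1 using p \<alpha> by (simp add: d_def divide_simps)
  show "h\<^sup>2 / s * A = 2 / c0 * \<kappa> * h powr ((1 + 2*\<alpha>) / (p * (1 + \<alpha>)) * (p - (3 + \<alpha>) / (1 + 2*\<alpha>))) * N"
    unfolding x1 comb[symmetric] A' hhs by simp
  have "h * A = \<kappa> * (h powr 1 * h powr (- d)) * N" using h by (simp add: A')
  then show "h * A = \<kappa> * h powr (1 / p * (p - (3 + \<alpha>) / (1 + \<alpha>))) * N"
    unfolding x2 comb by simp
  show "(h / s)\<^sup>2 * A = 4 / c0\<^sup>2 * \<kappa> * h powr (2*\<alpha> / (p * (1 + \<alpha>)) * (p - (3 + \<alpha>) / (2*\<alpha>))) * N"
    unfolding x3 comb[symmetric] A' hs2 by simp
  show "h / s * A = 2 / c0 * \<kappa> * h powr (\<alpha> / (p * (1 + \<alpha>)) * (p - (3 + \<alpha>) / \<alpha>)) * N"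
    unfolding x4 comb[symmetric] A' hs by simp
qed

theorem theorem1p1:
  fixes p \<alpha> :: real and \<Omega>0 S0 :: "(real^3) set"
  assumes "p \<ge> 1" and "0 < \<alpha>" and "\<alpha> \<le> 1"
    and "domain3 \<Omega>0" and "interior (closure \<Omega>0) = \<Omega>0"
    and "domain3 S0" and "bounded S0"
    and "uniformly_C1alpha \<alpha> \<Omega>0" and "uniformly_C1alpha \<alpha> S0"
  shows "\<exists>Hs>0. \<exists>Cw>0. \<exists>c0>0.
    \<forall>f g \<Omega> S h xs u G us \<omega>.
      isometry f \<longrightarrow> isometry g \<longrightarrow> \<Omega> = f ` \<Omega>0 \<longrightarrow> S = g ` S0 \<longrightarrow> S \<subseteq> \<Omega> \<longrightarrow>
      h = setdist S (frontier \<Omega>) \<longrightarrow> 0 < h \<longrightarrow> h < diameter S \<longrightarrow>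
      0 \<in> frontier \<Omega> \<longrightarrow> vector [0, 0, h] \<in> frontier S \<longrightarrow>
      xs \<in> closure S \<longrightarrow> u \<in> W1p0_body p xs S \<Omega> \<longrightarrow> rigid_on S xs us \<omega> u \<longrightarrow>
      weak_gradient \<Omega> u G \<longrightarrow> (AE x in lebesgue_on \<Omega>. trace (G x) = 0) \<longrightarrow>
      h < Hs \<longrightarrow>
      (let uP = us + cross3 \<omega> (vector [0, 0, h] - xs);
           F = \<Omega> - closure S;
           \<sigma>h = c0 * h powr (1 / (1 + \<alpha>));
           N = Lp_norm p (cylinder \<sigma>h \<inter> F) G
       in \<bar>uP $ 3\<bar> \<le>
            Cw * h powr ((1 + 2*\<alpha>) / (p * (1 + \<alpha>)) * (p - (3 + \<alpha>) / (1 + 2*\<alpha>))) * N \<and>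
          norm (tangential uP) \<le>
            Cw * h powr (1 / p * (p - (3 + \<alpha>) / (1 + \<alpha>))) * N \<and>
          norm (tangential \<omega>) \<le>
            Cw * h powr (2*\<alpha> / (p * (1 + \<alpha>)) * (p - (3 + \<alpha>) / (2*\<alpha>))) * N \<and>
          \<bar>\<omega> $ 3\<bar> \<le>
            Cw * h powr (\<alpha> / (p * (1 + \<alpha>)) * (p - (3 + \<alpha>) / \<alpha>)) * N)"
proof -
  define \<beta> where "\<beta> = 1 + \<alpha>"
  have \<beta>: "\<beta> > 1" using assms(2) by (simp add: \<beta>_def)
  obtain k1 \<delta>1 where c1: "k1 > 0" "\<delta>1 > 0" "squeezed k1 \<delta>1 \<beta> (frontier \<Omega>0)"
    using uniformly_C1alpha_imp_squeezed[OF assms(8)] unfolding \<beta>_def by blast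
  obtain k2 \<delta>2 where c2: "k2 > 0" "\<delta>2 > 0" "squeezed k2 \<delta>2 \<beta> (frontier S0)"
    using uniformly_C1alpha_imp_squeezed[OF assms(9)] unfolding \<beta>_def by blast
  obtain C where C: "C > 0" and est: "\<And>s h Y U \<Gamma> v \<omega>. gap_flow s h Y U \<Gamma> v \<omega> \<Longrightarrow> s > 0 \<Longrightarrow> h > 0 \<Longrightarrow>
     \<bar>v$3\<bar> \<le> C * (h / s ^ 3 * Y) \<and> \<bar>\<omega>$1\<bar> \<le> C * (h / s ^ 4 * Y) \<and> \<bar>\<omega>$2\<bar> \<le> C * (h / s ^ 4 * Y) \<and>
     \<bar>\<omega>$3\<bar> \<le> C * (Y / s ^ 3) \<and> \<bar>v$1\<bar> \<le> C * (Y / s ^ 2 + h * \<bar>\<omega>$2\<bar>) \<and> \<bar>v$2\<bar> \<le> C * (Y / s ^ 2 + h * \<bar>\<omega>$1\<bar>)"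
    using gap_estimates by blast
  define k where "k = max k1 k2"
  define \<delta> where "\<delta> = min \<delta>1 \<delta>2"
  have k: "k > 0" "k1 \<le> k" "k2 \<le> k" and \<delta>: "\<delta> > 0" "\<delta> \<le> \<delta>1" "\<delta> \<le> \<delta>2"
    using c1 c2 by (auto simp: k_def \<delta>_def)
  \<comment> \<open>with this radius the boundaries deviate from their tangent planes by at most \<open>h\<close>\<close>
  define c0 where "c0 = (1 / k) powr (1 / \<beta>)"
  have c0: "c0 > 0" using k by (simp add: c0_def)
  define \<kappa> where "\<kappa> = (5 * c0\<^sup>2) powr (- 1 / p)"
  have \<kappa>: "\<kappa> > 0" using c0 by (simp add: \<kappa>_def)
  \<comment> \<open>the coefficients \<open>80\<close>, \<open>164\<close>, \<open>160\<close> after absorption, times the factors \<open>2 / c0\<close>, \<open>1\<close>, \<open>4 / c0\<^sup>2\<close> from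
    the scaling\<close>
  define Cw where "Cw = \<kappa> * C * (160 / c0 + 164 + 640 / c0\<^sup>2)"
  have Cw: "Cw > 0" unfolding Cw_def using \<kappa> C c0 by (intro mult_pos_pos add_pos_pos) auto
  have t0: "((\<lambda>h::real. h powr e) \<longlongrightarrow> 0) (at_right 0)" if "e > 0" for e
  proof -
    have "((\<lambda>h::real. h powr e) \<longlongrightarrow> 0 powr e) (at_right 0)"
      using that by (intro tendsto_powr2 tendsto_ident_at tendsto_const)
        (auto intro: eventually_mono[OF eventually_at_right_less])
    then show ?thesis by simp
  qed
  have "((\<lambda>h::real. c0 * h powr (1 / \<beta>)) \<longlongrightarrow> c0 * 0) (at_right 0)"
    using \<beta> by (intro tendsto_mult tendsto_const t0) simp
  then have e1: "\<forall>\<^sub>F h in at_right 0. c0 * h powr (1 / \<beta>) < \<delta>" using \<delta> by (intro order_tendstoD) auto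
  have "((\<lambda>h::real. 40 * C * (4 / c0\<^sup>2 * h powr (2 * \<alpha> / \<beta>))) \<longlongrightarrow> 40 * C * (4 / c0\<^sup>2 * 0)) (at_right 0)"
    using \<beta> assms(2) by (intro tendsto_mult tendsto_const t0) simp
  then have e2: "\<forall>\<^sub>F h in at_right 0. 40 * C * (4 / c0\<^sup>2 * h powr (2 * \<alpha> / \<beta>)) < 1 / 2" by (intro order_tendstoD) auto
  have e3: "\<forall>\<^sub>F h in at_right 0. 2 * h < \<delta>"
    using \<delta> by (auto simp: eventually_at_right_field intro!: exI[of _ "\<delta> / 2"])
  \<comment> \<open>in this order: the gap region fits into the cusps horizontally, absorption works, it fits vertically\<close>
  obtain Hs where Hs: "Hs > 0" and small: "\<And>h. 0 < h \<Longrightarrow> h < Hs \<Longrightarrow> c0 * h powr (1 / \<beta>) < \<delta> \<and>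
      40 * C * (4 / c0\<^sup>2 * h powr (2 * \<alpha> / \<beta>)) < 1 / 2 \<and> 2 * h < \<delta>"
    using eventually_conj[OF e1 eventually_conj[OF e2 e3]] unfolding eventually_at_right_field by blast
  show ?thesis
  proof (rule exI[of _ Hs], rule conjI[OF Hs], rule exI[of _ Cw], rule conjI[OF Cw], rule exI[of _ c0], rule conjI[OF c0],
      intro allI impI)
    fix f g \<Omega> S h xs u G us \<omega>
    assume f: "isometry f" and g: "isometry g" and \<Omega>: "\<Omega> = f ` \<Omega>0" and S: "S = g ` S0" and sub: "S \<subseteq> \<Omega>"
      and h: "h = setdist S (frontier \<Omega>)" "0 < h" "h < diameter S" and Q0: "0 \<in> frontier \<Omega>"
      and P: "vector [0, 0, h] \<in> frontier S" and xs: "xs \<in> closure S" and u: "u \<in> W1p0_body p xs S \<Omega>"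
      and rig: "rigid_on S xs us \<omega> u" and G: "weak_gradient \<Omega> u G"
      and tr: "AE x in lebesgue_on \<Omega>. trace (G x) = 0" and hH: "h < Hs"
    have o\<Omega>: "open \<Omega>" and oS: "open S"
      using assms(4,6) isometry_interior_image[OF f, of \<Omega>0] isometry_interior_image[OF g, of S0]
      unfolding domain3_def \<Omega> S by (metis interior_open open_interior)+
    have ic: "interior (closure \<Omega>) = \<Omega>"
      unfolding \<Omega> isometry_closure_image[OF f] isometry_interior_image[OF f] assms(5) ..
    have sq\<Omega>: "squeezed k1 \<delta>1 \<beta> (frontier \<Omega>)"
      unfolding \<Omega> isometry_frontier_image[OF f] by (rule squeezed_isometry[OF f c1(3)])
    have sqS: "squeezed k2 \<delta>2 \<beta> (frontier S)"
      unfolding S isometry_frontier_image[OF g] by (rule squeezed_isometry[OF g c2(3)])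
    note balls = gap_balls[OF sub h(1,2) Q0 P]
    have up: "cusp k2 \<delta>2 \<beta> (vector [0, 0, h]) (axis 3 1) \<subseteq> S"
      by (rule body_contains_cusp[OF oS sqS c2(1,2) \<beta> h(2) P balls(1)])
    have down: "cusp k1 \<delta>1 \<beta> 0 (- axis 3 1) \<inter> \<Omega> = {}"
      by (rule cavity_avoids_cusp[OF ic sq\<Omega> c1(1,2) \<beta> h(2) Q0 balls(2)])
    define \<sigma> where "\<sigma> = c0 * h powr (1 / \<beta>)"
    define s where "s = \<sigma> / 2"
    have \<sigma>: "\<sigma> > 0" "\<sigma> < \<delta>" and h2: "2 * h < \<delta>" using small[OF h(2) hH] c0 h(2) by (auto simp: \<sigma>_def)
    have s: "s > 0" "2 * s = \<sigma>" using \<sigma> by (auto simp: s_def)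
    have k\<sigma>: "k * \<sigma> powr \<beta> = h"
      using k h(2) \<beta> by (simp add: \<sigma>_def c0_def powr_mult powr_powr)
    have thin: "k' * norm (tangential x) powr \<beta> \<le> h" "norm (tangential x) < \<delta>"
      if "\<bar>x$1\<bar> < s" "\<bar>x$2\<bar> < s" "0 < k'" "k' \<le> k" for x k'
    proof -
      have n: "norm (tangential x) < \<sigma>" using norm_tangential_less[of x s] that s by simp
      then show "norm (tangential x) < \<delta>" using \<sigma> by simp
      have "k' * norm (tangential x) powr \<beta> \<le> k * \<sigma> powr \<beta>"
        using that n \<beta> k by (intro mult_mono powr_mono2) auto
      then show "k' * norm (tangential x) powr \<beta> \<le> h" using k\<sigma> by simp
    qed
    have top: "x \<in> S" if "\<bar>x$1\<bar> < s" "\<bar>x$2\<bar> < s" "2 * h < x$3" "x$3 < 3 * h" for x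
    proof -
      have "x \<in> cusp k2 \<delta>2 \<beta> (vector [0, 0, h]) (axis 3 1)"
        using thin[OF that(1,2) c2(1) k(3)] that h2 \<delta> by (intro in_vertical_cusp) auto
      then show ?thesis using up by blast
    qed
    have bot: "x \<notin> \<Omega>" if "\<bar>x$1\<bar> < s" "\<bar>x$2\<bar> < s" "- 2 * h < x$3" "x$3 < - h" for x
    proof -
      have "x \<in> cusp k1 \<delta>1 \<beta> 0 (- axis 3 1)"
        using thin[OF that(1,2) c1(1) k(2)] that h2 \<delta> by (intro in_downward_cusp) auto
      then show ?thesis using down by blast
    qed
    define V where "V = 20 * s\<^sup>2 * h"
    define N where "N = Lp_norm p (cylinder \<sigma> \<inter> (\<Omega> - closure S)) G"
    define v where "v = us + cross3 \<omega> (vector [0, 0, h] - xs)"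
    define A where "A = V powr (- 1 / p) * N"
    have V: "V > 0" using s h by (simp add: V_def)
    have N: "N \<ge> 0" by (simp add: N_def Lp_norm_def)
    have uW: "u \<in> W1p0 p \<Omega>" using u by (simp add: W1p0_body_def)
    have flow: "gap_flow s h (2 * V powr (1 - 1 / p) * N + (\<bar>\<omega>$1\<bar> + \<bar>\<omega>$2\<bar>) * V)
        (\<lambda>x. indicator \<Omega> x *\<^sub>R u x) (\<lambda>x. indicator \<Omega> x *\<^sub>R G x) v \<omega>"
      unfolding v_def
      by (rule gap_flow_of_rigid_body[OF assms(1) o\<Omega> oS sub negligible_squeezed[OF sqS c2(1,2) \<beta>] uW rig G tr s(1) h(2) top bot V_def])
         (auto simp: N_def s(2))
    have Y: "2 * V powr (1 - 1 / p) * N + (\<bar>\<omega>$1\<bar> + \<bar>\<omega>$2\<bar>) * V = 20 * s\<^sup>2 * h * (2 * A + (\<bar>\<omega>$1\<bar> + \<bar>\<omega>$2\<bar>))"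
    proof -
      have "V powr (1 - 1 / p) = V * V powr (- 1 / p)"
        using V by (simp add: powr_diff powr_minus divide_inverse)
      then show ?thesis unfolding A_def V_def[symmetric] by (simp add: algebra_simps)
    qed
    have A: "A \<ge> 0" using N by (simp add: A_def)
    have s': "s = c0 * h powr (1 / (1 + \<alpha>)) / 2" by (simp add: s_def \<sigma>_def \<beta>_def)
    note sc = gap_scaling[OF assms(1,2) c0 h(2) s' V_def A_def, folded \<kappa>_def]
    have sm: "40 * C * (h / s)\<^sup>2 \<le> 1 / 2"
      unfolding sc(5) using small[OF h(2) hH] by (simp add: \<beta>_def)
    note es = est[OF flow s(1) h(2)]
    note ab = absorption[OF h(2) s(1) A C refl Y sm, of "v$3" "\<omega>$3" "v$1" "v$2"]
    note ab = ab[OF conjunct1[OF es] conjunct1[OF conjunct2[OF es]] conjunct1[OF conjunct2[OF conjunct2[OF es]]]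
       conjunct1[OF conjunct2[OF conjunct2[OF conjunct2[OF es]]]]
       conjunct1[OF conjunct2[OF conjunct2[OF conjunct2[OF conjunct2[OF es]]]]]
       conjunct2[OF conjunct2[OF conjunct2[OF conjunct2[OF conjunct2[OF es]]]]]]
    have Cwle: "\<kappa> * C * (160 / c0) \<le> Cw" "\<kappa> * C * 164 \<le> Cw" "\<kappa> * C * (640 / c0\<^sup>2) \<le> Cw"
      unfolding Cw_def by (rule mult_left_mono; use \<kappa> C c0 in simp)+
    have fin: "z \<le> Cw * E * N" if "z \<le> c * C * (d * \<kappa> * E * N)" "\<kappa> * C * (c * d) \<le> Cw" "E \<ge> 0" for z c d E
    proof -
      have "c * C * (d * \<kappa> * E * N) = \<kappa> * C * (c * d) * (E * N)" by simp
      also have "\<dots> \<le> Cw * (E * N)" using that N by (intro mult_right_mono) auto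
      finally show ?thesis using that by (simp add: mult.assoc)
    qed
    let ?E1 = "h powr ((1 + 2*\<alpha>) / (p * (1 + \<alpha>)) * (p - (3 + \<alpha>) / (1 + 2*\<alpha>)))"
    let ?E2 = "h powr (1 / p * (p - (3 + \<alpha>) / (1 + \<alpha>)))"
    let ?E3 = "h powr (2*\<alpha> / (p * (1 + \<alpha>)) * (p - (3 + \<alpha>) / (2*\<alpha>)))"
    let ?E4 = "h powr (\<alpha> / (p * (1 + \<alpha>)) * (p - (3 + \<alpha>) / \<alpha>))"
    have 1: "\<bar>v$3\<bar> \<le> Cw * ?E1 * N"
      using ab(1) unfolding sc(1) by (rule fin) (use Cwle in auto)
    have "norm (tangential v) \<le> 164 * C * (h * A)" using ab(2) norm_tangential_le[of v] by linarith
    then have "norm (tangential v) \<le> 164 * C * (1 * \<kappa> * ?E2 * N)"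
      unfolding sc(2) by simp
    then have 2: "norm (tangential v) \<le> Cw * ?E2 * N"
      by (rule fin) (use Cwle in auto)
    have "norm (tangential \<omega>) \<le> 160 * C * ((h / s)\<^sup>2 * A)" using ab(3) norm_tangential_le[of \<omega>] by linarith
    then have 3: "norm (tangential \<omega>) \<le> Cw * ?E3 * N"
      unfolding sc(3) by (rule fin) (use Cwle in auto)
    have 4: "\<bar>\<omega>$3\<bar> \<le> Cw * ?E4 * N"
      using ab(4) unfolding sc(4) by (rule fin) (use Cwle in auto)
    show "let uP = us + cross3 \<omega> (vector [0, 0, h] - xs);
           F = \<Omega> - closure S;
           \<sigma>h = c0 * h powr (1 / (1 + \<alpha>));
           N = Lp_norm p (cylinder \<sigma>h \<inter> F) G
       in \<bar>uP $ 3\<bar> \<le> Cw * ?E1 * N \<and> norm (tangential uP) \<le> Cw * ?E2 * N \<and>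
          norm (tangential \<omega>) \<le> Cw * ?E3 * N \<and> \<bar>\<omega> $ 3\<bar> \<le> Cw * ?E4 * N"
      unfolding Let_def v_def[symmetric] \<beta>_def[symmetric] \<sigma>_def[symmetric] N_def[symmetric]
      using 1 2 3 4 unfolding \<beta>_def by blast
  qed
qed

end
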